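(* Let $\mathcal{A},\mathcal{B}$ be skew diagrams with $[\mathcal{A}]=[\mathcal{B}]$. Then: (1) $\pi_{nw}(\mathcal{A})=\pi_{nw}(\mathcal{B})$; (2) for every $i$, $nw_i(\mathcal{A})$ and $nw_i(\mathcal{B})$ decompose into the same number of ribbons; (3) for every $i$, $nw_i(\mathcal{A})$ and $nw_i(\mathcal{B})$ have the same arm length and the same leg length; (4) for every $i$, if $\tilde{\mathcal{A}}$ resp. $\tilde{\mathcal{B}}$ is obtained by removing the first $i$ northwest ribbons from $\mathcal{A}$ resp. $\mathcal{B}$, then $[\tilde{\mathcal{A}}]=[\tilde{\mathcal{B}}]$.
   Context: For $\mu\subseteq\lambda$ the skew diagram $\lambda/\mu$ is the set of boxes of $\lambda$ not in $\mu$ (matrix coordinates, up to translation); its skew character is $[\lambda/\mu]=\sum_\nu c(\lambda;\mu,\nu)[\nu]$ with $c$ the Littlewood–Richardson coefficients and $[\nu]$ irreducible characters of the symmetric group. Two skew diagrams are disconnected if no box of one shares a row or column with a box of the other. A ribbon is a connected skew diagram with no $2\times2$ square; a weak ribbon is a skew diagram all of whose connected components are ribbons. The arm (resp. leg) length of a weak ribbon is its number of columns (resp. rows) minus its number of component ribbons. Northwest ribbons: $nw_1(\mathcal{A})$ is the set of boxes $(i,j)\in\mathcal{A}$ with $(i-1,j-1)\notin\mathcal{A}$ (for connected $\mathcal{A}$, the ribbon along the northwest border from the lowest box of the leftmost column to the rightmost box of the top row; in general the union of those of the components), and $nw_{k+1}(\mathcal{A})$ is $nw_1$ of $\mathcal{A}$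 with $nw_1(\mathcal{A}),\dots,nw_k(\mathcal{A})$ removed; these are weak ribbons. $\pi_{nw}(\mathcal{A})=(|nw_1(\mathcal{A})|,|nw_2(\mathcal{A})|,\dots)$. *)

theory Defs
  imports Complex_Main "HOL-Combinatorics.Permutations" "HOL-Library.Function_Algebras"
begin

section \<open>Partitions and skew diagrams\<close>

definition is_partition :: "nat list \<Rightarrow> bool" where
  "is_partition nu \<longleftrightarrow> sorted_wrt (\<ge>) nu \<and> 0 \<notin> set nu"

definition partitions_of :: "nat \<Rightarrow> nat list set" where
  "partitions_of n = {nu. is_partition nu \<and> sum_list nu = n}"

definition part :: "nat list \<Rightarrow> nat \<Rightarrow> nat" where
  "part nu i = (if 1 \<le> i \<and> i \<le> length nu then nu ! (i - 1) else 0)"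

type_synonym box = "nat \<times> nat"

text \<open>Boxes carry matrix coordinates (row, column), both starting from 1.\<close>

definition diagram :: "nat list \<Rightarrow> box set" where
  "diagram nu = {(i, j). 1 \<le> i \<and> 1 \<le> j \<and> j \<le> part nu i}"

definition skew_shape :: "nat list \<Rightarrow> nat list \<Rightarrow> box set" where
  "skew_shape la mu = diagram la - diagram mu"

definition skew_diagram :: "box set \<Rightarrow> bool" where
  "skew_diagram A \<longleftrightarrow> (\<exists>la mu. is_partition la \<and> is_partition mu \<and>
     diagram mu \<subseteq> diagram la \<and> A = skew_shape la mu)"

section \<open>Littlewood--Richardson coefficients\<close>

definition semistandard :: "box set \<Rightarrow> (box \<Rightarrow> nat) \<Rightarrow> bool" where
  "semistandard A T \<longleftrightarrow>
     (\<forall>b\<in>A. 1 \<le> T b) \<and>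
     (\<forall>i j j'. (i, j) \<in> A \<longrightarrow> (i, j') \<in> A \<longrightarrow> j < j' \<longrightarrow> T (i, j) \<le> T (i, j')) \<and>
     (\<forall>i i' j. (i, j) \<in> A \<longrightarrow> (i', j) \<in> A \<longrightarrow> i < i' \<longrightarrow> T (i, j) < T (i', j))"

text \<open>The boxes up to and including \<open>b\<close> when every row is read from right to left, and the
  rows from top to bottom.\<close>

definition read_upto :: "box set \<Rightarrow> box \<Rightarrow> box set" where
  "read_upto A b = {c \<in> A. fst c < fst b \<or> fst c = fst b \<and> snd b \<le> snd c}"

definition lattice_reading :: "box set \<Rightarrow> (box \<Rightarrow> nat) \<Rightarrow> bool" where
  "lattice_reading A T \<longleftrightarrow>
     (\<forall>b\<in>A. \<forall>k\<ge>1. card {c \<in> read_upto A b. T c = k + 1} \<le> card {c \<in> read_upto A b. T c = k})"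

text \<open>Fillings are normalised to 0 outside the shape, so that they can be counted.\<close>

definition lr_tableaux :: "box set \<Rightarrow> nat list \<Rightarrow> (box \<Rightarrow> nat) set" where
  "lr_tableaux A nu = {T. (\<forall>b. b \<notin> A \<longrightarrow> T b = 0) \<and> semistandard A T \<and> lattice_reading A T \<and>
     (\<forall>k\<ge>1. card {b \<in> A. T b = k} = part nu k)}"

definition lr_coeff :: "nat list \<Rightarrow> nat list \<Rightarrow> nat list \<Rightarrow> nat" where
  "lr_coeff la mu nu = card (lr_tableaux (skew_shape la mu) nu)"

section \<open>Irreducible characters of the symmetric groups\<close>

text \<open>The complex group algebra of the permutations of \<open>{1..n}\<close> is modelled by complex functions
  on permutations. The irreducible character of a partition \<open>nu\<close> is the trace on the Specht
  module, i.e. on the left ideal generated by the Young symmetrizer of \<open>nu\<close>.\<close>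

type_synonym galg = "(nat \<Rightarrow> nat) \<Rightarrow> complex"

definition gscale :: "complex \<Rightarrow> galg \<Rightarrow> galg" where
  "gscale c f = (\<lambda>s. c * f s)"

interpretation galg: vector_space gscale
  by unfold_locales (auto simp: gscale_def fun_eq_iff algebra_simps)

definition left_translate :: "(nat \<Rightarrow> nat) \<Rightarrow> galg \<Rightarrow> galg" where
  "left_translate s f = (\<lambda>t. f (inv s \<circ> t))"

text \<open>Fills the diagram of \<open>nu\<close> with 1, 2, 3 and so on, row by row.\<close>

definition row_tableau :: "nat list \<Rightarrow> box \<Rightarrow> nat" where
  "row_tableau nu b = (\<Sum>k\<in>{1..<fst b}. part nu k) + snd b"

definition row_group :: "nat list \<Rightarrow> (nat \<Rightarrow> nat) set" where
  "row_group nu = {p. p permutes {1..sum_list nu} \<and>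
     (\<forall>b\<in>diagram nu. \<exists>c\<in>diagram nu. fst c = fst b \<and> p (row_tableau nu b) = row_tableau nu c)}"

definition column_group :: "nat list \<Rightarrow> (nat \<Rightarrow> nat) set" where
  "column_group nu = {q. q permutes {1..sum_list nu} \<and>
     (\<forall>b\<in>diagram nu. \<exists>c\<in>diagram nu. snd c = snd b \<and> q (row_tableau nu b) = row_tableau nu c)}"

definition young_symmetrizer :: "nat list \<Rightarrow> galg" where
  "young_symmetrizer nu = (\<lambda>s. \<Sum>p\<in>row_group nu. \<Sum>q\<in>column_group nu.
     if p \<circ> q = s then of_int (sign q) else 0)"

definition specht_module :: "nat list \<Rightarrow> galg set" where
  "specht_module nu =
     galg.span {left_translate s (young_symmetrizer nu) | s. s permutes {1..sum_list nu}}"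

text \<open>The choice of the basis is immaterial.\<close>

definition trace_on :: "galg set \<Rightarrow> (galg \<Rightarrow> galg) \<Rightarrow> complex" where
  "trace_on V L = (let B = (SOME B. galg.independent B \<and> galg.span B = V)
     in \<Sum>b\<in>B. galg.representation B (L b) b)"

definition irr_char :: "nat list \<Rightarrow> (nat \<Rightarrow> nat) \<Rightarrow> complex" where
  "irr_char nu s = trace_on (specht_module nu) (left_translate s)"

text \<open>A skew character is given together with the degree \<open>n\<close> of the symmetric group on which it
  lives: the permutations of \<open>{1..0}\<close> and of \<open>{1..1}\<close> are the same functions, so that without
  \<open>n\<close> the characters of the empty diagram and of a single box would be identified.\<close>

definition skew_character :: "box set \<Rightarrow> nat \<times> galg" where
  "skew_character A = (card A, \<lambda>s. if s permutes {1..card A}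
     then \<Sum>nu\<in>partitions_of (card A). of_nat (card (lr_tableaux A nu)) * irr_char nu s else 0)"

lemma skew_character_skew_shape:
  "skew_character (skew_shape la mu) =
    (card (skew_shape la mu), \<lambda>s. if s permutes {1..card (skew_shape la mu)}
      then \<Sum>nu\<in>partitions_of (card (skew_shape la mu)). of_nat (lr_coeff la mu nu) * irr_char nu s
      else 0)"
  unfolding skew_character_def lr_coeff_def by (rule refl)

section \<open>Ribbons\<close>

definition disconnected :: "box set \<Rightarrow> box set \<Rightarrow> bool" where
  "disconnected A B \<longleftrightarrow> (\<forall>b\<in>A. \<forall>c\<in>B. fst b \<noteq> fst c \<and> snd b \<noteq> snd c)"

definition connected_boxes :: "box set \<Rightarrow> bool" where
  "connected_boxes A \<longleftrightarrow> A \<noteq> {} \<and>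
     \<not> (\<exists>B C. B \<noteq> {} \<and> C \<noteq> {} \<and> A = B \<union> C \<and> disconnected B C)"

definition box_linked :: "box set \<Rightarrow> (box \<times> box) set" where
  "box_linked A = {(b, c). b \<in> A \<and> c \<in> A \<and> (fst b = fst c \<or> snd b = snd c)}"

definition components :: "box set \<Rightarrow> box set set" where
  "components A = A // (box_linked A)\<^sup>+"

definition ribbon :: "box set \<Rightarrow> bool" where
  "ribbon A \<longleftrightarrow> skew_diagram A \<and> connected_boxes A \<and>
     \<not> (\<exists>i j. {(i, j), (i, j + 1), (i + 1, j), (i + 1, j + 1)} \<subseteq> A)"

definition weak_ribbon :: "box set \<Rightarrow> bool" where
  "weak_ribbon A \<longleftrightarrow> skew_diagram A \<and> (\<forall>C\<in>components A. ribbon C)"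

text \<open>Only meant for weak ribbons, where all components are ribbons.\<close>

definition num_ribbons :: "box set \<Rightarrow> nat" where
  "num_ribbons A = card (components A)"

definition arm_length :: "box set \<Rightarrow> int" where
  "arm_length A = int (card (snd ` A)) - int (num_ribbons A)"

definition leg_length :: "box set \<Rightarrow> int" where
  "leg_length A = int (card (fst ` A)) - int (num_ribbons A)"

section \<open>Northwest ribbons\<close>

text \<open>Truncated subtraction is harmless, because coordinates of boxes of a skew diagram are
  positive.\<close>

definition nw1 :: "box set \<Rightarrow> box set" where
  "nw1 A = {(i, j) \<in> A. (i - 1, j - 1) \<notin> A}"

text \<open>The ribbons are numbered from 1; index 0 is a dummy.\<close>

fun nw :: "nat \<Rightarrow> box set \<Rightarrow> box set" where
  "nw 0 A = {}"
| "nw (Suc k) A = nw1 (A - (\<Union>m\<in>{1..k}. nw m A))"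

definition remove_nw :: "nat \<Rightarrow> box set \<Rightarrow> box set" where
  "remove_nw i A = A - (\<Union>m\<in>{1..i}. nw m A)"

definition pi_nw :: "box set \<Rightarrow> nat \<Rightarrow> nat" where
  "pi_nw A = (\<lambda>k. card (nw (k + 1) A))"

subsection \<open>Northwest ribbons are weak ribbons\<close>

definition box_convex :: "box set \<Rightarrow> bool" where
  "box_convex A \<longleftrightarrow> (\<forall>i j i' j' a b. (i, j) \<in> A \<longrightarrow> (i', j') \<in> A \<longrightarrow>
     i \<le> a \<longrightarrow> a \<le> i' \<longrightarrow> j \<le> b \<longrightarrow> b \<le> j' \<longrightarrow> (a, b) \<in> A)"

lemma part_antimono:
  assumes "is_partition nu" "1 \<le> i" "i \<le> i'"
  shows "part nu i' \<le> part nu i"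
proof (cases "i' \<le> length nu")
  case True
  then show ?thesis
    using assms unfolding part_def is_partition_def
    by (cases "i = i'") (auto simp: sorted_wrt_iff_nth_less)
qed (simp add: part_def)

lemma finite_diagram: "finite (diagram nu)"
proof -
  have "diagram nu \<subseteq> {1..length nu} \<times> {1..Max (part nu ` {1..length nu})}"
  proof
    fix x assume "x \<in> diagram nu"
    then obtain i j where x: "x = (i, j)" "1 \<le> i" "1 \<le> j" "j \<le> part nu i"
      by (auto simp: diagram_def)
    then have "i \<le> length nu" by (auto simp: part_def split: if_splits)
    moreover from this x have "part nu i \<le> Max (part nu ` {1..length nu})"
      by (intro Max_ge) auto
    with x(4) have "j \<le> Max (part nu ` {1..length nu})" by (rule order_trans)
    ultimately show "x \<in> {1..length nu} \<times> {1..Max (part nu ` {1..length nu})}"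
      using x by simp
  qed
  then show ?thesis by (rule finite_subset) auto
qed

lemma downset_nat:
  fixes S :: "nat set"
  assumes "finite S" "0 \<notin> S" "\<And>a b. a \<in> S \<Longrightarrow> 1 \<le> b \<Longrightarrow> b \<le> a \<Longrightarrow> b \<in> S"
  shows "S = {1..card S}"
proof (cases "S = {}")
  case False
  have "S = {1..Max S}"
  proof
    show "S \<subseteq> {1..Max S}"
    proof
      fix x assume "x \<in> S"
      moreover from this have "x \<noteq> 0" using assms(2) by metis
      ultimately show "x \<in> {1..Max S}" using assms(1) by auto
    qed
    show "{1..Max S} \<subseteq> S" using assms(3)[OF Max_in[OF assms(1) False]] by auto
  qed
  then show ?thesis by (metis card_atLeastAtMost diff_Suc_1)
qed simp

lemma downset_diagram:
  assumes "finite D" and pos: "\<And>i j. (i, j) \<in> D \<Longrightarrow> 1 \<le> i \<and> 1 \<le> j"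
    and down: "\<And>i j a b. (i, j) \<in> D \<Longrightarrow> 1 \<le> a \<Longrightarrow> a \<le> i \<Longrightarrow> 1 \<le> b \<Longrightarrow> b \<le> j \<Longrightarrow> (a, b) \<in> D"
  shows "\<exists>nu. is_partition nu \<and> diagram nu = D"
proof -
  define r where "r = (\<lambda>i. card {j. (i, j) \<in> D})"
  define h where "h = card {i. (i, 1) \<in> D}"
  have fin: "finite {j. (i, j) \<in> D}" for i
    by (rule finite_subset[OF _ finite_imageI[OF assms(1), of snd]]) force
  have row: "{j. (i, j) \<in> D} = {1..r i}" for i
    unfolding r_def
  proof (rule downset_nat[OF fin])
    show "0 \<notin> {j. (i, j) \<in> D}" using pos[of i 0] by auto
    show "b \<in> {j. (i, j) \<in> D}" if "a \<in> {j. (i, j) \<in> D}" "1 \<le> b" "b \<le> a" for a b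
      using that pos[of i a] down[of i a i b] by simp
  qed
  have finc: "finite {i. (i, 1) \<in> D}"
    by (rule finite_subset[OF _ finite_imageI[OF assms(1), of fst]]) force
  have col: "{i. (i, 1) \<in> D} = {1..h}"
    unfolding h_def
  proof (rule downset_nat[OF finc])
    show "0 \<notin> {i. (i, 1) \<in> D}" using pos[of 0 1] by auto
    show "b \<in> {i. (i, 1) \<in> D}" if "a \<in> {i. (i, 1) \<in> D}" "1 \<le> b" "b \<le> a" for a b
      using that down[of a 1 b 1] by simp
  qed
  have mem: "(i, j) \<in> D \<longleftrightarrow> 1 \<le> j \<and> j \<le> r i" for i j
    using row[of i] by auto
  have memc: "1 \<le> i \<and> i \<le> h \<longleftrightarrow> 1 \<le> r i" for i
  proof -
    have "i \<in> {1..h} \<longleftrightarrow> (i, 1) \<in> D" unfolding col[symmetric] by simp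
    then show ?thesis using mem[of i 1] by simp
  qed
  have mono: "r i' \<le> r i" if "1 \<le> i" "i \<le> i'" for i i'
  proof (cases "r i' = 0")
    case False
    then have "(i', r i') \<in> D" by (auto simp: mem)
    then have "(i, r i') \<in> D" using down[of i' "r i'" i "r i'"] that False by auto
    then show ?thesis by (simp add: mem)
  qed simp
  define nu where "nu = map r [1..<Suc h]"
  have part: "part nu i = r i" if "1 \<le> i" for i
    using that memc[of i] by (auto simp: part_def nu_def simp del: upt_Suc)
  have "is_partition nu"
    unfolding is_partition_def
  proof
    show "sorted_wrt (\<ge>) nu"
      unfolding nu_def sorted_wrt_iff_nth_less by (auto simp del: upt_Suc intro!: mono)
    show "0 \<notin> set nu"
    proof
      assume "0 \<in> set nu"
      then obtain i where "1 \<le> i" "i \<le> h" "r i = 0" unfolding nu_def by auto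
      then show False using memc[of i] by simp
    qed
  qed
  moreover have "diagram nu = D"
  proof -
    have "(i, j) \<in> diagram nu \<longleftrightarrow> (i, j) \<in> D" for i j
      using pos[of i j] part[of i] mem[of i j] by (auto simp: diagram_def)
    then show ?thesis by auto
  qed
  ultimately show ?thesis by blast
qed

lemma skew_diagram_iff:
  "skew_diagram A \<longleftrightarrow> finite A \<and> (\<forall>(i, j)\<in>A. 1 \<le> i \<and> 1 \<le> j) \<and> box_convex A"
proof
  assume "skew_diagram A"
  then obtain la mu where *: "is_partition la" "is_partition mu" "A = diagram la - diagram mu"
    by (auto simp: skew_diagram_def skew_shape_def)
  have "box_convex A"
    unfolding box_convex_def
  proof (intro allI impI)
    fix i j i' j' a b
    assume "(i, j) \<in> A" "(i', j') \<in> A" "i \<le> a" "a \<le> i'" "j \<le> b" "b \<le> j'"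
    with * part_antimono[of la a i'] part_antimono[of mu i a] show "(a, b) \<in> A"
      by (auto simp: diagram_def)
  qed
  with * finite_diagram show "finite A \<and> (\<forall>(i, j)\<in>A. 1 \<le> i \<and> 1 \<le> j) \<and> box_convex A"
    by (auto simp: diagram_def)
next
  assume A: "finite A \<and> (\<forall>(i, j)\<in>A. 1 \<le> i \<and> 1 \<le> j) \<and> box_convex A"
  define D where "D = {(i, j). 1 \<le> i \<and> 1 \<le> j \<and> (\<exists>(i', j')\<in>A. i \<le> i' \<and> j \<le> j')}"
  have "D \<subseteq> (\<Union>(i', j')\<in>A. {..i'} \<times> {..j'})" by (auto simp: D_def)
  moreover have "finite (\<Union>(i', j')\<in>A. {..i'} \<times> {..j'})" using A by auto
  ultimately have fin: "finite D" by (rule finite_subset)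
  have sub: "A \<subseteq> D" using A by (fastforce simp: D_def)
  have cv: "(a, b) \<in> A" if "(i, j) \<in> A" "(i', j') \<in> A" "i \<le> a" "a \<le> i'" "j \<le> b" "b \<le> j'"
    for i j i' j' a b using A that unfolding box_convex_def by blast
  have "\<exists>la. is_partition la \<and> diagram la = D"
  proof (rule downset_diagram)
    fix i j a b assume *: "(i, j) \<in> D" "1 \<le> a" "a \<le> i" "1 \<le> b" "b \<le> j"
    then obtain i' j' where "(i', j') \<in> A" "i \<le> i'" "j \<le> j'" by (auto simp: D_def)
    with * have "\<exists>(i', j')\<in>A. a \<le> i' \<and> b \<le> j'" by (intro bexI[of _ "(i', j')"]) auto
    with * show "(a, b) \<in> D" by (simp add: D_def)
  qed (use fin in \<open>auto simp: D_def\<close>)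
  then obtain la where la: "is_partition la" "diagram la = D" by blast
  have "\<exists>mu. is_partition mu \<and> diagram mu = D - A"
  proof (rule downset_diagram)
    fix i j a b assume *: "(i, j) \<in> D - A" "1 \<le> a" "a \<le> i" "1 \<le> b" "b \<le> j"
    then obtain i' j' where "(i', j') \<in> A" "i \<le> i'" "j \<le> j'" by (auto simp: D_def)
    with * have "\<exists>(i', j')\<in>A. a \<le> i' \<and> b \<le> j'" by (intro bexI[of _ "(i', j')"]) auto
    with * have "(a, b) \<in> D" by (simp add: D_def)
    moreover have "(a, b) \<notin> A"
      using * cv[of a b i' j' i j] \<open>(i', j') \<in> A\<close> \<open>i \<le> i'\<close> \<open>j \<le> j'\<close> by blast
    ultimately show "(a, b) \<in> D - A" by blast
  qed (use fin in \<open>auto simp: D_def\<close>)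
  then obtain mu where mu: "is_partition mu" "diagram mu = D - A" by blast
  show "skew_diagram A"
    unfolding skew_diagram_def skew_shape_def
    using la mu sub by (intro exI[of _ la] exI[of _ mu]) auto
qed

lemma skew_diagram_nw1:
  assumes "skew_diagram A"
  shows "skew_diagram (nw1 A)" "skew_diagram (A - nw1 A)"
proof -
  have A: "finite A" "\<And>i j. (i, j) \<in> A \<Longrightarrow> 1 \<le> i \<and> 1 \<le> j"
    "\<And>i j i' j' a b. (i, j) \<in> A \<Longrightarrow> (i', j') \<in> A \<Longrightarrow> i \<le> a \<Longrightarrow> a \<le> i' \<Longrightarrow> j \<le> b \<Longrightarrow> b \<le> j'
      \<Longrightarrow> (a, b) \<in> A"
    using assms unfolding skew_diagram_iff box_convex_def by blast+
  have sub: "nw1 A \<subseteq> A" by (auto simp: nw1_def)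
  show "skew_diagram (nw1 A)"
    unfolding skew_diagram_iff
  proof (intro conjI)
    show "box_convex (nw1 A)"
      unfolding box_convex_def
    proof (intro allI impI)
      fix i j i' j' a b
      assume *: "(i, j) \<in> nw1 A" "(i', j') \<in> nw1 A" "i \<le> a" "a \<le> i'" "j \<le> b" "b \<le> j'"
      then have ab: "(a, b) \<in> A" using A(3)[of i j i' j'] by (auto simp: nw1_def)
      have "(a - 1, b - 1) \<notin> A"
      proof
        assume ab': "(a - 1, b - 1) \<in> A"
        then have "(i' - 1, j' - 1) \<in> A"
          by (rule A(3)[of "a - 1" "b - 1" i' j' "i' - 1" "j' - 1"]) (use * in \<open>auto simp: nw1_def\<close>)
        then show False using * by (auto simp: nw1_def)
      qed
      then show "(a, b) \<in> nw1 A" using ab by (auto simp: nw1_def)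
    qed
  qed (use A(1,2) sub in \<open>auto intro: finite_subset\<close>)
  show "skew_diagram (A - nw1 A)"
    unfolding skew_diagram_iff
  proof (intro conjI)
    show "box_convex (A - nw1 A)"
      unfolding box_convex_def
    proof (intro allI impI)
      fix i j i' j' a b
      assume *: "(i, j) \<in> A - nw1 A" "(i', j') \<in> A - nw1 A" "i \<le> a" "a \<le> i'" "j \<le> b" "b \<le> j'"
      then have "(a, b) \<in> A" using A(3)[of i j i' j'] by auto
      moreover have "(a - 1, b - 1) \<in> A"
        by (rule A(3)[of "i - 1" "j - 1" "i' - 1" "j' - 1"]) (use * in \<open>auto simp: nw1_def\<close>)
      ultimately show "(a, b) \<in> A - nw1 A" by (auto simp: nw1_def)
    qed
  qed (use A(1,2) in \<open>auto\<close>)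
qed

lemma remove_nw_Suc: "remove_nw (Suc i) A = remove_nw i A - nw1 (remove_nw i A)"
proof -
  have "{1..Suc i} = insert (Suc i) {1..i}" by auto
  then show ?thesis by (auto simp: remove_nw_def)
qed

lemma skew_diagram_remove_nw: "skew_diagram A \<Longrightarrow> skew_diagram (remove_nw i A)"
proof (induction i)
  case 0
  then show ?case by (simp add: remove_nw_def)
next
  case (Suc i)
  then show ?case unfolding remove_nw_Suc by (intro skew_diagram_nw1)
qed

lemma equiv_box_linked: "equiv A ((box_linked A)\<^sup>+)"
proof -
  have 1: "(box_linked A)\<^sup>+ \<subseteq> A \<times> A"
    by (rule trancl_subset_Sigma) (auto simp: box_linked_def)
  have 2: "refl_on A ((box_linked A)\<^sup>+)"
    by (rule refl_onI) (auto simp: box_linked_def)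
  have "sym ((box_linked A)\<^sup>+)"
    by (rule sym_trancl) (auto simp: box_linked_def sym_def)
  with 1 2 show ?thesis by (simp add: equiv_def)
qed

lemma skew_diagram_component:
  assumes "skew_diagram A" "C \<in> components A"
  shows "skew_diagram C" "connected_boxes C" "C \<subseteq> A"
proof -
  have A: "finite A" "\<And>i j. (i, j) \<in> A \<Longrightarrow> 1 \<le> i \<and> 1 \<le> j"
    "\<And>i j i' j' a b. (i, j) \<in> A \<Longrightarrow> (i', j') \<in> A \<Longrightarrow> i \<le> a \<Longrightarrow> a \<le> i' \<Longrightarrow> j \<le> b \<Longrightarrow> b \<le> j'
      \<Longrightarrow> (a, b) \<in> A"
    using assms(1) unfolding skew_diagram_iff box_convex_def by blast+
  obtain x where x: "x \<in> A" "C = (box_linked A)\<^sup>+ `` {x}"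
    using assms(2) unfolding components_def by (auto elim: quotientE)
  show sub: "C \<subseteq> A"
    using assms(2) equiv_box_linked unfolding components_def by (meson in_quotient_imp_subset)
  have step: "c \<in> C" if "b \<in> C" "(b, c) \<in> box_linked A" for b c
    using that x by (auto intro: trancl_into_trancl)
  show "skew_diagram C"
    unfolding skew_diagram_iff
  proof (intro conjI)
    show "box_convex C"
      unfolding box_convex_def
    proof (intro allI impI)
      fix i j i' j' a b
      assume *: "(i, j) \<in> C" "(i', j') \<in> C" "i \<le> a" "a \<le> i'" "j \<le> b" "b \<le> j'"
      then have m: "(i, j) \<in> A" "(i', j') \<in> A" using sub by auto
      then have "(a, b) \<in> A" "(i, b) \<in> A"
        using * A(3)[OF m, of a b] A(3)[OF m, of i b] by auto
      then show "(a, b) \<in> C"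
        using m step[OF *(1), of "(i, b)"] step[of "(i, b)" "(a, b)"] by (auto simp: box_linked_def)
    qed
  qed (use A(1,2) sub in \<open>auto intro: finite_subset\<close>)
  show "connected_boxes C"
    unfolding connected_boxes_def
  proof
    have xC: "x \<in> C" using x by (auto simp: box_linked_def)
    then show "C \<noteq> {}" by auto
    have key: False if B: "x \<in> B" "D \<noteq> {}" "C = B \<union> D" "disconnected B D" for B D
    proof -
      have "y \<in> B" if "(x, y) \<in> (box_linked A)\<^sup>+" for y
        using that
      proof (induction rule: trancl_induct)
        case (base y)
        then have "y \<in> C" using step xC by blast
        with B base show ?case by (auto simp: disconnected_def box_linked_def)
      next
        case (step y z)
        then have "z \<in> C" using x by (auto intro: trancl_into_trancl)
        with B step show ?case by (auto simp: disconnected_def box_linked_def)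
      qed
      then have "C \<subseteq> B" using x by auto
      then obtain d where "d \<in> B" "d \<in> D" using B by blast
      then show False using B by (auto simp: disconnected_def)
    qed
    show "\<not> (\<exists>B D. B \<noteq> {} \<and> D \<noteq> {} \<and> C = B \<union> D \<and> disconnected B D)"
    proof
      assume "\<exists>B D. B \<noteq> {} \<and> D \<noteq> {} \<and> C = B \<union> D \<and> disconnected B D"
      then obtain B D where *: "B \<noteq> {}" "D \<noteq> {}" "C = B \<union> D" "disconnected B D" by blast
      then have "disconnected D B" by (metis disconnected_def)
      with * key[of B D] key[of D B] xC show False by auto
    qed
  qed
qed

lemma weak_ribbon_nw:
  assumes "skew_diagram A" "1 \<le> k"
  shows "weak_ribbon (nw k A)"
proof -
  obtain i where k: "k = Suc i" using assms(2) by (cases k) auto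
  define R where "R = remove_nw i A"
  have nw: "nw k A = nw1 R" by (simp add: k R_def remove_nw_def)
  have R: "skew_diagram (nw1 R)"
    unfolding R_def using assms(1) by (intro skew_diagram_nw1 skew_diagram_remove_nw)
  have "\<not> {(a, b), (a, b + 1), (a + 1, b), (a + 1, b + 1)} \<subseteq> nw1 R" for a b
    by (auto simp: nw1_def)
  then have "ribbon C" if "C \<in> components (nw1 R)" for C
    unfolding ribbon_def using skew_diagram_component[OF R that] by (meson subset_trans)
  with R show ?thesis by (simp add: weak_ribbon_def nw)
qed

end

theory Submission
  imports Defs
begin

text \<open>By Young's lemma the row symmetrizer of \<open>mu\<close> annihilates the Specht module of \<open>nu\<close> unless
  \<open>nu\<close> dominates \<open>mu\<close>, and for \<open>nu = mu\<close> it acts with rank one and nonzero trace. Hence the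
  irreducible characters are linearly independent, and a skew character determines its
  Littlewood--Richardson numbers. By Stembridge's proof of the Littlewood--Richardson rule, these
  numbers in turn determine, and are determined by, the numbers of semistandard tableaux of all
  contents, i.e. the skew Schur function.

  The skew Schur function determines its supersymmetric version, because the generating function
  of the fillings of a nonempty diagram by one horizontal strip \<open>x\<close> followed by one vertical strip
  \<open>y\<close> vanishes at \<open>y = -x\<close>. The boxes filled with \<open>x\<close> and \<open>y\<close> form an order ideal without two
  boxes on a diagonal, so they lie in the first northwest ribbon. For an arm length \<open>a\<close>, a leg
  length \<open>l\<close> and \<open>r\<close> components of this ribbon, the part of highest degree in \<open>x, y\<close> is therefore
  \<open>x\<^sup>a y\<^sup>l (x + y)\<^sup>r\<close> times the supersymmetric skew Schur function of the diagram with the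
  ribbon removed, which yields all assertions by induction.\<close>

section \<open>Independence of the irreducible characters\<close>

text \<open>No ring of symmetric functions is built: a generating function appears as a family of
  counts indexed by contents or strip sizes, and each identity between generating functions becomes
  a bijection, a sign-reversing involution or a double count. The obstacle is that the hypothesis
  speaks of traces while the conclusion speaks of the shape. Equality is therefore carried over to
  the numbers \<open>strip_fillings (hword ps)\<close>, the only data that pass directly to the
  diagram without its first ribbon; the induction runs on these numbers for all \<open>ps\<close>,
  and characters reappear only at its two ends. A single horizontal letter sees no more than the
  columns of the ribbon. The number of component ribbons needs no separate invariant: a ribbon has
  one box less than it has rows and columns together, so the size and the two projections of the
  weak ribbon determine it.\<close>

lemma sum_fun_apply: "(\<Sum>i\<in>I. f i) x = (\<Sum>i\<in>I. f i x)"
  for f :: "'i \<Rightarrow> 'a \<Rightarrow> 'b::comm_monoid_add"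
  by (induction I rule: infinite_finite_induct) auto

section \<open>The row tableau, its inverse and the row and column groups\<close>

lemma card_diagram_rows: "card {b \<in> diagram nu. fst b \<le> m} = (\<Sum>i = 1..m. part nu i)"
proof -
  have "{b \<in> diagram nu. fst b \<le> m} = (SIGMA i:{1..m}. {1..part nu i})"
    by (auto simp: diagram_def)
  then show ?thesis by simp
qed

lemma sum_part: "length nu \<le> m \<Longrightarrow> (\<Sum>i = 1..m. part nu i) = sum_list nu"
proof -
  assume m: "length nu \<le> m"
  have "(\<Sum>i = 1..m. part nu i) = (\<Sum>i = 1..length nu. part nu i)"
    using m by (intro sum.mono_neutral_right) (auto simp: part_def)
  also have "\<dots> = (\<Sum>i = 0..<length nu. nu ! i)"
    by (rule sum.reindex_bij_witness[of _ Suc "\<lambda>i. i - 1"]) (auto simp: part_def)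
  finally show ?thesis by (simp add: sum_list_sum_nth)
qed

lemma card_diagram: "card (diagram nu) = sum_list nu"
proof -
  have "{b \<in> diagram nu. fst b \<le> length nu} = diagram nu"
    by (auto simp: diagram_def part_def split: if_splits)
  then show ?thesis using card_diagram_rows[of nu "length nu"] sum_part[of nu] by simp
qed

lemma row_tableau_bij: "bij_betw (row_tableau nu) (diagram nu) {1..sum_list nu}"
proof -
  have less: "row_tableau nu (i, j) < row_tableau nu (i', j')"
    if "(i, j) \<in> diagram nu" "(i', j') \<in> diagram nu" "i < i'" for i j i' j'
  proof -
    have "(\<Sum>k = 1..<i. part nu k) + j \<le> (\<Sum>k = 1..<Suc i. part nu k)"
      using that by (auto simp: diagram_def)
    also have "\<dots> \<le> (\<Sum>k = 1..<i'. part nu k)" using that by (intro sum_mono2) auto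
    finally show ?thesis using that by (auto simp: diagram_def row_tableau_def)
  qed
  have "inj_on (row_tableau nu) (diagram nu)"
  proof (rule inj_onI)
    fix b c assume *: "b \<in> diagram nu" "c \<in> diagram nu" "row_tableau nu b = row_tableau nu c"
    obtain i j i' j' where bc: "b = (i, j)" "c = (i', j')" by fastforce
    have "i = i'" using less[of i j i' j'] less[of i' j' i j] * bc by fastforce
    then show "b = c" using * bc by (auto simp: row_tableau_def)
  qed
  moreover have "row_tableau nu ` diagram nu \<subseteq> {1..sum_list nu}"
  proof
    fix x assume "x \<in> row_tableau nu ` diagram nu"
    then obtain i j where x: "x = row_tableau nu (i, j)" "(i, j) \<in> diagram nu" by auto
    then have "i \<le> length nu" by (auto simp: diagram_def part_def split: if_splits)
    have "x \<le> (\<Sum>k = 1..<Suc i. part nu k)" using x by (auto simp: diagram_def row_tableau_def)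
    also have "\<dots> \<le> (\<Sum>k = 1..length nu. part nu k)"
      using \<open>i \<le> length nu\<close> by (intro sum_mono2) auto
    finally show "x \<in> {1..sum_list nu}"
      using x sum_part[of nu "length nu"] by (auto simp: diagram_def row_tableau_def)
  qed
  ultimately show ?thesis
    by (simp add: bij_betw_def card_image card_subset_eq card_diagram)
qed

text \<open>Passing from a number back to its box turns the conditions on row and column groups into
  invariance of a function on the numbers, so that both groups become instances of one kind of
  stabiliser.\<close>

definition tab_box :: "nat list \<Rightarrow> nat \<Rightarrow> box" where
  "tab_box nu = inv_into (diagram nu) (row_tableau nu)"

abbreviation row_of :: "nat list \<Rightarrow> nat \<Rightarrow> nat" where "row_of nu x \<equiv> fst (tab_box nu x)"
abbreviation col_of :: "nat list \<Rightarrow> nat \<Rightarrow> nat" where "col_of nu x \<equiv> snd (tab_box nu x)"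

lemma tab_box_row_tableau [simp]: "b \<in> diagram nu \<Longrightarrow> tab_box nu (row_tableau nu b) = b"
  using row_tableau_bij[of nu] by (simp add: tab_box_def bij_betw_def)

lemma row_tableau_tab_box [simp]:
  "x \<in> {1..sum_list nu} \<Longrightarrow> row_tableau nu (tab_box nu x) = x"
  using row_tableau_bij[of nu] unfolding tab_box_def bij_betw_def by (metis f_inv_into_f)

lemma tab_box_diagram: "x \<in> {1..sum_list nu} \<Longrightarrow> tab_box nu x \<in> diagram nu"
  using row_tableau_bij[of nu] unfolding tab_box_def bij_betw_def by (metis inv_into_into)

lemma row_tableau_range: "b \<in> diagram nu \<Longrightarrow> row_tableau nu b \<in> {1..sum_list nu}"
  using row_tableau_bij[of nu] unfolding bij_betw_def by blast

lemma tab_box_inj: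
  "x \<in> {1..sum_list nu} \<Longrightarrow> y \<in> {1..sum_list nu} \<Longrightarrow> tab_box nu x = tab_box nu y \<Longrightarrow> x = y"
  by (metis row_tableau_tab_box)

lemma row_group_iff:
  "p \<in> row_group nu \<longleftrightarrow> p permutes {1..sum_list nu} \<and>
     (\<forall>x\<in>{1..sum_list nu}. row_of nu (p x) = row_of nu x)"
proof (cases "p permutes {1..sum_list nu}")
  case True
  have "(\<forall>b\<in>diagram nu. \<exists>c\<in>diagram nu. fst c = fst b \<and> p (row_tableau nu b) = row_tableau nu c) \<longleftrightarrow>
    (\<forall>x\<in>{1..sum_list nu}. row_of nu (p x) = row_of nu x)" (is "?L \<longleftrightarrow> ?R")
  proof
    assume ?L
    show ?R
    proof
      fix x assume "x \<in> {1..sum_list nu}"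
      with \<open>?L\<close>[rule_format, of "tab_box nu x"] obtain c where
        "c \<in> diagram nu" "fst c = row_of nu x" "p x = row_tableau nu c"
        using tab_box_diagram by force
      then show "row_of nu (p x) = row_of nu x" by simp
    qed
  next
    assume ?R
    show ?L
    proof
      fix b assume b: "b \<in> diagram nu"
      let ?x = "row_tableau nu b"
      have "?x \<in> {1..sum_list nu}" "p ?x \<in> {1..sum_list nu}"
        using row_tableau_range[OF b] permutes_in_image[OF True] by blast+
      then show "\<exists>c\<in>diagram nu. fst c = fst b \<and> p ?x = row_tableau nu c"
        using \<open>?R\<close> b by (intro bexI[of _ "tab_box nu (p ?x)"]) (auto simp: tab_box_diagram)
    qed
  qed
  with True show ?thesis by (simp add: row_group_def)
qed (simp add: row_group_def)

lemma column_group_iff: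
  "p \<in> column_group nu \<longleftrightarrow> p permutes {1..sum_list nu} \<and>
     (\<forall>x\<in>{1..sum_list nu}. col_of nu (p x) = col_of nu x)"
proof (cases "p permutes {1..sum_list nu}")
  case True
  have "(\<forall>b\<in>diagram nu. \<exists>c\<in>diagram nu. snd c = snd b \<and> p (row_tableau nu b) = row_tableau nu c) \<longleftrightarrow>
    (\<forall>x\<in>{1..sum_list nu}. col_of nu (p x) = col_of nu x)" (is "?L \<longleftrightarrow> ?R")
  proof
    assume ?L
    show ?R
    proof
      fix x assume "x \<in> {1..sum_list nu}"
      with \<open>?L\<close>[rule_format, of "tab_box nu x"] obtain c where
        "c \<in> diagram nu" "snd c = col_of nu x" "p x = row_tableau nu c"
        using tab_box_diagram by force
      then show "col_of nu (p x) = col_of nu x" by simp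
    qed
  next
    assume ?R
    show ?L
    proof
      fix b assume b: "b \<in> diagram nu"
      let ?x = "row_tableau nu b"
      have "?x \<in> {1..sum_list nu}" "p ?x \<in> {1..sum_list nu}"
        using row_tableau_range[OF b] permutes_in_image[OF True] by blast+
      then show "\<exists>c\<in>diagram nu. snd c = snd b \<and> p ?x = row_tableau nu c"
        using \<open>?R\<close> b by (intro bexI[of _ "tab_box nu (p ?x)"]) (auto simp: tab_box_diagram)
    qed
  qed
  with True show ?thesis by (simp add: column_group_def)
qed (simp add: column_group_def)

definition stabiliser :: "nat \<Rightarrow> (nat \<Rightarrow> nat) \<Rightarrow> (nat \<Rightarrow> nat) set" where
  "stabiliser n f = {p. p permutes {1..n} \<and> (\<forall>x\<in>{1..n}. f (p x) = f x)}"

lemma row_group_stabiliser: "row_group nu = stabiliser (sum_list nu) (row_of nu)"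
  by (auto simp: stabiliser_def row_group_iff)

lemma column_group_stabiliser: "column_group nu = stabiliser (sum_list nu) (col_of nu)"
  by (auto simp: stabiliser_def column_group_iff)

lemma stabiliser_permutes: "p \<in> stabiliser n f \<Longrightarrow> p permutes {1..n}"
  by (simp add: stabiliser_def)

lemma finite_stabiliser: "finite (stabiliser n f)"
  by (rule finite_subset[OF _ finite_permutations[of "{1..n}"]]) (auto simp: stabiliser_def)

lemma id_stabiliser: "id \<in> stabiliser n f"
  by (simp add: stabiliser_def permutes_id)

lemma comp_stabiliser: "p \<in> stabiliser n f \<Longrightarrow> q \<in> stabiliser n f \<Longrightarrow> p \<circ> q \<in> stabiliser n f"
  by (auto simp: stabiliser_def permutes_compose permutes_in_image[of q "{1..n}", simplified])

lemma inv_stabiliser: "p \<in> stabiliser n f \<Longrightarrow> inv p \<in> stabiliser n f"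
proof -
  assume p: "p \<in> stabiliser n f"
  have "f (inv p x) = f x" if "x \<in> {1..n}" for x
  proof -
    have "inv p x \<in> {1..n}"
      using that p by (meson permutes_in_image permutes_inv stabiliser_permutes)
    then have "f (p (inv p x)) = f (inv p x)" using p by (auto simp: stabiliser_def)
    then show ?thesis using p stabiliser_permutes permutes_inverses(1) by metis
  qed
  then show ?thesis using p by (auto simp: stabiliser_def permutes_inv)
qed

lemma transpose_stabiliser:
  "x \<in> {1..n} \<Longrightarrow> y \<in> {1..n} \<Longrightarrow> f x = f y \<Longrightarrow> Transposition.transpose x y \<in> stabiliser n f"
  by (auto simp: stabiliser_def permutes_swap_id transpose_def)

lemma sum_stabiliser_right:
  assumes "q \<in> stabiliser n f"
  shows "(\<Sum>p\<in>stabiliser n f. F (p \<circ> q)) = (\<Sum>p\<in>stabiliser n f. F p)"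
proof (rule sum.reindex_bij_witness[of _ "\<lambda>p. p \<circ> inv q" "\<lambda>p. p \<circ> q"])
  have q: "q \<circ> inv q = id" "inv q \<circ> q = id"
    using permutes_inv_o[OF stabiliser_permutes[OF assms]] by auto
  show "p \<circ> q \<circ> inv q = p" "p \<circ> inv q \<circ> q = p" for p by (simp_all add: o_assoc[symmetric] q)
qed (use assms in \<open>auto intro: comp_stabiliser inv_stabiliser\<close>)

lemma sum_stabiliser_left:
  assumes "q \<in> stabiliser n f"
  shows "(\<Sum>p\<in>stabiliser n f. F (q \<circ> p)) = (\<Sum>p\<in>stabiliser n f. F p)"
proof (rule sum.reindex_bij_witness[of _ "\<lambda>p. inv q \<circ> p" "\<lambda>p. q \<circ> p"])
  have q: "q \<circ> inv q = id" "inv q \<circ> q = id"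
    using permutes_inv_o[OF stabiliser_permutes[OF assms]] by auto
  show "inv q \<circ> (q \<circ> p) = p" "q \<circ> (inv q \<circ> p) = p" for p by (simp_all add: o_assoc q)
qed (use assms in \<open>auto intro: comp_stabiliser inv_stabiliser\<close>)

lemma sign_stabiliser_comp:
  "p \<in> stabiliser n f \<Longrightarrow> q \<in> stabiliser n f \<Longrightarrow> sign (p \<circ> q) = sign p * sign q"
  by (meson finite_atLeastAtMost permutation_permutes sign_compose stabiliser_permutes)

text \<open>The product of the row symmetrizer of \<open>mu\<close>, the permutation \<open>g\<close> and the column
  antisymmetrizer of \<open>nu\<close> in the group algebra.\<close>

definition young_product :: "nat list \<Rightarrow> (nat \<Rightarrow> nat) \<Rightarrow> nat list \<Rightarrow> galg" where
  "young_product mu g nu = (\<lambda>s. \<Sum>p\<in>row_group mu. \<Sum>q\<in>column_group nu.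
     if p \<circ> g \<circ> q = s then of_int (sign q) else 0)"

lemma young_symmetrizer_product: "young_symmetrizer nu = young_product nu id nu"
  by (simp add: young_symmetrizer_def young_product_def)

section \<open>Young's combinatorial lemma for products of symmetrizers\<close>

lemma young_product_row:
  assumes "p0 \<in> row_group mu"
  shows "young_product mu (p0 \<circ> g) nu = young_product mu g nu"
proof
  fix s
  show "young_product mu (p0 \<circ> g) nu s = young_product mu g nu s"
    unfolding young_product_def row_group_stabiliser
    using sum_stabiliser_right[OF assms[unfolded row_group_stabiliser], of
      "\<lambda>p. \<Sum>q\<in>column_group nu. if p \<circ> g \<circ> q = s then of_int (sign q) else (0::complex)"]
    by (simp add: o_assoc)
qed

text \<open>Reindexing the column group by \<open>q0 \<circ> q\<close> produces the factor
  \<open>sign q0\<close>; its square is 1, so it may be moved to the other side.\<close>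

lemma young_product_column:
  assumes "q0 \<in> column_group nu"
  shows "young_product mu (g \<circ> q0) nu = gscale (of_int (sign q0)) (young_product mu g nu)"
proof
  fix s :: "nat \<Rightarrow> nat"
  let ?C = "stabiliser (sum_list nu) (col_of nu)"
  have q0: "q0 \<in> ?C" using assms by (simp add: column_group_stabiliser)
  have sq: "sign q0 * sign q0 = (1::int)" by (simp add: sign_idempotent)
  have "(\<Sum>q\<in>?C. if p \<circ> (g \<circ> q0) \<circ> q = s then of_int (sign q) else 0) =
    of_int (sign q0) * (\<Sum>q\<in>?C. if p \<circ> g \<circ> q = s then of_int (sign q) else (0::complex))" for p
  proof -
    have "(\<Sum>q\<in>?C. if p \<circ> (g \<circ> q0) \<circ> q = s then of_int (sign q) else (0::complex)) =
      (\<Sum>q\<in>?C. if p \<circ> g \<circ> (q0 \<circ> q) = s then of_int (sign q0 * sign (q0 \<circ> q)) else 0)"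
      by (rule sum.cong[OF refl])
        (simp add: o_assoc sign_stabiliser_comp[OF q0] mult.assoc[symmetric] sq del: of_int_mult)
    also have "\<dots> = (\<Sum>q\<in>?C. if p \<circ> g \<circ> q = s then of_int (sign q0 * sign q) else 0)"
      by (rule sum_stabiliser_left[OF q0])
    also have "\<dots> = of_int (sign q0) * (\<Sum>q\<in>?C. if p \<circ> g \<circ> q = s then of_int (sign q) else 0)"
      by (simp add: sum_distrib_left if_distrib cong: if_cong)
    finally show ?thesis .
  qed
  then show "young_product mu (g \<circ> q0) nu s =
      gscale (of_int (sign q0)) (young_product mu g nu) s"
    unfolding young_product_def gscale_def column_group_stabiliser by (simp add: sum_distrib_left)
qed


text \<open>Two numbers in one row of \<open>mu\<close> whose preimages under \<open>g\<close> share
  a column of \<open>nu\<close> give transpositions \<open>t\<close> and \<open>u\<close> with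
  \<open>t \<circ> g = g \<circ> u\<close>. The row group absorbs \<open>t\<close>, the column group
  turns \<open>u\<close> into a sign, and the product equals its own negative.\<close>

lemma young_product_eq_0:
  assumes g: "g permutes {1..n}" and n: "sum_list mu = n" "sum_list nu = n"
    and not_inj: "\<not> inj_on (\<lambda>x. (row_of mu x, col_of nu (inv g x))) {1..n}"
  shows "young_product mu g nu = 0"
proof -
  obtain x y where xy: "x \<in> {1..n}" "y \<in> {1..n}" "x \<noteq> y" "row_of mu x = row_of mu y"
    "col_of nu (inv g x) = col_of nu (inv g y)"
    using not_inj unfolding inj_on_def by auto
  define t where "t = Transposition.transpose x y"
  define u where "u = Transposition.transpose (inv g x) (inv g y)"
  have ig: "inv g x \<in> {1..n}" "inv g y \<in> {1..n}"
    using xy permutes_in_image[OF permutes_inv[OF g]] by auto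
  have t: "t \<in> row_group mu"
    unfolding t_def row_group_stabiliser using xy n by (intro transpose_stabiliser) auto
  have u: "u \<in> column_group nu"
    unfolding u_def column_group_stabiliser using xy n ig by (intro transpose_stabiliser) auto
  have gg: "g (inv g z) = z" "inv g (g z) = z" for z using permutes_inverses[OF g] by auto
  have "inv g x \<noteq> inv g y" using xy gg by metis
  then have "sign u = -1" by (simp add: u_def sign_swap_id)
  have "t \<circ> g = g \<circ> u"
  proof
    fix z
    have "g z = x \<longleftrightarrow> z = inv g x" "g z = y \<longleftrightarrow> z = inv g y" using gg by metis+
    then show "(t \<circ> g) z = (g \<circ> u) z" by (auto simp: t_def u_def transpose_def gg)
  qed
  then have neg: "young_product mu g nu = gscale (-1) (young_product mu g nu)"
    using young_product_row[OF t, of g nu] young_product_column[OF u, of mu g] \<open>sign u = -1\<close> by simp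
  show ?thesis
  proof
    fix s
    have "young_product mu g nu s = gscale (-1) (young_product mu g nu) s" by (rule fun_cong[OF neg])
    also have "\<dots> = - young_product mu g nu s" by (simp add: gscale_def)
    finally have "2 * young_product mu g nu s = 0" by (metis add.right_inverse mult_2)
    then show "young_product mu g nu s = 0 s" by simp
  qed
qed

lemma diagram_column:
  assumes "is_partition nu"
  shows "{i. (i, c) \<in> diagram nu} = {1..card {i. (i, c) \<in> diagram nu}}"
proof (rule downset_nat)
  show "finite {i. (i, c) \<in> diagram nu}"
    by (rule finite_subset[OF _ finite_imageI[OF finite_diagram, of fst]]) force
  show "0 \<notin> {i. (i, c) \<in> diagram nu}" by (simp add: diagram_def)
  fix a b assume "a \<in> {i. (i, c) \<in> diagram nu}" "1 \<le> b" "b \<le> a"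
  then show "b \<in> {i. (i, c) \<in> diagram nu}"
    using part_antimono[OF assms, of b a] by (simp add: diagram_def)
qed

text \<open>The numbers counted on the left have distinct rows in \<open>mu\<close>, which bounds
  them by \<open>m\<close>, and their preimages are distinct boxes of column \<open>c\<close> of
  \<open>nu\<close>, which bounds them by its height. The right side is the minimum of both
  bounds.\<close>

lemma card_inj_rows_columns:
  assumes g: "g permutes {1..n}" and n: "sum_list mu = n" "sum_list nu = n"
    and nu: "is_partition nu"
    and inj: "inj_on (\<lambda>x. (row_of mu x, col_of nu (inv g x))) {1..n}"
  shows "card {x \<in> {1..n}. row_of mu x \<le> m \<and> col_of nu (inv g x) = c} \<le>
    card {i. i \<le> m \<and> (i, c) \<in> diagram nu}"
proof -
  let ?S = "{x \<in> {1..n}. row_of mu x \<le> m \<and> col_of nu (inv g x) = c}"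
  let ?D = "{i. (i, c) \<in> diagram nu}"
  have ig: "inv g x \<in> {1..n}" if "x \<in> {1..n}" for x
    using that permutes_in_image[OF permutes_inv[OF g]] by auto
  define h where "h = card ?D"
  have D: "?D = {1..h}" unfolding h_def by (rule diagram_column[OF nu])
  have "{i. i \<le> m \<and> (i, c) \<in> diagram nu} = {..m} \<inter> ?D" by auto
  also have "\<dots> = {1..min h m}" unfolding D by (simp add: set_eq_iff conj_commute)
  finally have card: "card {i. i \<le> m \<and> (i, c) \<in> diagram nu} = min (card ?D) m"
    unfolding D by (simp only: card_atLeastAtMost)
  have "card ?S \<le> card {1..m}"
  proof (rule card_inj_on_le[of "row_of mu"])
    show "inj_on (row_of mu) ?S"
      by (rule inj_onI, rule inj_onD[OF inj]) auto
    have "1 \<le> row_of mu x" if "x \<in> {1..n}" for x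
      using tab_box_diagram[of x mu] n that by (auto simp: diagram_def)
    then show "row_of mu ` ?S \<subseteq> {1..m}" by auto
  qed simp
  moreover have "card ?S \<le> card ?D"
  proof (rule card_inj_on_le[of "\<lambda>x. row_of nu (inv g x)"])
    show "inj_on (\<lambda>x. row_of nu (inv g x)) ?S"
    proof (rule inj_onI)
      fix x y assume *: "x \<in> ?S" "y \<in> ?S" "row_of nu (inv g x) = row_of nu (inv g y)"
      then have "tab_box nu (inv g x) = tab_box nu (inv g y)" by (simp add: prod_eq_iff)
      then have "inv g x = inv g y" using tab_box_inj[of "inv g x" nu "inv g y"] ig * n by auto
      then show "x = y" using permutes_inverses(1)[OF g] by metis
    qed
    have "(row_of nu (inv g x), col_of nu (inv g x)) \<in> diagram nu" if "x \<in> {1..n}" for x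
      using tab_box_diagram[of "inv g x" nu] n ig[OF that] by simp
    then show "(\<lambda>x. row_of nu (inv g x)) ` ?S \<subseteq> ?D" by auto
    show "finite ?D" unfolding D by simp
  qed
  ultimately show ?thesis by (simp add: card)
qed

text \<open>Sorting the numbers in the first \<open>m\<close> rows of \<open>mu\<close> by the
  column of their preimage prepares the columnwise comparison that yields dominance.\<close>

lemma card_rows_eq_sum_columns:
  assumes g: "g permutes {1..n}" and n: "sum_list mu = n" "sum_list nu = n"
  shows "(\<Sum>i = 1..m. part mu i) =
    (\<Sum>c\<in>snd ` diagram nu. card {x \<in> {1..n}. row_of mu x \<le> m \<and> col_of nu (inv g x) = c})"
proof -
  have ig: "inv g x \<in> {1..n}" if "x \<in> {1..n}" for x
    using that permutes_in_image[OF permutes_inv[OF g]] by auto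
  have "(\<Sum>i = 1..m. part mu i) = card {b \<in> diagram mu. fst b \<le> m}" by (simp add: card_diagram_rows)
  also have "\<dots> = card {x \<in> {1..n}. row_of mu x \<le> m}"
    by (rule bij_betw_same_card[of "row_tableau mu"], rule bij_betwI[where g = "tab_box mu"])
      (use n row_tableau_range[of _ mu] tab_box_diagram[of _ mu] in auto)
  also have "{x \<in> {1..n}. row_of mu x \<le> m} =
    (\<Union>c\<in>snd ` diagram nu. {x \<in> {1..n}. row_of mu x \<le> m \<and> col_of nu (inv g x) = c})"
    using ig n tab_box_diagram[of _ nu] by auto
  also have "card \<dots> =
    (\<Sum>c\<in>snd ` diagram nu. card {x \<in> {1..n}. row_of mu x \<le> m \<and> col_of nu (inv g x) = c})"
    by (rule card_UN_disjoint) (auto simp: finite_diagram)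
  finally show ?thesis .
qed

lemma card_rows_columns:
  "(\<Sum>i = 1..m. part nu i) =
    (\<Sum>c\<in>snd ` diagram nu. card {i. i \<le> m \<and> (i, c) \<in> diagram nu})"
proof -
  have "(\<Sum>i = 1..m. part nu i) = card {b \<in> diagram nu. fst b \<le> m}" by (simp add: card_diagram_rows)
  also have "{b \<in> diagram nu. fst b \<le> m} =
     (\<Union>c\<in>snd ` diagram nu. (\<lambda>i. (i, c)) ` {i. i \<le> m \<and> (i, c) \<in> diagram nu})"
    by force
  also have "card \<dots> = (\<Sum>c\<in>snd ` diagram nu. card ((\<lambda>i. (i, c)) ` {i. i \<le> m \<and> (i, c) \<in> diagram nu}))"
    by (rule card_UN_disjoint) (auto simp: finite_diagram)
  also have "\<dots> = (\<Sum>c\<in>snd ` diagram nu. card {i. i \<le> m \<and> (i, c) \<in> diagram nu})"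
    by (simp add: card_image inj_on_def)
  finally show ?thesis .
qed

definition dominated :: "nat list \<Rightarrow> nat list \<Rightarrow> bool" where
  "dominated mu nu \<longleftrightarrow> (\<forall>m. (\<Sum>i = 1..m. part mu i) \<le> (\<Sum>i = 1..m. part nu i))"

lemma dominated_if_young_product_nonzero:
  assumes "g permutes {1..n}" "sum_list mu = n" "sum_list nu = n" "is_partition nu"
    and "young_product mu g nu \<noteq> 0"
  shows "dominated mu nu"
proof -
  have inj: "inj_on (\<lambda>x. (row_of mu x, col_of nu (inv g x))) {1..n}"
    using young_product_eq_0[OF assms(1-3)] assms(5) by blast
  show ?thesis
    unfolding dominated_def card_rows_eq_sum_columns[OF assms(1-3)] card_rows_columns[of nu]
    by (intro allI sum_mono card_inj_rows_columns[OF assms(1-4) inj])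
qed

text \<open>If no row and column meet twice, then \<open>g\<close> factors as a row permutation
  after a column permutation \<open>q\<close>, and the product is \<open>sign q\<close> times the
  Young symmetrizer; otherwise it is 0.\<close>

lemma young_product_multiple:
  assumes g: "g permutes {1..n}" and n: "sum_list nu = n" and nu: "is_partition nu"
  shows "\<exists>z. young_product nu g nu = gscale z (young_symmetrizer nu)"
proof (cases "inj_on (\<lambda>x. (row_of nu x, col_of nu (inv g x))) {1..n}")
  case False
  then have "young_product nu g nu = gscale 0 (young_symmetrizer nu)"
    using young_product_eq_0[OF g n n] by (simp add: gscale_def fun_eq_iff)
  then show ?thesis by blast
next
  case inj: True
  have gg: "g (inv g z) = z" "inv g (g z) = z" for z using permutes_inverses[OF g] by auto
  have gim: "g x \<in> {1..n}" if "x \<in> {1..n}" for x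
    using that permutes_in_image[OF g] by auto
  \<comment> \<open>Both shapes are \<open>nu\<close>, so the columnwise inequalities add up to an
    equality and each of them must be sharp.\<close>
  have eq: "card {x \<in> {1..n}. row_of nu x \<le> m \<and> col_of nu (inv g x) = c} =
    card {i. i \<le> m \<and> (i, c) \<in> diagram nu}" if "c \<in> snd ` diagram nu" for m c
  proof (rule ccontr)
    assume ne: "\<not> ?thesis"
    have "(\<Sum>c\<in>snd ` diagram nu. card {x \<in> {1..n}. row_of nu x \<le> m \<and> col_of nu (inv g x) = c})
      < (\<Sum>c\<in>snd ` diagram nu. card {i. i \<le> m \<and> (i, c) \<in> diagram nu})"
    proof (rule sum_strict_mono_ex1)
      show "\<exists>c\<in>snd ` diagram nu. card {x \<in> {1..n}. row_of nu x \<le> m \<and> col_of nu (inv g x) = c}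
        < card {i. i \<le> m \<and> (i, c) \<in> diagram nu}"
        using ne that card_inj_rows_columns[OF g n n nu inj, of m c] by (intro bexI[of _ c]) linarith+
    qed (use card_inj_rows_columns[OF g n n nu inj] finite_diagram in blast)+
    then show False
      using card_rows_eq_sum_columns[OF g n n, of m] card_rows_columns[of nu m] by simp
  qed
  \<comment> \<open>Taking \<open>m\<close> to be the height of the column of \<open>y\<close> shows
    that all numbers with preimage in this column lie in rows that the column still reaches.\<close>
  have box: "(row_of nu (g y), col_of nu y) \<in> diagram nu" if y: "y \<in> {1..n}" for y
  proof -
    let ?c = "col_of nu y"
    let ?D = "{i. (i, ?c) \<in> diagram nu}"
    let ?h = "card ?D"
    have c: "?c \<in> snd ` diagram nu" using tab_box_diagram[of y nu] y n by auto
    have D: "?D = {1..?h}" by (rule diagram_column[OF nu])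
    have "{x \<in> {1..n}. col_of nu (inv g x) = ?c} = {x \<in> {1..n}. row_of nu x \<le> ?h \<and> col_of nu (inv g x) = ?c}"
    proof (rule sym, rule card_subset_eq)
      have "{i. i \<le> ?h \<and> (i, ?c) \<in> diagram nu} = ?D" using D by auto
      then have "card {x \<in> {1..n}. row_of nu x \<le> ?h \<and> col_of nu (inv g x) = ?c} = ?h"
        using eq[OF c, of ?h] by simp
      moreover have "card {x \<in> {1..n}. col_of nu (inv g x) = ?c} = ?h"
      proof (rule bij_betw_same_card[of "\<lambda>x. row_of nu (inv g x)"],
          rule bij_betwI[where g = "\<lambda>i. g (row_tableau nu (i, ?c))"])
        show "(\<lambda>x. row_of nu (inv g x)) \<in> {x \<in> {1..n}. col_of nu (inv g x) = ?c} \<rightarrow> ?D"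
        proof
          fix x assume x: "x \<in> {x \<in> {1..n}. col_of nu (inv g x) = ?c}"
          then have "inv g x \<in> {1..sum_list nu}"
            using permutes_in_image[OF permutes_inv[OF g]] n by auto
          from tab_box_diagram[OF this] x show "row_of nu (inv g x) \<in> ?D"
            by (metis (mono_tags, lifting) mem_Collect_eq prod.collapse)
        qed
        show "(\<lambda>i. g (row_tableau nu (i, ?c))) \<in> ?D \<rightarrow> {x \<in> {1..n}. col_of nu (inv g x) = ?c}"
          using gim row_tableau_range[of _ nu] n by (auto simp: gg)
        show "g (row_tableau nu (row_of nu (inv g x), ?c)) = x"
          if x: "x \<in> {x \<in> {1..n}. col_of nu (inv g x) = ?c}" for x
        proof -
          have "inv g x \<in> {1..sum_list nu}"
            using x permutes_in_image[OF permutes_inv[OF g]] n by auto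
          then show ?thesis using x row_tableau_tab_box[of "inv g x" nu] gg
            by (metis (mono_tags, lifting) mem_Collect_eq prod.collapse)
        qed
      qed (auto simp: gg)
      ultimately show "card {x \<in> {1..n}. row_of nu x \<le> ?h \<and> col_of nu (inv g x) = ?c} =
        card {x \<in> {1..n}. col_of nu (inv g x) = ?c}" by simp
    qed auto
    moreover have "g y \<in> {x \<in> {1..n}. col_of nu (inv g x) = ?c}" using y gim by (simp add: gg)
    ultimately have "row_of nu (g y) \<le> ?h" by auto
    moreover have "1 \<le> row_of nu (g y)"
      using tab_box_diagram[of "g y" nu] gim[OF y] n by (auto simp: diagram_def)
    ultimately have "row_of nu (g y) \<in> ?D" using D by auto
    then show ?thesis by simp
  qed
  \<comment> \<open>The column permutation moves \<open>y\<close> inside its column to the row of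
    \<open>g y\<close>; what remains of \<open>g\<close> then preserves rows.\<close>
  define q where "q = (\<lambda>y. if y \<in> {1..n} then row_tableau nu (row_of nu (g y), col_of nu y) else y)"
  have tq: "tab_box nu (q y) = (row_of nu (g y), col_of nu y)" if "y \<in> {1..n}" for y
    using box[OF that] that by (simp add: q_def)
  have qim: "q y \<in> {1..n}" if "y \<in> {1..n}" for y
    using row_tableau_range[OF box[OF that]] that n by (simp add: q_def)
  have "inj_on q {1..n}"
  proof (rule inj_onI)
    fix x y assume *: "x \<in> {1..n}" "y \<in> {1..n}" "q x = q y"
    then have "row_of nu (g x) = row_of nu (g y)" "col_of nu x = col_of nu y"
      using tq[of x] tq[of y] by auto
    then have "g x = g y"
      using inj_onD[OF inj, of "g x" "g y"] gim * by (simp add: gg)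
    then show "x = y" using gg by metis
  qed
  then have "bij_betw q {1..n} {1..n}"
    using qim by (simp add: bij_betw_def endo_inj_surj image_subset_iff)
  then have qp: "q permutes {1..n}" by (rule bij_imp_permutes) (simp only: q_def if_False)
  have qC: "q \<in> column_group nu" using qp tq n by (simp add: column_group_iff)
  then have iq: "inv q \<in> column_group nu" by (simp add: column_group_stabiliser inv_stabiliser)
  define p where "p = g \<circ> inv q"
  have qq: "q (inv q z) = z" "inv q (q z) = z" for z using permutes_inverses[OF qp] by auto
  have "p \<in> row_group nu"
    unfolding row_group_iff
  proof (intro conjI ballI)
    show "p permutes {1..sum_list nu}"
      unfolding p_def n using g qp by (intro permutes_compose permutes_inv)
    fix x assume "x \<in> {1..sum_list nu}"
    then have "inv q x \<in> {1..n}" using permutes_in_image[OF permutes_inv[OF qp]] n by auto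
    then show "row_of nu (p x) = row_of nu x" using tq[of "inv q x"] by (simp add: p_def qq)
  qed
  moreover have "g = p \<circ> id \<circ> q" by (auto simp: p_def qq)
  ultimately have "young_product nu g nu = gscale (of_int (sign q)) (young_symmetrizer nu)"
    using young_product_column[OF qC, of nu "p \<circ> id"] young_product_row[of p nu id nu]
    by (simp add: young_symmetrizer_product)
  then show ?thesis by blast
qed

text \<open>A permutation preserving rows and columns is trivial, so only \<open>p = q = id\<close>
  contributes. The value serves to read off the scalar of any multiple of the symmetrizer.\<close>

lemma young_symmetrizer_id: "young_symmetrizer nu id = 1"
proof -
  have "(if p \<circ> q = id then of_int (sign q) else 0) = (if q = id then if p = id then 1 else 0 else (0::complex))"
    if p: "p \<in> row_group nu" and q: "q \<in> column_group nu" for p q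
  proof (cases "p \<circ> q = id")
    case True
    have qp: "q permutes {1..sum_list nu}" and pp: "p permutes {1..sum_list nu}"
      using p q by (auto simp: row_group_iff column_group_iff)
    have "p = p \<circ> (q \<circ> inv q)" using permutes_inv_o(1)[OF qp] by simp
    also have "\<dots> = inv q" using True by (simp add: o_assoc)
    finally have "p \<in> column_group nu" using q by (simp add: column_group_stabiliser inv_stabiliser)
    then have "tab_box nu (p x) = tab_box nu x" if "x \<in> {1..sum_list nu}" for x
      using p that by (auto simp: row_group_iff column_group_iff prod_eq_iff)
    then have "p x = x" for x
      using tab_box_inj[of "p x" nu x] permutes_in_image[OF pp] permutes_not_in[OF pp] by blast
    then have "p = id" by auto
    then show ?thesis using True by simp
  qed auto
  then have "young_symmetrizer nu id =
    (\<Sum>p\<in>row_group nu. \<Sum>q\<in>column_group nu. if q = id then if p = id then 1 else 0 else 0)"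
    unfolding young_symmetrizer_def by (intro sum.cong refl) auto
  also have "\<dots> = 1"
    using finite_stabiliser id_stabiliser
    by (simp add: sum.delta row_group_stabiliser column_group_stabiliser)
  finally show ?thesis .
qed

section \<open>Trace of the row symmetrizer on a Specht module\<close>

lemma comp_inv_eq_iff:
  assumes "p permutes S"
  shows "x = inv p \<circ> t \<longleftrightarrow> p \<circ> x = t"
  using permutes_inv_o[OF assms] by (metis comp_assoc comp_id id_comp)

lemma left_translate_young_symmetrizer:
  assumes "p \<in> row_group nu"
  shows "left_translate p (young_symmetrizer nu) = young_symmetrizer nu"
proof
  fix t :: "nat \<Rightarrow> nat"
  have pp: "p permutes {1..sum_list nu}" using assms by (simp add: row_group_iff)
  have "left_translate p (young_symmetrizer nu) t = (\<Sum>p'\<in>row_group nu. \<Sum>q\<in>column_group nu.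
     if (p \<circ> p') \<circ> q = t then of_int (sign q) else 0)"
    unfolding left_translate_def young_symmetrizer_def comp_inv_eq_iff[OF pp] o_assoc ..
  also have "\<dots> = young_symmetrizer nu t"
    using sum_stabiliser_left[OF assms[unfolded row_group_stabiliser], of
      "\<lambda>p. \<Sum>q\<in>column_group nu. if p \<circ> q = t then of_int (sign q) else (0::complex)"]
    by (simp add: young_symmetrizer_def row_group_stabiliser)
  finally show "left_translate p (young_symmetrizer nu) t = young_symmetrizer nu t" .
qed

lemma left_translate_linear: "left_translate p (gscale z x + y) = gscale z (left_translate p x) + left_translate p y"
  by (auto simp: left_translate_def gscale_def)

definition row_sym :: "nat list \<Rightarrow> galg \<Rightarrow> galg" where
  "row_sym mu v = (\<Sum>p\<in>row_group mu. left_translate p v)"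

lemma row_sym_linear: "row_sym mu (gscale z x + y) = gscale z (row_sym mu x) + row_sym mu y"
  by (simp add: row_sym_def left_translate_linear sum.distrib galg.scale_sum_right)

lemma row_sym_zero: "row_sym mu 0 = 0"
  by (simp add: row_sym_def left_translate_def zero_fun_def sum_fun_apply fun_eq_iff)

text \<open>Expanding the row factor of the Young symmetrizer of \<open>nu\<close> leaves only its
  column factor on the right, so everything known about \<open>young_product\<close> applies to the
  generators of the Specht module.\<close>

lemma row_sym_translate:
  assumes s: "s permutes {1..n}" and n: "sum_list mu = n"
  shows "row_sym mu (left_translate s (young_symmetrizer nu)) =
    (\<Sum>p\<in>row_group nu. young_product mu (s \<circ> p) nu)"
proof
  fix t
  have "row_sym mu (left_translate s (young_symmetrizer nu)) t =
    (\<Sum>p\<in>row_group mu. \<Sum>p'\<in>row_group nu. \<Sum>q\<in>column_group nu.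
      if p' \<circ> q = inv s \<circ> (inv p \<circ> t) then of_int (sign q) else 0)"
    by (simp add: row_sym_def sum_fun_apply left_translate_def young_symmetrizer_def)
  also have "\<dots> = (\<Sum>p\<in>row_group mu. \<Sum>p'\<in>row_group nu. \<Sum>q\<in>column_group nu.
      if p \<circ> (s \<circ> p') \<circ> q = t then of_int (sign q) else 0)"
  proof (intro sum.cong refl)
    fix p p' q assume "p \<in> row_group mu"
    then have pp: "p permutes {1..n}" using n by (simp add: row_group_iff)
    show "(if p' \<circ> q = inv s \<circ> (inv p \<circ> t) then of_int (sign q) else 0) =
      (if p \<circ> (s \<circ> p') \<circ> q = t then of_int (sign q) else (0::complex))"
      by (simp only: comp_inv_eq_iff[OF s] comp_inv_eq_iff[OF pp] o_assoc[symmetric])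
  qed
  also have "\<dots> = (\<Sum>p'\<in>row_group nu. young_product mu (s \<circ> p') nu t)"
    unfolding young_product_def by (rule sum.swap)
  finally show "row_sym mu (left_translate s (young_symmetrizer nu)) t =
    (\<Sum>p\<in>row_group nu. young_product mu (s \<circ> p) nu) t" by (simp add: sum_fun_apply)
qed

lemma specht_module_closed:
  assumes p: "p permutes {1..sum_list nu}" and v: "v \<in> specht_module nu"
  shows "left_translate p v \<in> specht_module nu"
  using v unfolding specht_module_def
proof (induction rule: galg.span_induct_alt)
  case base
  have zero: "left_translate p 0 = 0" by (simp add: left_translate_def fun_eq_iff)
  show ?case unfolding zero by (rule galg.span_zero)
next
  case (step z x y)
  then obtain s where s: "x = left_translate s (young_symmetrizer nu)" "s permutes {1..sum_list nu}"
    by auto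
  have "left_translate p x = left_translate (p \<circ> s) (young_symmetrizer nu)"
    using p s by (auto simp: left_translate_def o_assoc permutes_bij o_inv_distrib)
  moreover have "(p \<circ> s) permutes {1..sum_list nu}" using p s(2) by (intro permutes_compose)
  ultimately have "left_translate p x \<in> {left_translate s (young_symmetrizer nu) | s. s permutes {1..sum_list nu}}"
    by auto
  note x = galg.span_base[OF this]
  show ?case unfolding left_translate_linear by (intro galg.span_add galg.span_scale x step.IH)
qed

lemma young_symmetrizer_specht: "young_symmetrizer nu \<in> specht_module nu"
  unfolding specht_module_def
proof (rule galg.span_base)
  have "young_symmetrizer nu = left_translate id (young_symmetrizer nu)"
    by (auto simp: left_translate_def)
  then show "young_symmetrizer nu \<in> {left_translate s (young_symmetrizer nu) | s. s permutes {1..sum_list nu}}"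
    using permutes_id by blast
qed

lemma row_sym_specht_undominated:
  assumes n: "sum_list mu = sum_list nu" and nu: "is_partition nu"
    and dom: "\<not> dominated mu nu" and v: "v \<in> specht_module nu"
  shows "row_sym mu v = 0"
  using v unfolding specht_module_def
proof (induction rule: galg.span_induct_alt)
  case base
  then show ?case by (rule row_sym_zero)
next
  case (step z x y)
  then obtain s where s: "x = left_translate s (young_symmetrizer nu)" "s permutes {1..sum_list nu}"
    by auto
  have "young_product mu (s \<circ> p) nu = 0" if "p \<in> row_group nu" for p
  proof -
    have "(s \<circ> p) permutes {1..sum_list nu}"
      using that s(2) by (intro permutes_compose) (auto simp: row_group_iff)
    then show ?thesis using dominated_if_young_product_nonzero[OF _ n refl nu] dom by blast
  qed
  then have "row_sym mu x = 0" unfolding s(1) row_sym_translate[OF s(2) n] by (auto intro!: sum.neutral)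
  then show ?case
    unfolding row_sym_linear step.IH by (simp only: galg.scale_zero_right add_0)
qed

lemma row_sym_specht_multiple:
  assumes nu: "is_partition nu" and v: "v \<in> specht_module nu"
  shows "\<exists>z. row_sym nu v = gscale z (young_symmetrizer nu)"
  using v unfolding specht_module_def
proof (induction rule: galg.span_induct_alt)
  case base
  have "row_sym nu 0 = gscale 0 (young_symmetrizer nu)" by (simp add: row_sym_zero)
  then show ?case ..
next
  case (step z x y)
  then obtain s where s: "x = left_translate s (young_symmetrizer nu)" "s permutes {1..sum_list nu}"
    by auto
  have "\<exists>z. young_product nu (s \<circ> p) nu = gscale z (young_symmetrizer nu)" if "p \<in> row_group nu" for p
    using that s(2) nu by (intro young_product_multiple[OF _ refl] permutes_compose) (auto simp: row_group_iff)
  then obtain f where "young_product nu (s \<circ> p) nu = gscale (f p) (young_symmetrizer nu)"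
    if "p \<in> row_group nu" for p by metis
  then have "row_sym nu x = gscale (\<Sum>p\<in>row_group nu. f p) (young_symmetrizer nu)"
    by (simp add: s(1) row_sym_translate[OF s(2) refl] galg.scale_sum_left)
  moreover obtain z' where "row_sym nu y = gscale z' (young_symmetrizer nu)" using step.IH by blast
  ultimately have "row_sym nu (gscale z x + y) =
    gscale (z * (\<Sum>p\<in>row_group nu. f p) + z') (young_symmetrizer nu)"
    by (simp add: row_sym_linear galg.scale_left_distrib)
  then show ?case ..
qed

text \<open>The operator \<open>row_sym mu\<close> has the form of \<open>v\<close> mapped to a
  linear functional of \<open>v\<close> times the fixed vector \<open>w\<close>, the functional
  being the coefficient at the identity. Such an operator has as its trace the value of the
  functional at \<open>w\<close>, and the trace is the sum of the character values over the row
  group. The case \<open>w = 0\<close> is included.\<close>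

lemma sum_irr_char:
  assumes n: "sum_list mu = sum_list nu" and w: "w \<in> specht_module nu"
    and rank1: "\<And>v. v \<in> specht_module nu \<Longrightarrow> row_sym mu v = gscale (row_sym mu v id) w"
  shows "(\<Sum>p\<in>row_group mu. irr_char nu p) = row_sym mu w id"
proof -
  let ?V = "specht_module nu"
  let ?S = "{left_translate s (young_symmetrizer nu) | s. s permutes {1..sum_list nu}}"
  have V: "?V = galg.span ?S" by (simp add: specht_module_def)
  obtain B0 where B0: "B0 \<subseteq> ?V" "galg.independent B0" "?V \<subseteq> galg.span B0"
    by (rule galg.basis_exists)
  have "galg.span B0 = ?V"
  proof
    show "galg.span B0 \<subseteq> ?V" unfolding V by (rule galg.span_minimal) (use B0 V in auto)
  qed (rule B0(3))
  then have ex: "\<exists>B. galg.independent B \<and> galg.span B = ?V" using B0 by blast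
  define B where "B = (SOME B. galg.independent B \<and> galg.span B = ?V)"
  have B: "galg.independent B" "galg.span B = ?V"
    using someI_ex[OF ex] unfolding B_def by auto
  have "finite ?S" by (simp add: setcompr_eq_image finite_permutations)
  moreover have "B \<subseteq> galg.span ?S" using B galg.span_superset V by blast
  ultimately have fin: "finite B" using B(1) galg.independent_span_bound by blast
  have BV: "b \<in> ?V" if "b \<in> B" for b using that B galg.span_base by blast
  have tr: "left_translate p b \<in> galg.span B" if "p \<in> row_group mu" "b \<in> B" for p b
    using that specht_module_closed[of p nu b] BV B n by (auto simp: row_group_iff)
  have "(\<Sum>p\<in>row_group mu. irr_char nu p) =
    (\<Sum>p\<in>row_group mu. \<Sum>b\<in>B. galg.representation B (left_translate p b) b)"
    unfolding irr_char_def trace_on_def Let_def B_def by (rule refl)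
  also have "\<dots> = (\<Sum>b\<in>B. \<Sum>p\<in>row_group mu. galg.representation B (left_translate p b) b)"
    by (rule sum.swap)
  also have "\<dots> = (\<Sum>b\<in>B. galg.representation B (row_sym mu b) b)"
    unfolding row_sym_def using tr by (intro sum.cong refl) (simp add: galg.representation_sum[OF B(1)])
  also have "\<dots> = (\<Sum>b\<in>B. row_sym mu b id * galg.representation B w b)"
  proof (intro sum.cong refl)
    fix b assume "b \<in> B"
    have "galg.representation B (row_sym mu b) b = galg.representation B (gscale (row_sym mu b id) w) b"
      using rank1[OF BV[OF \<open>b \<in> B\<close>]] by simp
    then show "galg.representation B (row_sym mu b) b = row_sym mu b id * galg.representation B w b"
      using w B by (simp add: galg.representation_scale)
  qed
  also have "\<dots> = row_sym mu (\<Sum>b\<in>B. gscale (galg.representation B w b) b) id"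
  proof -
    have "row_sym mu (\<Sum>b\<in>C. gscale (f b) b) id = (\<Sum>b\<in>C. row_sym mu b id * f b)"
      if "finite C" for C and f :: "galg \<Rightarrow> complex"
      using that
    proof (induction C)
      case (insert x C)
      have "gscale (f x) (row_sym mu x) id = row_sym mu x id * f x" by (simp add: gscale_def)
      then show ?case
        unfolding sum.insert[OF insert.hyps] row_sym_linear by (simp only: plus_fun_apply insert.IH)
    qed (simp only: sum.empty row_sym_zero, simp)
    then show ?thesis using fin by simp
  qed
  also have "(\<Sum>b\<in>B. gscale (galg.representation B w b) b) = w"
    using B w fin by (intro galg.sum_representation_eq) auto
  finally show ?thesis .
qed

lemma sum_irr_char_undominated:
  assumes "sum_list mu = sum_list nu" "is_partition nu" "\<not> dominated mu nu"
  shows "(\<Sum>p\<in>row_group mu. irr_char nu p) = 0"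
  using sum_irr_char[OF assms(1), of 0] row_sym_specht_undominated[OF assms]
  by (simp add: specht_module_def galg.span_zero row_sym_zero)

text \<open>Here \<open>w\<close> is the Young symmetrizer. It is fixed by left translation with the
  row group, so the trace is the order of that group.\<close>

lemma sum_irr_char_self:
  assumes "is_partition nu"
  shows "(\<Sum>p\<in>row_group nu. irr_char nu p) \<noteq> 0"
proof -
  let ?c = "young_symmetrizer nu"
  have "row_sym nu v = gscale (row_sym nu v id) ?c" if v: "v \<in> specht_module nu" for v
  proof -
    obtain z where z: "row_sym nu v = gscale z ?c" using row_sym_specht_multiple[OF assms v] ..
    then have "row_sym nu v id = z" by (simp add: gscale_def young_symmetrizer_id)
    with z show ?thesis by simp
  qed
  then have "(\<Sum>p\<in>row_group nu. irr_char nu p) = row_sym nu ?c id"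
    by (rule sum_irr_char[OF refl young_symmetrizer_specht])
  also have "\<dots> = of_nat (card (row_group nu))"
    by (simp add: row_sym_def left_translate_young_symmetrizer sum_fun_apply young_symmetrizer_id)
  also have "\<dots> \<noteq> 0"
    using finite_stabiliser id_stabiliser[of "sum_list nu" "row_of nu"]
    by (force simp: row_group_stabiliser)
  finally show ?thesis .
qed

section \<open>Linear independence through the dominance order\<close>

lemma dominated_antisym:
  assumes "is_partition mu" "is_partition nu" "dominated mu nu" "dominated nu mu"
  shows "mu = nu"
proof -
  have eq: "(\<Sum>i = 1..m. part mu i) = (\<Sum>i = 1..m. part nu i)" for m
    using assms(3,4) by (auto simp: dominated_def intro: antisym)
  have part: "part mu (Suc i) = part nu (Suc i)" for i
    using eq[of i] eq[of "Suc i"] by simp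
  have pos: "part xi (Suc i) > 0 \<longleftrightarrow> i < length xi" if "is_partition xi" for xi i
    using that by (auto simp: part_def is_partition_def in_set_conv_nth)
  have "i < length mu \<longleftrightarrow> i < length nu" for i
    using pos[OF assms(1), of i] pos[OF assms(2), of i] part[of i] by simp
  then have "length mu = length nu" by (metis linorder_neqE_nat nat_less_le)
  then show ?thesis
  proof (rule nth_equalityI)
    show "mu ! i = nu ! i" if "i < length mu" for i
      using that part[of i] \<open>length mu = length nu\<close> by (simp add: part_def)
  qed
qed

lemma finite_partitions_of: "finite (partitions_of n)"
proof (rule finite_subset)
  show "partitions_of n \<subseteq> {xs. set xs \<subseteq> {..n} \<and> length xs \<le> n}"
  proof
    fix nu assume nu: "nu \<in> partitions_of n"
    then have "x \<le> n" if "x \<in> set nu" for x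
      using member_le_sum_list[OF that] by (auto simp: partitions_of_def)
    moreover have "length nu \<le> sum_list nu"
    proof -
      have "0 \<notin> set nu" using nu by (simp add: partitions_of_def is_partition_def)
      then show ?thesis by (induction nu) auto
    qed
    ultimately show "nu \<in> {xs. set xs \<subseteq> {..n} \<and> length xs \<le> n}"
      using nu by (auto simp: partitions_of_def)
  qed
  show "finite {xs. set xs \<subseteq> {..n} \<and> length xs \<le> n}" by (rule finite_lists_length_le) simp
qed

text \<open>Summing the relation over the row group of \<open>mu\<close> kills every term whose
  partition does not dominate \<open>mu\<close>. For \<open>mu\<close> maximal among the partitions
  with nonzero coefficient only its own term survives, with a nonzero factor.\<close>

theorem irr_char_independent:
  fixes D :: "nat list \<Rightarrow> complex"
  assumes zero: "\<And>s. s permutes {1..n} \<Longrightarrow> (\<Sum>nu\<in>partitions_of n. D nu * irr_char nu s) = 0"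
    and nu: "nu \<in> partitions_of n"
  shows "D nu = 0"
proof (rule ccontr)
  assume "D nu \<noteq> 0"
  \<comment> \<open>The sum of the partial sums grows strictly along dominance and replaces the
    partial order by a number; a maximum of it is a maximal partition. From \<open>m = n\<close> on
    all partial sums equal \<open>n\<close>, so \<open>m \<le> n\<close> suffices.\<close>
  define F where "F = (\<lambda>xi. \<Sum>m\<le>n. \<Sum>i = 1..m. part xi i)"
  define S where "S = {nu \<in> partitions_of n. D nu \<noteq> 0}"
  have S: "finite S" "S \<noteq> {}" using finite_partitions_of nu \<open>D nu \<noteq> 0\<close> by (auto simp: S_def)
  then have "Max (F ` S) \<in> F ` S" by (intro Max_in) auto
  then obtain mu where "mu \<in> S" and max: "F mu = Max (F ` S)" by auto
  then have mu: "mu \<in> partitions_of n" "D mu \<noteq> 0" by (auto simp: S_def)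
  have mun: "is_partition mu" "sum_list mu = n" using mu by (auto simp: partitions_of_def)
  have "D xi * (\<Sum>p\<in>row_group mu. irr_char xi p) = 0" if xi: "xi \<in> partitions_of n - {mu}" for xi
  proof (cases "D xi \<noteq> 0 \<and> dominated mu xi")
    case True
    have xin: "is_partition xi" "sum_list xi = n" using xi by (auto simp: partitions_of_def)
    have len: "length ze \<le> n" if "is_partition ze" "sum_list ze = n" for ze
    proof -
      have "0 \<notin> set ze" using that by (simp add: is_partition_def)
      then have "length ze \<le> sum_list ze" by (induction ze) auto
      then show ?thesis using that by simp
    qed
    have "\<not> dominated xi mu" using dominated_antisym[of mu xi] True mun xin xi by auto
    then obtain m where m: "(\<Sum>i = 1..m. part mu i) < (\<Sum>i = 1..m. part xi i)"
      by (auto simp: dominated_def not_le)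
    have "m \<le> n"
    proof (rule ccontr)
      assume "\<not> m \<le> n"
      then show False using m sum_part[of mu m] sum_part[of xi m] len[OF mun] len[OF xin] mun xin by auto
    qed
    then have "F mu < F xi"
      unfolding F_def using True m by (intro sum_strict_mono_ex1) (auto simp: dominated_def)
    moreover have "F xi \<le> F mu" unfolding max using S(1) xi True by (intro Max_ge) (auto simp: S_def)
    ultimately show ?thesis by simp
  next
    case False
    then show ?thesis
      using sum_irr_char_undominated[of mu xi] xi mun by (auto simp: partitions_of_def)
  qed
  then have "(\<Sum>xi\<in>partitions_of n - {mu}. D xi * (\<Sum>p\<in>row_group mu. irr_char xi p)) = 0"
    by (intro sum.neutral ballI)
  then have "(\<Sum>xi\<in>partitions_of n. D xi * (\<Sum>p\<in>row_group mu. irr_char xi p)) =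
    D mu * (\<Sum>p\<in>row_group mu. irr_char mu p)"
    using mu finite_partitions_of by (subst sum.remove[of _ mu]) simp_all
  moreover have "(\<Sum>xi\<in>partitions_of n. D xi * (\<Sum>p\<in>row_group mu. irr_char xi p)) =
    (\<Sum>p\<in>row_group mu. \<Sum>xi\<in>partitions_of n. D xi * irr_char xi p)"
    unfolding sum_distrib_left by (rule sum.swap)
  moreover have "\<dots> = 0"
    using zero mun by (intro sum.neutral) (auto simp: row_group_iff)
  ultimately show False using sum_irr_char_self[OF mun(1)] mu by auto
qed

lemma skew_character_eq_iff:
  "skew_character A = skew_character B \<longleftrightarrow> card A = card B \<and>
    (\<forall>nu\<in>partitions_of (card A). card (lr_tableaux A nu) = card (lr_tableaux B nu))"
proof
  assume eq: "skew_character A = skew_character B"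
  then have card: "card A = card B" by (simp add: skew_character_def)
  let ?n = "card A"
  let ?D = "\<lambda>nu. of_nat (card (lr_tableaux A nu)) - of_nat (card (lr_tableaux B nu)) :: complex"
  have "(\<Sum>nu\<in>partitions_of ?n. ?D nu * irr_char nu s) = 0" if s: "s permutes {1..?n}" for s
  proof -
    have "snd (skew_character A) s = snd (skew_character B) s" using eq by simp
    then show ?thesis
      using s card by (simp add: skew_character_def left_diff_distrib sum_subtractf)
  qed
  then have "?D nu = 0" if "nu \<in> partitions_of ?n" for nu
    using irr_char_independent[of ?n ?D nu] that by blast
  then show "card A = card B \<and>
    (\<forall>nu\<in>partitions_of (card A). card (lr_tableaux A nu) = card (lr_tableaux B nu))"
    using card by simp
qed (auto simp: skew_character_def intro!: ext sum.cong)

section \<open>The Bender--Knuth involution\<close>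

definition ssyt :: "nat \<Rightarrow> box set \<Rightarrow> (box \<Rightarrow> nat) set" where
  "ssyt n A = {T. (\<forall>b. b \<notin> A \<longrightarrow> T b = 0) \<and> semistandard A T \<and> (\<forall>b\<in>A. T b \<le> n)}"

definition entries :: "box set \<Rightarrow> (box \<Rightarrow> nat) \<Rightarrow> nat \<Rightarrow> nat" where
  "entries A T k = card {b \<in> A. T b = k}"

text \<open>The content of column \<open>J\<close> and all columns to its right: the part of a
  tableau on which the lattice condition is tested and which the restricted involution leaves
  alone.\<close>

definition entries_from :: "box set \<Rightarrow> (box \<Rightarrow> nat) \<Rightarrow> nat \<Rightarrow> nat \<Rightarrow> nat" where
  "entries_from A T J k = card {b \<in> A. J \<le> snd b \<and> T b = k}"

definition bk_active :: "box set \<Rightarrow> nat \<Rightarrow> nat \<Rightarrow> (box \<Rightarrow> nat) \<Rightarrow> box set" where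
  "bk_active A k J T = {b \<in> A. snd b < J \<and> (T b = k \<or> T b = Suc k)}"

definition free_columns :: "box set \<Rightarrow> nat \<Rightarrow> nat set" where
  "free_columns U i = {j. (i, j) \<in> U \<and> (Suc i, j) \<notin> U \<and> (i - 1, j) \<notin> U}"

text \<open>An involution on the active boxes. Replacing an entry by \<open>2 * k + 1\<close> minus
  the entry of its partner reproduces a vertical domino, and turns a free block of \<open>a\<close>
  entries \<open>k\<close> and \<open>b\<close> entries \<open>k + 1\<close> into one of
  \<open>b\<close> entries \<open>k\<close> and \<open>a\<close> entries
  \<open>k + 1\<close>.\<close>

definition bk_partner :: "box set \<Rightarrow> box \<Rightarrow> box" where
  "bk_partner U = (\<lambda>(i, j). if (Suc i, j) \<in> U then (Suc i, j)
     else if (i - 1, j) \<in> U then (i - 1, j)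
     else (i, Min (free_columns U i) + Max (free_columns U i) - j))"

text \<open>The Bender--Knuth involution restricted to the columns left of column \<open>J\<close>: a vertical
  domino of entries \<open>k\<close> and \<open>k + 1\<close> is kept, and in every row the remaining block of entries
  \<open>k\<close> and \<open>k + 1\<close> is reversed while these entries are exchanged.\<close>

definition bender_knuth :: "box set \<Rightarrow> nat \<Rightarrow> nat \<Rightarrow> (box \<Rightarrow> nat) \<Rightarrow> box \<Rightarrow> nat" where
  "bender_knuth A k J T = (\<lambda>b. if b \<in> bk_active A k J T
     then 2 * k + 1 - T (bk_partner (bk_active A k J T) b) else T b)"

lemma skew_diagramD:
  assumes "skew_diagram A"
  shows "finite A" "(i, j) \<in> A \<Longrightarrow> 1 \<le> i" "(i, j) \<in> A \<Longrightarrow> 1 \<le> j"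
    "(i, j) \<in> A \<Longrightarrow> (i', j') \<in> A \<Longrightarrow> i \<le> a \<Longrightarrow> a \<le> i' \<Longrightarrow> j \<le> b \<Longrightarrow> b \<le> j' \<Longrightarrow> (a, b) \<in> A"
  using assms unfolding skew_diagram_iff box_convex_def by blast+

lemma semistandard_row:
  "semistandard A T \<Longrightarrow> (i, j) \<in> A \<Longrightarrow> (i, j') \<in> A \<Longrightarrow> j \<le> j' \<Longrightarrow> T (i, j) \<le> T (i, j')"
  unfolding semistandard_def by (metis le_eq_less_or_eq)

lemma semistandard_column:
  "semistandard A T \<Longrightarrow> (i, j) \<in> A \<Longrightarrow> (i', j) \<in> A \<Longrightarrow> i < i' \<Longrightarrow> T (i, j) < T (i', j)"
  unfolding semistandard_def by blast

lemma semistandard_se: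
  assumes "skew_diagram A" "semistandard A T" "(i, j) \<in> A" "(i', j') \<in> A" "i < i'" "j \<le> j'"
  shows "T (i, j) < T (i', j')"
proof -
  have "(i', j) \<in> A" using skew_diagramD(4)[OF assms(1,3,4)] assms by simp
  then show ?thesis
    using semistandard_column[OF assms(2,3), of i'] semistandard_row[OF assms(2), of i' j j'] assms
    by simp
qed

text \<open>Column \<open>J\<close> is the barrier for the restricted exchange. A row may acquire an
  entry \<open>k + 1\<close> just left of it, which stays semistandard because \<open>k\<close> does
  not occur in column \<open>J\<close>. If \<open>J\<close> lies beyond all boxes, this is the
  ordinary involution.\<close>

locale bk_setup =
  fixes A :: "box set" and T :: "box \<Rightarrow> nat" and k J :: nat
  assumes A: "skew_diagram A" and T: "semistandard A T"
    and noJ: "\<And>i. (i, J) \<in> A \<Longrightarrow> T (i, J) \<noteq> k"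
begin

abbreviation "U \<equiv> bk_active A k J T"
abbreviation "F \<equiv> free_columns U"
abbreviation "T' \<equiv> bender_knuth A k J T"

lemmas conv = skew_diagramD(4)[OF A]
lemmas pos = skew_diagramD(2)[OF A]
lemmas row = semistandard_row[OF T]
lemmas col = semistandard_column[OF T]

lemma U: "(i, j) \<in> U \<longleftrightarrow> (i, j) \<in> A \<and> j < J \<and> (T (i, j) = k \<or> T (i, j) = Suc k)"
  by (auto simp: bk_active_def)

lemma U_pos: "(i, j) \<in> U \<Longrightarrow> 1 \<le> i" using pos by (auto simp: U)

lemma vertical:
  assumes "(i, j) \<in> U" "(Suc i, j) \<in> U"
  shows "T (i, j) = k" "T (Suc i, j) = Suc k"
  using assms col[of i j "Suc i"] by (auto simp: U)

lemma above: "(i, j) \<in> U \<Longrightarrow> (i - 1, j) \<in> U \<Longrightarrow> T (i - 1, j) = k \<and> T (i, j) = Suc k"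
  using vertical[of "i - 1" j] U_pos[of i j] by simp

lemma no_triple:
  assumes "(i, j) \<in> U" "(Suc i, j) \<in> U"
  shows "(Suc (Suc i), j) \<notin> U" "(i - 1, j) \<notin> U"
proof -
  show "(Suc (Suc i), j) \<notin> U" using vertical[OF assms] vertical[of "Suc i" j] assms by auto
  show "(i - 1, j) \<notin> U" using vertical[OF assms] above[of i j] assms by auto
qed

text \<open>In a row of active boxes the upper halves of dominos therefore stand to the left of all
  others.\<close>

lemma below_left:
  assumes "(i, j) \<in> U" "(Suc i, j) \<in> U" "(i, j') \<in> U" "j' \<le> j"
  shows "(Suc i, j') \<in> U"
proof -
  have T1: "T (i, j) = k" "T (Suc i, j) = Suc k" by (rule vertical[OF assms(1,2)])+
  have m: "(i, j) \<in> A" "(Suc i, j) \<in> A" "(i, j') \<in> A" using assms by (auto simp: U)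
  have b: "(Suc i, j') \<in> A" using conv[OF m(3,2)] assms by simp
  have "T (Suc i, j') \<le> Suc k" using row[OF b m(2)] assms T1 by simp
  moreover have "T (i, j') < T (Suc i, j')" using col[OF m(3) b] by simp
  ultimately show ?thesis using assms b by (auto simp: U)
qed

text \<open>Mirror image of the preceding property: lower halves of dominos stand at the right end
  of the active boxes of their row.\<close>

lemma above_right:
  assumes "(i, j) \<in> U" "(i - 1, j) \<in> U" "(i, j') \<in> U" "j \<le> j'"
  shows "(i - 1, j') \<in> U"
proof -
  have i: "1 \<le> i" using U_pos[OF assms(1)] .
  have T1: "T (i - 1, j) = k" "T (i, j) = Suc k" using above[OF assms(1,2)] by auto
  have m: "(i, j) \<in> A" "(i - 1, j) \<in> A" "(i, j') \<in> A" using assms by (auto simp: U)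
  have b: "(i - 1, j') \<in> A" using conv[OF m(2,3)] assms by simp
  have "k \<le> T (i - 1, j')" using row[OF m(2) b] assms T1 by simp
  moreover have "T (i - 1, j') < T (i, j')" using col[OF b m(3)] i by simp
  ultimately show ?thesis using assms b by (auto simp: U)
qed

lemma finite_F: "finite (F i)"
proof -
  have "F i \<subseteq> {..<J}" by (auto simp: free_columns_def U)
  then show ?thesis by (rule finite_subset) simp
qed

text \<open>With upper halves of dominos at the left and lower halves at the right, the free boxes
  of a row are contiguous, so that reflection in the middle of the block makes sense.\<close>

lemma F_interval:
  assumes "j1 \<in> F i" "j2 \<in> F i" "j1 \<le> j" "j \<le> j2"
  shows "j \<in> F i"
proof -
  have u: "(i, j1) \<in> U" "(i, j2) \<in> U" "(Suc i, j1) \<notin> U" "(i - 1, j2) \<notin> U"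
    using assms by (auto simp: free_columns_def)
  then have m: "(i, j1) \<in> A" "(i, j2) \<in> A" "k \<le> T (i, j1)" "T (i, j2) \<le> Suc k" "j2 < J"
    by (auto simp: U)
  then have j: "(i, j) \<in> A" using conv[OF m(1,2)] assms by simp
  then have "k \<le> T (i, j)" "T (i, j) \<le> Suc k" using row[OF m(1) j] row[OF j m(2)] assms m by auto
  then have ju: "(i, j) \<in> U" using j m assms by (auto simp: U)
  then show ?thesis
    using below_left[OF ju _ u(1)] above_right[OF ju _ u(2)] u assms
    by (auto simp: free_columns_def)
qed

lemma reflect:
  assumes "j \<in> F i"
  shows "Min (F i) + Max (F i) - j \<in> F i" "j \<le> Min (F i) + Max (F i)"
proof -
  have m: "Min (F i) \<in> F i" "Max (F i) \<in> F i" "Min (F i) \<le> j" "j \<le> Max (F i)"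
    using assms finite_F[of i] by (auto intro: Min_in Max_in)
  show "Min (F i) + Max (F i) - j \<in> F i"
    by (rule F_interval[OF m(1,2)]) (use m(3,4) in linarith)+
  show "j \<le> Min (F i) + Max (F i)" using m(4) by linarith
qed

lemma partner_cases:
  assumes "(i, j) \<in> U"
  obtains (below) "(Suc i, j) \<in> U" "(i - 1, j) \<notin> U" "bk_partner U (i, j) = (Suc i, j)"
  | (above) "(i - 1, j) \<in> U" "(Suc i, j) \<notin> U" "bk_partner U (i, j) = (i - 1, j)"
  | (free) "j \<in> F i" "bk_partner U (i, j) = (i, Min (F i) + Max (F i) - j)"
  using assms no_triple[OF assms]
  by (cases "(Suc i, j) \<in> U"; cases "(i - 1, j) \<in> U") (auto simp: bk_partner_def free_columns_def)

lemma partner: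
  assumes "b \<in> U"
  shows "bk_partner U b \<in> U \<and> bk_partner U (bk_partner U b) = b"
proof -
  obtain i j where b: "b = (i, j)" by fastforce
  have u: "(i, j) \<in> U" using assms b by simp
  show ?thesis using u
  proof (cases rule: partner_cases)
    case below
    then show ?thesis using u no_triple[OF u] by (simp add: b bk_partner_def)
  next
    case above
    then show ?thesis using u U_pos[OF u] by (simp add: b bk_partner_def)
  next
    case free
    let ?j = "Min (F i) + Max (F i) - j"
    have "?j \<in> F i" by (rule reflect[OF free(1)])
    then have "(i, ?j) \<in> U" "bk_partner U (i, ?j) = (i, Min (F i) + Max (F i) - ?j)"
      by (auto simp: free_columns_def bk_partner_def)
    then show ?thesis using free reflect[OF free(1)] by (simp add: b)
  qed
qed

lemma U_values: "b \<in> U \<Longrightarrow> T b = k \<or> T b = Suc k" by (auto simp: bk_active_def)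

lemma T'_U: "b \<in> U \<Longrightarrow> T' b = 2 * k + 1 - T (bk_partner U b)" by (simp add: bender_knuth_def)

lemma T'_not_U: "b \<notin> U \<Longrightarrow> T' b = T b" by (simp add: bender_knuth_def)

lemma T'_values: "b \<in> U \<Longrightarrow> T' b = k \<or> T' b = Suc k"
  using T'_U U_values[of "bk_partner U b"] partner[of b] by auto

lemma active_T': "bk_active A k J T' = U"
proof -
  have "b \<in> bk_active A k J T' \<longleftrightarrow> b \<in> U" for b
    using T'_values[of b] T'_not_U[of b] by (cases "b \<in> U") (auto simp: bk_active_def)
  then show ?thesis by blast
qed

lemma involution: "bender_knuth A k J T' = T"
proof
  fix b
  show "bender_knuth A k J T' b = T b"
  proof (cases "b \<in> U")
    case True
    then have "bender_knuth A k J T' b = 2 * k + 1 - T' (bk_partner U b)"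
      unfolding bender_knuth_def[of A k J T'] active_T' by simp
    also have "\<dots> = 2 * k + 1 - (2 * k + 1 - T b)" using T'_U partner[OF True] by simp
    also have "\<dots> = T b" using U_values[OF True] by auto
    finally show ?thesis .
  next
    case False
    then show ?thesis
      unfolding bender_knuth_def[of A k J T'] active_T' by (simp add: T'_not_U)
  qed
qed

lemma T'_above_below:
  assumes "(i, j) \<in> U"
  shows "(Suc i, j) \<in> U \<Longrightarrow> T' (i, j) = k" "(i - 1, j) \<in> U \<Longrightarrow> T' (i, j) = Suc k"
  using assms vertical[OF assms] above[OF assms] no_triple[OF assms] U_pos[OF assms]
  by (auto simp: T'_U bk_partner_def)

lemma T'_row:
  assumes m: "(i, j) \<in> A" "(i, j') \<in> A" "j < j'"
  shows "T' (i, j) \<le> T' (i, j')"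
proof -
  have r: "T (i, j) \<le> T (i, j')" using row m by simp
  show ?thesis
  proof (cases "(i, j) \<in> U"; cases "(i, j') \<in> U")
    assume u: "(i, j) \<in> U" "(i, j') \<notin> U"
    then have k: "k \<le> T (i, j)" "j < J" by (auto simp: U)
    \<comment> \<open>When \<open>j'\<close> is at \<open>J\<close> or beyond, the row crosses
      column \<open>J\<close> in an entry that is at least \<open>k\<close> but different from
      \<open>k\<close>.\<close>
    have "Suc k \<le> T (i, j')"
    proof (cases "j' < J")
      case True
      then show ?thesis using u k r m by (auto simp: U)
    next
      case False
      have "(i, J) \<in> A" using conv[OF m(1,2)] False k by simp
      moreover from this have "T (i, j) \<le> T (i, J)" "T (i, J) \<le> T (i, j')"
        using row m False k by auto
      ultimately show ?thesis using noJ[of i] k by simp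
    qed
    then show ?thesis using T'_values[OF u(1)] T'_not_U[OF u(2)] by auto
  next
    assume u: "(i, j) \<notin> U" "(i, j') \<in> U"
    then have "T (i, j) < k" using r m by (auto simp: U)
    then show ?thesis using T'_values[OF u(2)] T'_not_U[OF u(1)] by auto
  next
    assume u: "(i, j) \<in> U" "(i, j') \<in> U"
    show ?thesis
      using u(1)
    proof (cases rule: partner_cases)
      case below
      then show ?thesis using T'_above_below(1)[OF u(1)] T'_values[OF u(2)] by auto
    next
      case above
      then have "(i - 1, j') \<in> U" using above_right[OF u(1) _ u(2)] m by simp
      then show ?thesis using T'_above_below(2)[OF u(2)] T'_values[OF u(1)] by auto
    next
      case f: free
      show ?thesis
        using u(2)
      proof (cases rule: partner_cases)
        case below
        then have "(Suc i, j) \<in> U" using below_left[OF u(2) _ u(1)] m by simp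
        then show ?thesis using f by (simp add: free_columns_def)
      next
        case above
        then show ?thesis using T'_above_below(2)[OF u(2)] T'_values[OF u(1)] by auto
      next
        case f': free
        let ?s = "Min (F i) + Max (F i)"
        have "(i, ?s - j) \<in> A" "(i, ?s - j') \<in> A"
          using reflect(1)[OF f(1)] reflect(1)[OF f'(1)] by (auto simp: free_columns_def U)
        \<comment> \<open>Reflection reverses the order in the block and complementing the entries
          reverses it once more.\<close>
        then have "T (i, ?s - j') \<le> T (i, ?s - j)" using row[of i "?s - j'" "?s - j"] m by simp
        then show ?thesis using u f f' by (simp add: T'_U)
      qed
    qed
  qed (use r in \<open>simp add: T'_not_U\<close>)
qed

lemma T'_column:
  assumes m: "(i, j) \<in> A" "(i', j) \<in> A" "i < i'"
  shows "T' (i, j) < T' (i', j)"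
proof -
  have r: "T (i, j) < T (i', j)" using col m by simp
  show ?thesis
  proof (cases "(i, j) \<in> U"; cases "(i', j) \<in> U")
    assume u: "(i, j) \<in> U" "(i', j) \<notin> U"
    then have "Suc k < T (i', j)" using r m by (auto simp: U)
    then show ?thesis using T'_values[OF u(1)] T'_not_U[OF u(2)] by auto
  next
    assume u: "(i, j) \<notin> U" "(i', j) \<in> U"
    then have "T (i, j) < k" using r m by (auto simp: U)
    then show ?thesis using T'_values[OF u(2)] T'_not_U[OF u(1)] by auto
  next
    assume u: "(i, j) \<in> U" "(i', j) \<in> U"
    then have k: "T (i, j) = k" "T (i', j) = Suc k" using r by (auto simp: U)
    have "i' = Suc i"
    proof (rule ccontr)
      assume "i' \<noteq> Suc i"
      then have "Suc i < i'" using m by simp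
      moreover from this have "(Suc i, j) \<in> A" using conv[OF m(1,2)] by simp
      ultimately have "T (i, j) < T (Suc i, j)" "T (Suc i, j) < T (i', j)"
        using col m by auto
      then show False using k by simp
    qed
    then show ?thesis
      using T'_above_below(1)[OF u(1)] T'_above_below(2)[OF u(2)] u by simp
  qed (use r in \<open>simp add: T'_not_U\<close>)
qed

lemma semistandard_T': "1 \<le> k \<Longrightarrow> semistandard A T'"
  unfolding semistandard_def
proof (intro conjI allI impI ballI)
  fix b assume "1 \<le> k" "b \<in> A"
  moreover from this have "1 \<le> T b" using T by (auto simp: semistandard_def)
  ultimately show "1 \<le> T' b" using T'_values[of b] T'_not_U[of b] by fastforce
qed (use T'_row T'_column in auto)

lemma ssyt_T':
  assumes "T \<in> ssyt n A" "1 \<le> k" "k < n"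
  shows "T' \<in> ssyt n A"
proof -
  have "T' b \<le> n" if "b \<in> A" for b
    using assms that T'_values[of b] T'_not_U[of b] by (cases "b \<in> U") (auto simp: ssyt_def)
  moreover have "T' b = 0" if "b \<notin> A" for b
    using assms that T'_not_U[of b] by (cases b) (simp add: ssyt_def bk_active_def)
  ultimately show ?thesis using semistandard_T'[OF assms(2)] by (simp add: ssyt_def)
qed

lemma entries_from_T': "J \<le> J' \<Longrightarrow> entries_from A T' J' l = entries_from A T J' l"
  unfolding entries_from_def
  by (rule arg_cong[of _ _ card]) (auto simp: bender_knuth_def bk_active_def)

lemma entries_split:
  assumes "l = k \<or> l = Suc k"
  shows "entries A S l = entries_from A S J l + card {b \<in> bk_active A k J S. S b = l}"
proof -
  have "{b \<in> A. S b = l} = {b \<in> A. J \<le> snd b \<and> S b = l} \<union> {b \<in> bk_active A k J S. S b = l}"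
    using assms by (auto simp: bk_active_def)
  moreover have "card ({b \<in> A. J \<le> snd b \<and> S b = l} \<union> {b \<in> bk_active A k J S. S b = l}) =
    card {b \<in> A. J \<le> snd b \<and> S b = l} + card {b \<in> bk_active A k J S. S b = l}"
    using skew_diagramD(1)[OF A] by (intro card_Un_disjoint) (auto simp: bk_active_def)
  ultimately show ?thesis by (simp add: entries_def entries_from_def)
qed

lemma card_U:
  assumes "l = k \<or> l = Suc k"
  shows "card {b \<in> U. T' b = l} = card {b \<in> U. T b = 2 * k + 1 - l}"
proof (rule bij_betw_same_card[of "bk_partner U"], rule bij_betwI[where g = "bk_partner U"])
  show "bk_partner U \<in> {b \<in> U. T' b = l} \<rightarrow> {b \<in> U. T b = 2 * k + 1 - l}"
  proof
    fix b assume "b \<in> {b \<in> U. T' b = l}"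
    then show "bk_partner U b \<in> {b \<in> U. T b = 2 * k + 1 - l}"
      using assms partner[of b] U_values[of "bk_partner U b"] T'_U[of b] by auto
  qed
  show "bk_partner U \<in> {b \<in> U. T b = 2 * k + 1 - l} \<rightarrow> {b \<in> U. T' b = l}"
  proof
    fix b assume "b \<in> {b \<in> U. T b = 2 * k + 1 - l}"
    then show "bk_partner U b \<in> {b \<in> U. T' b = l}"
      using assms partner[of b] T'_U[of "bk_partner U b"] by simp linarith
  qed
qed (use partner in auto)

text \<open>Left of \<open>J\<close> the numbers of \<open>k\<close> and \<open>k + 1\<close> are
  exchanged, from \<open>J\<close> on they stay. The additive form avoids truncated
  subtraction.\<close>

lemma entries_T':
  "entries A T' k + entries_from A T J (Suc k) = entries_from A T J k + entries A T (Suc k)"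
  "entries A T' (Suc k) + entries_from A T J k = entries_from A T J (Suc k) + entries A T k"
  using entries_split[of k T'] entries_split[of "Suc k" T'] entries_split[of k T]
    entries_split[of "Suc k" T] card_U[of k] card_U[of "Suc k"]
  by (simp_all add: entries_from_T' active_T')

lemma entries_T'_other:
  assumes "l \<noteq> k" "l \<noteq> Suc k"
  shows "entries A T' l = entries A T l"
proof -
  have "T' b = l \<longleftrightarrow> T b = l" for b
    using assms T'_values[of b] U_values[of b] T'_not_U[of b] by (cases "b \<in> U") auto
  then show ?thesis by (simp add: entries_def)
qed

end

section \<open>The Littlewood--Richardson rule\<close>

definition column_lattice :: "nat \<Rightarrow> box set \<Rightarrow> (box \<Rightarrow> nat) \<Rightarrow> bool" where
  "column_lattice n A T \<longleftrightarrow>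
     (\<forall>J k. 1 \<le> k \<longrightarrow> k < n \<longrightarrow> entries_from A T J (Suc k) \<le> entries_from A T J k)"

text \<open>Reading stops at the leftmost \<open>k + 1\<close> of the lowest row \<open>i\<close>
  that has a \<open>k + 1\<close> in column \<open>J\<close> or further right. By then all entries
  \<open>k + 1\<close> counted in \<open>C\<close> have been read, together with those of row
  \<open>i\<close> left of \<open>J\<close>, the set \<open>D\<close>. The entries \<open>k\<close>
  read left of \<open>J\<close> are at most as many as \<open>D\<close>, so the reading condition
  remains valid after the columns left of \<open>J\<close> are discarded.\<close>

lemma lattice_reading_imp_column_lattice:
  assumes A: "skew_diagram A" and T: "semistandard A T" and lat: "lattice_reading A T" and k: "1 \<le> k"
  shows "entries_from A T J (Suc k) \<le> entries_from A T J k"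
proof -
  note fin = skew_diagramD(1)[OF A]
  define C where "C = {b \<in> A. J \<le> snd b \<and> T b = Suc k}"
  show ?thesis
  proof (cases "C = {}")
    case True
    then show ?thesis unfolding entries_from_def C_def[symmetric] by simp
  next
    case False
    have finC: "finite C" using fin by (simp add: C_def)
    define i where "i = Max (fst ` C)"
    have "i \<in> fst ` C" unfolding i_def using finC False by (intro Max_in) auto
    then obtain jc where jc: "(i, jc) \<in> C" by auto
    then have jc': "(i, jc) \<in> A" "J \<le> jc" "T (i, jc) = Suc k" by (auto simp: C_def)
    define Y where "Y = {j. (i, j) \<in> A \<and> T (i, j) = Suc k}"
    define j0 where "j0 = (LEAST j. j \<in> Y)"
    have j0: "j0 \<in> Y" unfolding j0_def by (rule LeastI[of _ jc]) (use jc' in \<open>simp add: Y_def\<close>)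
    have j0_le: "j0 \<le> j" if "j \<in> Y" for j unfolding j0_def by (rule Least_le) (rule that)
    define R where "R = read_upto A (i, j0)"
    have finR: "finite R" unfolding R_def read_upto_def using fin by simp
    define D where "D = {b \<in> A. fst b = i \<and> snd b < J \<and> T b = Suc k}"
    define E where "E = {c \<in> R. snd c < J \<and> T c = k}"
    have finD: "finite D" using fin by (simp add: D_def)
    have "C \<union> D \<subseteq> {c \<in> R. T c = k + 1}"
    proof
      fix c assume c: "c \<in> C \<union> D"
      then have cA: "c \<in> A" "T c = Suc k" by (auto simp: C_def D_def)
      have "fst c \<le> i"
      proof (cases "c \<in> C")
        case True
        then show ?thesis unfolding i_def using finC by (intro Max_ge) auto
      qed (use c in \<open>simp add: D_def\<close>)
      moreover have "j0 \<le> snd c" if "fst c = i"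
        using j0_le[of "snd c"] cA that by (cases c) (auto simp: Y_def)
      ultimately show "c \<in> {c \<in> R. T c = k + 1}" using cA by (auto simp: R_def read_upto_def)
    qed
    then have "card (C \<union> D) \<le> card {c \<in> R. T c = k + 1}" using finR by (intro card_mono) auto
    moreover have "card (C \<union> D) = card C + card D"
      using finC finD by (intro card_Un_disjoint) (auto simp: C_def D_def)
    moreover have "card {c \<in> R. T c = k + 1} \<le> card {c \<in> R. T c = k}"
      using lat j0 k unfolding lattice_reading_def R_def by (auto simp: Y_def)
    moreover have "card {c \<in> R. T c = k} \<le> card ({b \<in> A. J \<le> snd b \<and> T b = k} \<union> E)"
      using fin finR by (intro card_mono) (auto simp: E_def R_def read_upto_def)
    moreover have "\<dots> \<le> card {b \<in> A. J \<le> snd b \<and> T b = k} + card E" by (rule card_Un_le)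
    \<comment> \<open>Dropping such a \<open>k\<close> vertically into row \<open>i\<close> lands in
      the diagram by convexity, on an entry larger than \<open>k\<close> and at most
      \<open>k + 1\<close>.\<close>
    moreover have "card E \<le> card D"
    proof (rule card_inj_on_le[of "\<lambda>c. (i, snd c)"])
      have E: "fst c < i" "c \<in> A" if "c \<in> E" for c
      proof -
        show "c \<in> A" using that by (auto simp: E_def R_def read_upto_def)
        have "\<not> (fst c = i \<and> j0 \<le> snd c)"
        proof
          assume *: "fst c = i \<and> j0 \<le> snd c"
          then have "T (i, j0) \<le> T (i, snd c)"
            using semistandard_row[OF T, of i j0 "snd c"] j0 \<open>c \<in> A\<close> by (cases c) (auto simp: Y_def)
          moreover have "T (i, snd c) = k" using * that by (cases c) (auto simp: E_def)
          ultimately show False using j0 by (simp add: Y_def)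
        qed
        then show "fst c < i" using that by (auto simp: E_def R_def read_upto_def)
      qed
      show "inj_on (\<lambda>c. (i, snd c)) E"
      proof (rule inj_onI)
        fix c d assume *: "c \<in> E" "d \<in> E" "(i, snd c) = (i, snd d)"
        obtain a a' b where cd: "c = (a, b)" "d = (a', b)" using * by (cases c; cases d) auto
        have "T c = T d" using * by (simp add: E_def)
        then show "c = d"
          using semistandard_column[OF T, of a b a'] semistandard_column[OF T, of a' b a] cd E *
          by (cases a a' rule: linorder_cases) auto
      qed
      show "(\<lambda>c. (i, snd c)) ` E \<subseteq> D"
      proof
        fix d assume "d \<in> (\<lambda>c. (i, snd c)) ` E"
        then obtain a b where d: "d = (i, b)" "(a, b) \<in> E" by auto
        have ab: "(a, b) \<in> A" "a < i" "b < J" "T (a, b) = k" using E[OF d(2)] d(2) by (auto simp: E_def)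
        have "(i, b) \<in> A" using skew_diagramD(4)[OF A ab(1) jc'(1)] ab jc' by simp
        moreover from this have "T (i, b) \<le> Suc k" "k < T (i, b)"
          using semistandard_row[OF T _ jc'(1), of b] semistandard_column[OF T ab(1), of i] ab jc' by auto
        ultimately show "d \<in> D" using ab d by (auto simp: D_def)
      qed
    qed (rule finD)
    ultimately have "card C \<le> card {b \<in> A. J \<le> snd b \<and> T b = k}" by linarith
    then show ?thesis by (simp add: entries_from_def C_def)
  qed
qed

text \<open>Let \<open>(i, j)\<close> be the leftmost of the lowest \<open>k + 1\<close> read so
  far. Entries increase strictly towards the southeast, so every \<open>k + 1\<close> read lies in
  column \<open>j\<close> or further right, while every \<open>k\<close> of these columns lies above
  row \<open>i\<close> and has been read.\<close>

lemma column_lattice_imp_lattice_reading: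
  assumes A: "skew_diagram A" and T: "T \<in> ssyt n A" and lat: "column_lattice n A T"
  shows "lattice_reading A T"
  unfolding lattice_reading_def
proof (intro ballI allI impI)
  fix b k assume b: "b \<in> A" and k: "(1::nat) \<le> k"
  note fin = skew_diagramD(1)[OF A]
  have ss: "semistandard A T" using T by (simp add: ssyt_def)
  define X where "X = {c \<in> read_upto A b. T c = Suc k}"
  have finX: "finite X" using fin by (simp add: X_def read_upto_def)
  show "card {c \<in> read_upto A b. T c = k + 1} \<le> card {c \<in> read_upto A b. T c = k}"
  proof (cases "X = {}")
    case True
    then have "card {c \<in> read_upto A b. T c = k + 1} = 0"
      unfolding X_def by (metis Suc_eq_plus1 card.empty)
    then show ?thesis by simp
  next
    case False
    define i where "i = Max (fst ` X)"
    have "i \<in> fst ` X" unfolding i_def using finX False by (intro Max_in) auto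
    then obtain jc where jc: "(i, jc) \<in> X" by auto
    define j where "j = (LEAST j. (i, j) \<in> X)"
    have j: "(i, j) \<in> X" unfolding j_def by (rule LeastI[of _ jc]) (rule jc)
    have j_le: "j \<le> j'" if "(i, j') \<in> X" for j' unfolding j_def by (rule Least_le) (rule that)
    have ij: "(i, j) \<in> A" "T (i, j) = Suc k" "i \<le> fst b"
      using j by (auto simp: X_def read_upto_def)
    have "k < n" using ij T by (auto simp: ssyt_def)
    have "X \<subseteq> {c \<in> A. j \<le> snd c \<and> T c = Suc k}"
    proof
      fix c assume c: "c \<in> X"
      obtain a d where ad: "c = (a, d)" by fastforce
      have cA: "(a, d) \<in> A" "T (a, d) = Suc k" using c ad by (auto simp: X_def read_upto_def)
      have "fst c \<le> i" unfolding i_def using finX c by (intro Max_ge) auto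
      then have "j \<le> d"
        using j_le[of d] semistandard_se[OF A ss cA(1) ij(1)] c ad cA ij
        by (cases "a = i"; cases "j \<le> d") auto
      then show "c \<in> {c \<in> A. j \<le> snd c \<and> T c = Suc k}" using cA ad by simp
    qed
    then have "card X \<le> entries_from A T j (Suc k)"
      unfolding entries_from_def using fin by (intro card_mono) auto
    also have "\<dots> \<le> entries_from A T j k" using lat k \<open>k < n\<close> by (simp add: column_lattice_def)
    also have "\<dots> \<le> card {c \<in> read_upto A b. T c = k}"
      unfolding entries_from_def
    proof (intro card_mono subsetI)
      fix c assume c: "c \<in> {c \<in> A. j \<le> snd c \<and> T c = k}"
      obtain a d where ad: "c = (a, d)" by fastforce
      have cA: "(a, d) \<in> A" "T (a, d) = k" "j \<le> d" using c ad by auto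
      have "a < i"
        using semistandard_row[OF ss ij(1), of d] semistandard_se[OF A ss ij(1) cA(1)] cA ij
        by (cases a i rule: linorder_cases) auto
      then show "c \<in> {c \<in> read_upto A b. T c = k}" using cA ad ij by (simp add: read_upto_def)
    qed (use fin in \<open>simp add: read_upto_def\<close>)
    finally show ?thesis by (simp add: X_def)
  qed
qed

lemma lattice_reading_iff:
  assumes "skew_diagram A" "T \<in> ssyt n A"
  shows "lattice_reading A T \<longleftrightarrow> column_lattice n A T"
  using lattice_reading_imp_column_lattice[OF assms(1)] column_lattice_imp_lattice_reading[OF assms] assms(2)
  by (auto simp: column_lattice_def ssyt_def)

lemma finite_ssyt:
  assumes "finite A"
  shows "finite (ssyt n A)"
proof (rule finite_subset)
  show "ssyt n A \<subseteq> {T. \<forall>b. (b \<in> A \<longrightarrow> T b \<in> {..n}) \<and> (b \<notin> A \<longrightarrow> T b = 0)}"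
    unfolding ssyt_def by blast
  show "finite {T. \<forall>b. (b \<in> A \<longrightarrow> T b \<in> {..n}) \<and> (b \<notin> A \<longrightarrow> T b = (0::nat))}"
    by (rule finite_set_of_finite_funs) (use assms in auto)
qed

lemma sum_entries:
  assumes "finite A" "T \<in> ssyt n A"
  shows "(\<Sum>k = 1..n. entries A T k) = card A"
proof -
  have "A = (\<Union>k\<in>{1..n}. {b \<in> A. T b = k})"
    using assms(2) by (auto simp: ssyt_def semistandard_def)
  then have "card A = card (\<Union>k\<in>{1..n}. {b \<in> A. T b = k})" by simp
  also have "\<dots> = (\<Sum>k = 1..n. card {b \<in> A. T b = k})"
    using assms(1) by (intro card_UN_disjoint) auto
  finally show ?thesis by (simp add: entries_def)
qed

section \<open>Skew Kostka numbers and their symmetry\<close>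

definition content_is :: "nat \<Rightarrow> box set \<Rightarrow> (box \<Rightarrow> nat) \<Rightarrow> (nat \<Rightarrow> int) \<Rightarrow> bool" where
  "content_is n A T al \<longleftrightarrow> (\<forall>k\<in>{1..n}. int (entries A T k) = al k)"

text \<open>Coefficients of the skew Schur polynomial in \<open>n\<close> variables. Contents are
  integers because exponents shifted by \<open>n - k\<close> may become negative; the number is then
  0.\<close>

definition kostka :: "nat \<Rightarrow> box set \<Rightarrow> (nat \<Rightarrow> int) \<Rightarrow> nat" where
  "kostka n A al = card {T \<in> ssyt n A. content_is n A T al}"

definition lattice_kostka :: "nat \<Rightarrow> box set \<Rightarrow> (nat \<Rightarrow> int) \<Rightarrow> nat" where
  "lattice_kostka n A al = card {T \<in> ssyt n A. column_lattice n A T \<and> content_is n A T al}"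

text \<open>The barrier is placed to the right of all boxes, where nothing is fixed and the
  involution exchanges the full numbers of \<open>k\<close> and \<open>k + 1\<close>.\<close>

lemma kostka_adjacent:
  assumes A: "skew_diagram A" and k: "1 \<le> k" "k < n"
  shows "kostka n A (al \<circ> Transposition.transpose k (Suc k)) = kostka n A al"
proof -
  note fin = skew_diagramD(1)[OF A]
  define J where "J = Suc (Max (insert 0 (snd ` A)))"
  have J: "snd b < J" if "b \<in> A" for b
    unfolding J_def less_Suc_eq_le using fin that by (intro Max_ge) auto
  let ?t = "Transposition.transpose k (Suc k)"
  have bk: "bk_setup A T k J" if "T \<in> ssyt n A" for T
  proof
    show "T (i, J) \<noteq> k" if "(i, J) \<in> A" for i using J[OF that] by simp
  qed (use A that in \<open>simp_all add: ssyt_def\<close>)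
  have e0: "entries_from A T J l = 0" for T l
  proof -
    have "{b \<in> A. J \<le> snd b \<and> T b = l} = {}" using J by fastforce
    then show ?thesis unfolding entries_from_def by (simp only: card.empty)
  qed
  have cont: "content_is n A (bender_knuth A k J T) (ga \<circ> ?t)"
    if T: "T \<in> ssyt n A" and c: "content_is n A T ga" for T and ga :: "nat \<Rightarrow> int"
    unfolding content_is_def
  proof
    fix l assume l: "l \<in> {1..n}"
    have *: "int (entries A T l) = ga l" if "l \<in> {1..n}" for l using c that by (simp add: content_is_def)
    show "int (entries A (bender_knuth A k J T) l) = (ga \<circ> ?t) l"
      using bk_setup.entries_T'[OF bk[OF T]] bk_setup.entries_T'_other[OF bk[OF T], of l]
        *[of k] *[of "Suc k"] *[of l] k l
      by (cases "l = k"; cases "l = Suc k") (auto simp: e0)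
  qed
  have step: "bender_knuth A k J T \<in> {T \<in> ssyt n A. content_is n A T (ga \<circ> ?t)}"
    if "T \<in> {T \<in> ssyt n A. content_is n A T ga}" for T and ga :: "nat \<Rightarrow> int"
    using that cont[of T ga] bk_setup.ssyt_T'[OF bk _ k, of T] by auto
  show ?thesis
    unfolding kostka_def
  proof (rule bij_betw_same_card[of "bender_knuth A k J"], rule bij_betwI[where g = "bender_knuth A k J"])
    have tt: "al \<circ> ?t \<circ> ?t = al" by (simp add: o_assoc[symmetric])
    show "bender_knuth A k J \<in> {T \<in> ssyt n A. content_is n A T (al \<circ> ?t)} \<rightarrow>
      {T \<in> ssyt n A. content_is n A T al}"
      using step[of _ "al \<circ> ?t"] unfolding tt by blast
    show "bender_knuth A k J \<in> {T \<in> ssyt n A. content_is n A T al} \<rightarrow>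
      {T \<in> ssyt n A. content_is n A T (al \<circ> ?t)}"
      using step[of _ al] by blast
  qed (use bk_setup.involution[OF bk] in auto)
qed

text \<open>A transposition of distant letters is a shorter one conjugated by an adjacent
  one.\<close>

lemma kostka_transpose:
  assumes A: "skew_diagram A" and "1 \<le> a" "a < b" "b \<le> n"
  shows "kostka n A (al \<circ> Transposition.transpose a b) = kostka n A al"
  using assms(3,4)
proof (induction "b - a" arbitrary: b al rule: less_induct)
  case less
  show ?case
  proof (cases "b = Suc a")
    case True
    then show ?thesis using kostka_adjacent[OF A assms(2), of n al] less.prems by simp
  next
    case False
    define c where "c = b - 1"
    have c: "b = Suc c" "a < c" using less.prems False by (auto simp: c_def)
    let ?t = "Transposition.transpose c (Suc c)"
    have "al \<circ> Transposition.transpose a b = al \<circ> ?t \<circ> Transposition.transpose a c \<circ> ?t"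
      using c by (auto simp: fun_eq_iff transpose_def)
    then have "kostka n A (al \<circ> Transposition.transpose a b) =
      kostka n A (al \<circ> ?t \<circ> Transposition.transpose a c \<circ> ?t)" by simp
    also have "\<dots> = kostka n A (al \<circ> ?t \<circ> Transposition.transpose a c)"
      using c less.prems assms(2) by (intro kostka_adjacent[OF A]) auto
    also have "\<dots> = kostka n A (al \<circ> ?t)" using c less.prems by (intro less.hyps) auto
    also have "\<dots> = kostka n A al" using c less.prems assms(2) by (intro kostka_adjacent[OF A]) auto
    finally show ?thesis .
  qed
qed

lemma kostka_permute:
  assumes A: "skew_diagram A" and w: "w permutes {1..n}"
  shows "kostka n A (al \<circ> w) = kostka n A al"
  using w finite_atLeastAtMost
proof (induction arbitrary: al rule: permutes_induct)
  case id
  then show ?case by simp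
next
  case (swap a b p)
  have "kostka n A (al \<circ> (Transposition.transpose a b \<circ> p)) =
    kostka n A (al \<circ> Transposition.transpose a b)"
    unfolding o_assoc by (rule swap.IH)
  also have "\<dots> = kostka n A al"
  proof (cases "a < b")
    case True
    then show ?thesis using kostka_transpose[OF A, of a b n al] swap.hyps by simp
  next
    case False
    then show ?thesis
      using kostka_transpose[OF A, of b a n al] swap.hyps by (simp add: transpose_commute)
  qed
  finally show ?case .
qed


section \<open>Cancellation of the tableaux that violate the lattice condition\<close>

definition bad_at :: "nat \<Rightarrow> box set \<Rightarrow> (box \<Rightarrow> nat) \<Rightarrow> nat \<Rightarrow> nat \<Rightarrow> bool" where
  "bad_at n A T J k \<longleftrightarrow> 1 \<le> k \<and> k < n \<and> entries_from A T J k < entries_from A T J (Suc k)"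

text \<open>The rightmost violation, followed by the least violated entry there. Both choices depend
  only on the columns that the exchange does not touch, so they can be made again after it.\<close>

definition bad_column :: "nat \<Rightarrow> box set \<Rightarrow> (box \<Rightarrow> nat) \<Rightarrow> nat" where
  "bad_column n A T = Max {J. \<exists>k. bad_at n A T J k}"

definition bad_entry :: "nat \<Rightarrow> box set \<Rightarrow> (box \<Rightarrow> nat) \<Rightarrow> nat" where
  "bad_entry n A T = (LEAST k. bad_at n A T (bad_column n A T) k)"

lemma column_lattice_iff_bad: "column_lattice n A T \<longleftrightarrow> \<not> (\<exists>J k. bad_at n A T J k)"
  unfolding column_lattice_def bad_at_def not_less[symmetric] by blast

lemma finite_bad_columns:
  assumes "finite A"
  shows "finite {J. \<exists>k. bad_at n A T J k}"
proof (rule finite_subset)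
  show "{J. \<exists>k. bad_at n A T J k} \<subseteq> {..Max (insert 0 (snd ` A))}"
  proof
    fix J assume "J \<in> {J. \<exists>k. bad_at n A T J k}"
    then obtain k where "entries_from A T J k < entries_from A T J (Suc k)" by (auto simp: bad_at_def)
    then have "entries_from A T J (Suc k) \<noteq> 0" by simp
    then have "{b \<in> A. J \<le> snd b \<and> T b = Suc k} \<noteq> {}"
      unfolding entries_from_def by (metis card.empty)
    then obtain b where "b \<in> A" "J \<le> snd b" by blast
    moreover from this have "snd b \<le> Max (insert 0 (snd ` A))" using assms by (intro Max_ge) auto
    ultimately show "J \<in> {..Max (insert 0 (snd ` A))}" by simp
  qed
qed simp

lemma bad_column_entry:
  assumes "finite A" "\<not> column_lattice n A T"
  shows "bad_at n A T (bad_column n A T) (bad_entry n A T)"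
    and "bad_column n A T < J \<Longrightarrow> \<not> bad_at n A T J k"
proof -
  have "bad_column n A T \<in> {J. \<exists>k. bad_at n A T J k}"
    unfolding bad_column_def using assms finite_bad_columns
    by (intro Max_in) (auto simp: column_lattice_iff_bad)
  then show "bad_at n A T (bad_column n A T) (bad_entry n A T)"
    unfolding bad_entry_def by (auto intro: LeastI)
  have "J \<le> bad_column n A T" if "bad_at n A T J k"
    unfolding bad_column_def using that finite_bad_columns[OF assms(1)] by (intro Max_ge) auto
  then show "bad_column n A T < J \<Longrightarrow> \<not> bad_at n A T J k" by auto
qed

lemma entries_from_Suc:
  assumes "finite A"
  shows "entries_from A T J l = entries_from A T (Suc J) l + card {b \<in> A. snd b = J \<and> T b = l}"
proof -
  have "{b \<in> A. J \<le> snd b \<and> T b = l} =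
    {b \<in> A. Suc J \<le> snd b \<and> T b = l} \<union> {b \<in> A. snd b = J \<and> T b = l}" by auto
  moreover have "card ({b \<in> A. Suc J \<le> snd b \<and> T b = l} \<union> {b \<in> A. snd b = J \<and> T b = l}) =
    card {b \<in> A. Suc J \<le> snd b \<and> T b = l} + card {b \<in> A. snd b = J \<and> T b = l}"
    using assms by (intro card_Un_disjoint) auto
  ultimately show ?thesis by (simp add: entries_from_def)
qed

lemma card_column_entry_le_1:
  assumes "semistandard A T" "finite A"
  shows "card {b \<in> A. snd b = J \<and> T b = l} \<le> 1"
proof -
  have "b = c" if "b \<in> {b \<in> A. snd b = J \<and> T b = l}" "c \<in> {b \<in> A. snd b = J \<and> T b = l}" for b c
    using that semistandard_column[OF assms(1), of "fst b" J "fst c"]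
      semistandard_column[OF assms(1), of "fst c" J "fst b"]
    by (cases b; cases c; cases "fst b" "fst c" rule: linorder_cases) auto
  moreover have fin: "finite {b \<in> A. snd b = J \<and> T b = l}" using assms(2) by simp
  ultimately show ?thesis unfolding One_nat_def card_le_Suc0_iff_eq[OF fin] by blast
qed

locale bad_tableau =
  fixes A :: "box set" and T :: "box \<Rightarrow> nat" and n :: nat
  assumes A: "skew_diagram A" and T: "T \<in> ssyt n A" and bad: "\<not> column_lattice n A T"
begin

abbreviation "J \<equiv> bad_column n A T"
abbreviation "k \<equiv> bad_entry n A T"

lemmas fin = skew_diagramD(1)[OF A]
lemmas bad_Jk = bad_column_entry[OF fin bad]

lemma semi: "semistandard A T" using T by (simp add: ssyt_def)

lemma k: "1 \<le> k" "k < n" using bad_Jk(1) by (auto simp: bad_at_def)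

text \<open>The condition still holds just right of \<open>J\<close>, and a column contains each
  entry at most once. Hence the violation arises by exactly one: column \<open>J\<close> has a
  \<open>k + 1\<close> and no \<open>k\<close>. This supplies the barrier as well as the unit needed
  in the exponents.\<close>

lemma column_J: "card {b \<in> A. snd b = J \<and> T b = k} = 0"
  "entries_from A T J (Suc k) = Suc (entries_from A T J k)"
proof -
  have "entries_from A T (Suc J) (Suc k) \<le> entries_from A T (Suc J) k"
    using bad_Jk(2)[of "Suc J" k] k by (auto simp: bad_at_def)
  moreover have "entries_from A T J k < entries_from A T J (Suc k)"
    using bad_Jk(1) by (simp add: bad_at_def)
  ultimately show "card {b \<in> A. snd b = J \<and> T b = k} = 0"
    "entries_from A T J (Suc k) = Suc (entries_from A T J k)"
    using entries_from_Suc[OF fin, of T J k] entries_from_Suc[OF fin, of T J "Suc k"]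
      card_column_entry_le_1[OF semi fin, of J k] card_column_entry_le_1[OF semi fin, of J "Suc k"]
    by linarith+
qed

sublocale bk_setup A T k J
proof
  fix i assume i: "(i, J) \<in> A"
  have "finite {b \<in> A. snd b = J \<and> T b = k}" using fin by simp
  then have "{b \<in> A. snd b = J \<and> T b = k} = {}" using column_J(1) by (simp only: card_0_eq)
  then show "T (i, J) \<noteq> k" using i by auto
qed (use A semi in auto)

lemma bad_at_T': "J \<le> J' \<Longrightarrow> bad_at n A T' J' l \<longleftrightarrow> bad_at n A T J' l"
  by (simp add: bad_at_def entries_from_T')

lemma bad_T': "\<not> column_lattice n A T'" "bad_column n A T' = J" "bad_entry n A T' = k"
proof -
  have b: "bad_at n A T' J k" using bad_Jk(1) by (simp add: bad_at_T')
  then show "\<not> column_lattice n A T'" by (auto simp: column_lattice_iff_bad)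
  show J: "bad_column n A T' = J"
    unfolding bad_column_def[of n A T']
  proof (rule Max_eqI[OF finite_bad_columns[OF fin]])
    show "J \<in> {J. \<exists>k. bad_at n A T' J k}" using b by auto
    fix J' assume J': "J' \<in> {J. \<exists>k. bad_at n A T' J k}"
    show "J' \<le> J"
    proof (rule ccontr)
      assume "\<not> J' \<le> J"
      then show False using J' bad_at_T'[of J'] bad_Jk(2)[of J'] by auto
    qed
  qed
  have "bad_at n A T' J = bad_at n A T J" by (simp add: bad_at_T' fun_eq_iff)
  then show "bad_entry n A T' = k" unfolding bad_entry_def[of n A T'] J by (simp add: bad_entry_def)
qed

end

text \<open>The pairs indexing the terms of the product of the Vandermonde alternant and the skew
  Schur polynomial that contribute to the monomial with exponents \<open>be\<close>.\<close>

definition signed_pairs :: "nat \<Rightarrow> box set \<Rightarrow> (nat \<Rightarrow> int) \<Rightarrow> ((nat \<Rightarrow> nat) \<times> (box \<Rightarrow> nat)) set" where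
  "signed_pairs n A be = (SIGMA w:{w. w permutes {1..n}}.
     {T \<in> ssyt n A. content_is n A T (\<lambda>k. be (w k) - (int n - int k))})"

text \<open>Stembridge's cancellation: right of the critical column and in it the exponents of the
  shifted content at \<open>k\<close> and \<open>k + 1\<close> agree, so exchanging the entries to the left of it
  transposes the shifted content.\<close>

lemma sum_bad_pairs:
  assumes A: "skew_diagram A"
  shows "(\<Sum>(w, T) \<in> {(w, T) \<in> signed_pairs n A be. \<not> column_lattice n A T}. sign w) = (0::int)"
proof -
  let ?X = "{(w, T) \<in> signed_pairs n A be. \<not> column_lattice n A T}"
  define flip where "flip = (\<lambda>(w :: nat \<Rightarrow> nat, T). let J = bad_column n A T; k = bad_entry n A T in
     (w \<circ> Transposition.transpose k (Suc k), bender_knuth A k J T))"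
  have flip: "flip x \<in> ?X \<and> flip (flip x) = x \<and> sign (fst (flip x)) = - sign (fst x)"
    if x: "x \<in> ?X" for x
  proof -
    obtain w T where wT: "x = (w, T)" by fastforce
    then have w: "w permutes {1..n}" and T: "T \<in> ssyt n A" and bad: "\<not> column_lattice n A T"
      and cont: "content_is n A T (\<lambda>k. be (w k) - (int n - int k))"
      using x by (auto simp: signed_pairs_def)
    interpret bad_tableau A T n by unfold_locales (use A T bad in auto)
    let ?t = "Transposition.transpose k (Suc k)"
    have fx: "flip x = (w \<circ> ?t, T')" by (simp add: wT flip_def Let_def)
    have t: "?t permutes {1..n}" using k by (intro permutes_swap_id) auto
    have "sign (w \<circ> ?t) = sign w * sign ?t"
      using w t by (intro sign_compose) (auto intro: permutes_imp_permutation)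
    then have sgn: "sign (w \<circ> ?t) = - sign w" by (simp add: sign_swap_id)
    have c: "int (entries A T l) = be (w l) - (int n - int l)" if "l \<in> {1..n}" for l
      using cont that by (simp add: content_is_def)
    \<comment> \<open>The surplus of one \<open>k + 1\<close> from column \<open>J\<close> on
      matches the difference of one between the shifts \<open>n - k\<close> and
      \<open>n - (k + 1)\<close>.\<close>
    have "content_is n A T' (\<lambda>k. be ((w \<circ> ?t) k) - (int n - int k))"
      unfolding content_is_def
    proof
      fix l assume l: "l \<in> {1..n}"
      consider "l = k" | "l = Suc k" | "l \<noteq> k" "l \<noteq> Suc k" by blast
      then show "int (entries A T' l) = be ((w \<circ> ?t) l) - (int n - int l)"
      proof cases
        case 1
        then show ?thesis using entries_T'(1) column_J(2) c[of "Suc k"] k by simp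
      next
        case 2
        then show ?thesis using entries_T'(2) column_J(2) c[of k] k by simp
      next
        case 3
        then show ?thesis using entries_T'_other[of l] c[OF l] by simp
      qed
    qed
    moreover have "(w \<circ> ?t) permutes {1..n}" using t w by (rule permutes_compose)
    ultimately have "flip x \<in> ?X"
      using ssyt_T'[OF T k] bad_T'(1) by (simp add: fx signed_pairs_def)
    moreover have "flip (flip x) = x"
      unfolding fx by (simp add: flip_def Let_def bad_T' involution wT o_assoc[symmetric])
    moreover have "sign (fst (flip x)) = - sign (fst x)" unfolding fx using sgn by (simp add: wT)
    ultimately show ?thesis by blast
  qed
  have "(\<Sum>x\<in>?X. sign (fst x)) = (\<Sum>x\<in>?X. - sign (fst x) :: int)"
    by (rule sum.reindex_bij_witness[of _ flip flip]) (use flip in auto)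
  then have "(\<Sum>x\<in>?X. sign (fst x) :: int) = 0" by (simp add: sum_negf)
  then show ?thesis by (simp add: case_prod_unfold)
qed

text \<open>Coefficientwise, the product of the Vandermonde alternant and the skew Schur polynomial;
  after the cancellation only lattice tableaux remain.\<close>

lemma alternant_kostka:
  assumes A: "skew_diagram A"
  shows "(\<Sum>w | w permutes {1..n}. sign w * int (kostka n A (\<lambda>k. be (w k) - (int n - int k)))) =
    (\<Sum>w | w permutes {1..n}. sign w * int (lattice_kostka n A (\<lambda>k. be (w k) - (int n - int k))))"
proof -
  note fin = skew_diagramD(1)[OF A]
  let ?W = "{w. w permutes {1..n}}"
  have W: "finite ?W" by (simp add: finite_permutations)
  let ?K = "\<lambda>w. {T \<in> ssyt n A. content_is n A T (\<lambda>k. be (w k) - (int n - int k))}"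
  let ?L = "\<lambda>w. {T \<in> ssyt n A. column_lattice n A T \<and> content_is n A T (\<lambda>k. be (w k) - (int n - int k))}"
  have finK: "finite (?K w)" "finite (?L w)" for w using finite_ssyt[OF fin] by auto
  have "(\<Sum>w\<in>?W. sign w * int (kostka n A (\<lambda>k. be (w k) - (int n - int k)))) =
    (\<Sum>w\<in>?W. \<Sum>T\<in>?K w. sign w)" by (simp add: kostka_def mult.commute)
  also have "\<dots> = (\<Sum>(w, T)\<in>signed_pairs n A be. sign w)"
    unfolding signed_pairs_def using W finK by (intro sum.Sigma) auto
  also have "\<dots> = (\<Sum>(w, T)\<in>{(w, T) \<in> signed_pairs n A be. column_lattice n A T}. sign w) +
    (\<Sum>(w, T) \<in> {(w, T) \<in> signed_pairs n A be. \<not> column_lattice n A T}. sign w)"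
  proof -
    have "finite (signed_pairs n A be)" unfolding signed_pairs_def using W finK by (intro finite_SigmaI) auto
    then have f: "finite {(w, T) \<in> signed_pairs n A be. column_lattice n A T}"
      "finite {(w, T) \<in> signed_pairs n A be. \<not> column_lattice n A T}"
      by (auto intro: finite_subset)
    have "signed_pairs n A be = {(w, T) \<in> signed_pairs n A be. column_lattice n A T} \<union>
      {(w, T) \<in> signed_pairs n A be. \<not> column_lattice n A T}" by auto
    then have "(\<Sum>(w, T)\<in>signed_pairs n A be. sign w) =
      (\<Sum>(w, T)\<in>{(w, T) \<in> signed_pairs n A be. column_lattice n A T} \<union>
      {(w, T) \<in> signed_pairs n A be. \<not> column_lattice n A T}. sign w)" by simp
    also have "\<dots> = (\<Sum>(w, T)\<in>{(w, T) \<in> signed_pairs n A be. column_lattice n A T}. sign w) +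
      (\<Sum>(w, T) \<in> {(w, T) \<in> signed_pairs n A be. \<not> column_lattice n A T}. sign w)"
      by (rule sum.union_disjoint[OF f]) auto
    finally show ?thesis .
  qed
  also have "\<dots> = (\<Sum>(w, T)\<in>{(w, T) \<in> signed_pairs n A be. column_lattice n A T}. sign w)"
    using sum_bad_pairs[OF A, of n be] by simp
  also have "{(w, T) \<in> signed_pairs n A be. column_lattice n A T} = (SIGMA w:?W. ?L w)"
    by (auto simp: signed_pairs_def)
  also have "(\<Sum>(w, T)\<in>(SIGMA w:?W. ?L w). sign w) = (\<Sum>w\<in>?W. \<Sum>T\<in>?L w. sign w)"
    using W finK by (intro sum.Sigma[symmetric]) auto
  also have "\<dots> = (\<Sum>w\<in>?W. sign w * int (lattice_kostka n A (\<lambda>k. be (w k) - (int n - int k))))"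
    by (simp add: lattice_kostka_def mult.commute)
  finally show ?thesis .
qed

section \<open>Recovering the tableau counts from the alternants\<close>

lemma sum_displacement_pos:
  assumes w: "w permutes {1..n}" and ne: "w \<noteq> id"
  shows "0 < (\<Sum>k = 1..n. (int n - int k) * (int (w k) - int k))"
proof -
  \<comment> \<open>A permutation changes neither the sum of the numbers nor that of their squares,
    so twice the weighted displacement is the sum of the squares of the displacements.\<close>
  have sq: "(\<Sum>k = 1..n. (int (w k))\<^sup>2) = (\<Sum>k = 1..n. (int k)\<^sup>2)"
    using sum.permute[OF w, of "\<lambda>k. (int k)\<^sup>2"] by simp
  have lin: "(\<Sum>k = 1..n. int (w k)) = (\<Sum>k = 1..n. int k)"
    using sum.permute[OF w, of int] by simp
  have "(\<Sum>k = 1..n. 2 * ((int n - int k) * (int (w k) - int k))) =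
    (\<Sum>k = 1..n. (int (w k) - int k)\<^sup>2) + 2 * int n * ((\<Sum>k = 1..n. int (w k)) - (\<Sum>k = 1..n. int k))
     - ((\<Sum>k = 1..n. (int (w k))\<^sup>2) - (\<Sum>k = 1..n. (int k)\<^sup>2))"
    unfolding sum_distrib_left sum_subtractf[symmetric] sum.distrib[symmetric]
    by (intro sum.cong refl) (simp add: power2_eq_square algebra_simps)
  then have eq: "2 * (\<Sum>k = 1..n. (int n - int k) * (int (w k) - int k)) =
    (\<Sum>k = 1..n. (int (w k) - int k)\<^sup>2)"
    unfolding sq lin sum_distrib_left by simp
  obtain k where k: "w k \<noteq> k" using ne by (auto simp: fun_eq_iff)
  then have "k \<in> {1..n}" using w permutes_not_in by metis
  then have "0 < (\<Sum>k = 1..n. (int (w k) - int k)\<^sup>2)"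
    using k by (intro sum_pos2[of _ k]) auto
  then show ?thesis using eq by linarith
qed

lemma kostka_cong:
  assumes "\<And>k. k \<in> {1..n} \<Longrightarrow> al k = ga k"
  shows "kostka n A al = kostka n A ga"
  using assms by (simp add: kostka_def content_is_def)

text \<open>By symmetry of the Kostka numbers each content may be permuted by \<open>inv w\<close>.
  This isolates \<open>al\<close> and leaves a displacement depending only on the permutation, so
  that the terms are comparable by a linear functional.\<close>

lemma alternant_kostka_shift:
  assumes A: "skew_diagram A"
  shows "(\<Sum>w | w permutes {1..n}.
      sign w * int (kostka n A (\<lambda>k. (\<lambda>k. al k + (int n - int k)) (w k) - (int n - int k)))) =
    (\<Sum>w | w permutes {1..n}. sign w * int (kostka n A (\<lambda>k. al k + (int (w k) - int k))))"
proof (rule sum.reindex_bij_witness[of _ inv inv])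
  fix w assume "w \<in> {w. w permutes {1..n}}"
  then have w: "w permutes {1..n}" by simp
  then have iw: "inv w permutes {1..n}" by (rule permutes_inv)
  show "inv (inv w) = w" using w by (simp add: permutes_inv_inv)
  show "inv w \<in> {w. w permutes {1..n}}" using iw by simp
  have "kostka n A (\<lambda>k. al (w k) + (int n - int (w k)) - (int n - int k)) =
    kostka n A ((\<lambda>k. al (w k) + (int n - int (w k)) - (int n - int k)) \<circ> inv w)"
    by (rule kostka_permute[OF A iw, symmetric])
  also have "(\<lambda>k. al (w k) + (int n - int (w k)) - (int n - int k)) \<circ> inv w =
    (\<lambda>k. al k + (int (inv w k) - int k))"
    using permutes_inverses(1)[OF w] by auto
  finally show "sign (inv w) * int (kostka n A (\<lambda>k. al k + (int (inv w k) - int k))) =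
    sign w * int (kostka n A (\<lambda>k. (\<lambda>k. al k + (int n - int k)) (w k) - (int n - int k)))"
    using w by (simp add: sign_inverse permutes_imp_permutation[of "{1..n}"])
next
  fix w assume "w \<in> {w. w permutes {1..n}}"
  then have w: "w permutes {1..n}" by simp
  show "inv (inv w) = w" using w by (simp add: permutes_inv_inv)
  show "inv w \<in> {w. w permutes {1..n}}" using w by (simp add: permutes_inv)
qed

text \<open>An upper bound for the functional on the contents that occur, which makes the later
  recursion towards larger values terminate.\<close>

lemma kostka_nonzero:
  assumes "finite A" "kostka n A al \<noteq> 0"
  shows "(\<Sum>k = 1..n. (int n - int k) * al k) \<le> int n * int (card A)"
proof -
  obtain T where T: "T \<in> ssyt n A" "content_is n A T al"
    using assms(2) unfolding kostka_def by (metis (no_types, lifting) card.empty mem_Collect_eq ex_in_conv)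
  have "(\<Sum>k = 1..n. (int n - int k) * al k) \<le> (\<Sum>k = 1..n. int n * int (entries A T k))"
  proof (rule sum_mono)
    fix k assume k: "k \<in> {1..n}"
    then have "al k = int (entries A T k)" using T by (simp add: content_is_def)
    then show "(int n - int k) * al k \<le> int n * int (entries A T k)"
      by (simp add: mult_right_mono)
  qed
  also have "\<dots> = int n * int (\<Sum>k = 1..n. entries A T k)" by (simp add: sum_distrib_left)
  finally show ?thesis unfolding sum_entries[OF assms(1) T(1)] .
qed

text \<open>The alternants determine the numbers of tableaux: all terms but one of the alternant
  at the shifted content \<open>al\<close> have a content with a larger value of the linear functional
  with coefficients \<open>n - k\<close>.\<close>

lemma kostka_determined:
  assumes A: "skew_diagram A" and B: "skew_diagram B" and card: "card A = card B"
    and eq: "\<And>be. (\<Sum>w | w permutes {1..n}. sign w * int (kostka n A (\<lambda>k. be (w k) - (int n - int k)))) =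
      (\<Sum>w | w permutes {1..n}. sign w * int (kostka n B (\<lambda>k. be (w k) - (int n - int k))))"
  shows "kostka n A al = kostka n B al"
proof -
  define P where "P = (\<lambda>al. \<Sum>k = 1..n. (int n - int k) * al k)"
  define N where "N = int n * int (card A)"
  show ?thesis
  \<comment> \<open>The extra 1 keeps the measure positive, hence strictly decreasing, even if
    \<open>P al\<close> attains the bound \<open>N\<close>.\<close>
  proof (induction "nat (N + 1 - P al)" arbitrary: al rule: less_induct)
    case less
    show ?case
    proof (cases "kostka n A al = 0 \<and> kostka n B al = 0")
      case False
      then have PN: "P al \<le> N"
        using kostka_nonzero[of A n al] kostka_nonzero[of B n al] skew_diagramD(1) A B card
        unfolding P_def N_def by auto
      let ?W = "{w. w permutes {1..n}}"
      let ?s = "\<lambda>w k. al k + (int (w k) - int k)"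
      have W: "finite ?W" "id \<in> ?W" by (simp_all add: finite_permutations permutes_id)
      have IH: "kostka n A (?s w) = kostka n B (?s w)" if w: "w \<in> ?W - {id}" for w
      proof (rule less.hyps)
        have "P (?s w) = P al + (\<Sum>k = 1..n. (int n - int k) * (int (w k) - int k))"
          unfolding P_def sum.distrib[symmetric] by (simp add: distrib_left)
        then have "P al < P (?s w)" using sum_displacement_pos[of w n] w by simp
        then show "nat (N + 1 - P (?s w)) < nat (N + 1 - P al)" using PN by linarith
      qed
      have "(\<Sum>w\<in>?W. sign w * int (kostka n A (?s w))) = (\<Sum>w\<in>?W. sign w * int (kostka n B (?s w)))"
        using eq[of "\<lambda>k. al k + (int n - int k)"]
        unfolding alternant_kostka_shift[OF A] alternant_kostka_shift[OF B] .
      then have "int (kostka n A (?s id)) + (\<Sum>w\<in>?W - {id}. sign w * int (kostka n A (?s w))) =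
        int (kostka n B (?s id)) + (\<Sum>w\<in>?W - {id}. sign w * int (kostka n B (?s w)))"
        unfolding sum.remove[OF W] by simp
      moreover have "(\<Sum>w\<in>?W - {id}. sign w * int (kostka n A (?s w))) =
        (\<Sum>w\<in>?W - {id}. sign w * int (kostka n B (?s w)))"
        by (intro sum.cong refl) (use IH in simp)
      ultimately show ?thesis by simp
    qed simp
  qed
qed

section \<open>Lattice tableaux and Littlewood--Richardson numbers\<close>

lemma lattice_kostka_lr:
  assumes A: "skew_diagram A" and nu: "\<And>k. k \<in> {1..n} \<Longrightarrow> al k = int (part nu k)"
    and zero: "\<And>k. n < k \<Longrightarrow> part nu k = 0"
  shows "lattice_kostka n A al = card (lr_tableaux A nu)"
proof -
  note fin = skew_diagramD(1)[OF A]
  have "T \<in> ssyt n A \<and> column_lattice n A T \<and> content_is n A T al \<longleftrightarrow> T \<in> lr_tableaux A nu" for T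
  proof
    assume T: "T \<in> ssyt n A \<and> column_lattice n A T \<and> content_is n A T al"
    have "card {b \<in> A. T b = k} = part nu k" if "1 \<le> k" for k
    proof (cases "k \<le> n")
      case True
      then have "k \<in> {1..n}" using that by simp
      then have "int (entries A T k) = int (part nu k)" using T nu[of k] by (simp add: content_is_def)
      then show ?thesis by (simp add: entries_def)
    next
      case False
      then have "{b \<in> A. T b = k} = {}" using T by (fastforce simp: ssyt_def)
      then have "card {b \<in> A. T b = k} = 0" by (simp only: card.empty)
      then show ?thesis using zero[of k] False by simp
    qed
    moreover have "lattice_reading A T" using T lattice_reading_iff[OF A] by blast
    ultimately show "T \<in> lr_tableaux A nu" using T unfolding lr_tableaux_def ssyt_def by blast
  next
    assume T: "T \<in> lr_tableaux A nu"
    have "T b \<le> n" if b: "b \<in> A" for b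
    proof (rule ccontr)
      assume "\<not> T b \<le> n"
      then have "card {c \<in> A. T c = T b} = 0" using T zero[of "T b"] by (simp add: lr_tableaux_def)
      then show False using fin b by (cases b) auto
    qed
    then have ss: "T \<in> ssyt n A" using T unfolding lr_tableaux_def ssyt_def by blast
    moreover have "content_is n A T al"
      using T nu unfolding lr_tableaux_def content_is_def entries_def by simp
    moreover have "column_lattice n A T"
      using T lattice_reading_iff[OF A ss] by (simp add: lr_tableaux_def)
    ultimately show "T \<in> ssyt n A \<and> column_lattice n A T \<and> content_is n A T al" by blast
  qed
  then have "{T \<in> ssyt n A. column_lattice n A T \<and> content_is n A T al} = lr_tableaux A nu" by blast
  then show ?thesis by (simp add: lattice_kostka_def)
qed

lemma entries_from_0: "entries_from A T 0 k = entries A T k"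
  by (simp add: entries_from_def entries_def)

text \<open>At column 0 the lattice condition compares the full numbers of entries, so the content
  decreases weakly.\<close>

lemma lattice_kostka_partition:
  assumes A: "skew_diagram A" and nz: "lattice_kostka n A al \<noteq> 0"
  shows "\<exists>nu\<in>partitions_of (card A). (\<forall>k\<in>{1..n}. al k = int (part nu k)) \<and> (\<forall>k>n. part nu k = 0)"
proof -
  note fin = skew_diagramD(1)[OF A]
  obtain T where T: "T \<in> ssyt n A" "column_lattice n A T" "content_is n A T al"
    using nz unfolding lattice_kostka_def by (metis (no_types, lifting) card.empty mem_Collect_eq ex_in_conv)
  let ?e = "entries A T"
  have Suc: "?e (Suc k) \<le> ?e k" if "1 \<le> k" "k < n" for k
    using T(2) that entries_from_0 unfolding column_lattice_def by metis
  have anti: "?e i' \<le> ?e i" if "1 \<le> i" "i \<le> i'" "i' \<le> n" for i i'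
    using that(2,3)
  proof (induction i' rule: dec_induct)
    case (step m)
    then show ?case using Suc[of m] that(1) by simp
  qed simp
  define D where "D = (SIGMA i:{1..n}. {1..?e i})"
  have "\<exists>nu. is_partition nu \<and> diagram nu = D"
  proof (rule downset_diagram)
    fix i j a b assume "(i, j) \<in> D" "1 \<le> a" "a \<le> i" "1 \<le> b" "b \<le> j"
    then show "(a, b) \<in> D" using anti[of a i] by (auto simp: D_def)
  qed (auto simp: D_def)
  then obtain nu where nu: "is_partition nu" "diagram nu = D" by blast
  have iff: "1 \<le> i \<and> 1 \<le> j \<and> j \<le> part nu i \<longleftrightarrow> i \<in> {1..n} \<and> 1 \<le> j \<and> j \<le> ?e i" for i j
  proof -
    have "(i, j) \<in> diagram nu \<longleftrightarrow> (i, j) \<in> D" using nu by simp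
    then show ?thesis by (simp add: diagram_def D_def)
  qed
  have part: "part nu k = ?e k" if "k \<in> {1..n}" for k
  proof (rule antisym)
    show "part nu k \<le> ?e k" using iff[of k "part nu k"] that by (cases "part nu k = 0") auto
    show "?e k \<le> part nu k" using iff[of k "?e k"] that by (cases "?e k = 0") auto
  qed
  have zero: "part nu k = 0" if "n < k" for k
    using iff[of k "part nu k"] that by (cases "part nu k = 0") auto
  have "card (diagram nu) = card A"
    unfolding nu(2) D_def using sum_entries[OF fin T(1)] by simp
  then have "nu \<in> partitions_of (card A)" using nu(1) by (simp add: partitions_of_def card_diagram)
  moreover have "al k = int (part nu k)" if "k \<in> {1..n}" for k
    using T(3) part[OF that] that by (simp add: content_is_def)
  ultimately show ?thesis using zero by blast
qed

lemma increasing_permutation: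
  assumes w: "w permutes {1..n}" and mono: "\<And>k. 1 \<le> k \<Longrightarrow> k < n \<Longrightarrow> w k < w (Suc k)"
  shows "w = id"
proof -
  have ge: "k \<le> w k" if "1 \<le> k" "k \<le> n" for k
    using that
  proof (induction k rule: nat_induct_at_least)
    case base
    then show ?case using permutes_in_image[OF w, of 1] by simp
  next
    case (Suc m)
    then show ?case using mono[of m] by simp
  qed
  have "w k = k" if "k \<in> {1..n}" for k
  proof (rule ccontr)
    assume "w k \<noteq> k"
    then have "(\<Sum>k = 1..n. k) < (\<Sum>k = 1..n. w k)"
    proof (intro sum_strict_mono_ex1 bexI[of _ k] ballI)
      show "k < w k" using ge[of k] that \<open>w k \<noteq> k\<close> by simp
    qed (use ge that in auto)
    then show False using sum.permute[OF w, of "\<lambda>k. k"] by simp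
  qed
  then show ?thesis using permutes_not_in[OF w] by (metis eq_id_iff)
qed

text \<open>A lattice tableau has a partition as its content, while \<open>part nu k - k\<close>
  decreases strictly. A descent of \<open>w\<close> would make the shifted content increase, so only
  the identity contributes.\<close>

lemma alternant_lattice_kostka:
  assumes A: "skew_diagram A" and nu: "is_partition nu"
    and n: "n = length nu"
  shows "(\<Sum>w | w permutes {1..n}. sign w * int (lattice_kostka n A
      (\<lambda>k. (\<lambda>k. int (part nu k) + (int n - int k)) (w k) - (int n - int k)))) =
    int (card (lr_tableaux A nu))"
proof -
  let ?W = "{w. w permutes {1..n}}"
  let ?al = "\<lambda>w k. int (part nu (w k)) + (int n - int (w k)) - (int n - int k)"
  have W: "finite ?W" "id \<in> ?W" by (simp_all add: finite_permutations permutes_id)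
  have "lattice_kostka n A (?al w) = 0" if w: "w \<in> ?W - {id}" for w
  proof (rule ccontr)
    assume "lattice_kostka n A (?al w) \<noteq> 0"
    then obtain xi where xi: "xi \<in> partitions_of (card A)"
      "\<And>k. k \<in> {1..n} \<Longrightarrow> ?al w k = int (part xi k)"
      using lattice_kostka_partition[OF A] by blast
    have wp: "w permutes {1..n}" using w by simp
    have "w k < w (Suc k)" if "1 \<le> k" "k < n" for k
    proof (rule ccontr)
      assume not: "\<not> w k < w (Suc k)"
      have "1 \<le> w (Suc k)" using permutes_in_image[OF wp, of "Suc k"] that by simp
      then have "part nu (w k) \<le> part nu (w (Suc k))" using part_antimono[OF nu] not by simp
      moreover have "part xi (Suc k) \<le> part xi k"
        using part_antimono[of xi k "Suc k"] xi(1) that by (simp add: partitions_of_def)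
      ultimately show False using xi(2)[of k] xi(2)[of "Suc k"] that not by auto
    qed
    then have "w = id" by (rule increasing_permutation[OF wp])
    then show False using w by simp
  qed
  then have "(\<Sum>w\<in>?W - {id}. sign w * int (lattice_kostka n A (?al w))) = 0"
    by (intro sum.neutral) auto
  then have "(\<Sum>w\<in>?W. sign w * int (lattice_kostka n A (?al w))) = int (lattice_kostka n A (?al id))"
    unfolding sum.remove[OF W] by simp
  also have "lattice_kostka n A (?al id) = card (lr_tableaux A nu)"
    by (rule lattice_kostka_lr[OF A]) (auto simp: n part_def)
  finally show ?thesis .
qed

text \<open>In one direction every lattice count is a Littlewood--Richardson number or 0, so the
  alternants agree and can be inverted; in the other the alternant at \<open>nu\<close>, in
  \<open>length nu\<close> letters, is the Littlewood--Richardson number itself.\<close>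

theorem lr_tableaux_iff_kostka:
  assumes A: "skew_diagram A" and B: "skew_diagram B" and card: "card A = card B"
  shows "(\<forall>nu\<in>partitions_of (card A). card (lr_tableaux A nu) = card (lr_tableaux B nu)) \<longleftrightarrow>
    (\<forall>n al. kostka n A al = kostka n B al)"
proof (intro iffI allI ballI)
  fix n al
  assume lr: "\<forall>nu\<in>partitions_of (card A). card (lr_tableaux A nu) = card (lr_tableaux B nu)"
  have lat: "lattice_kostka n A ga = lattice_kostka n B ga" for ga
  proof (cases "lattice_kostka n A ga = 0 \<and> lattice_kostka n B ga = 0")
    case False
    then obtain nu where "nu \<in> partitions_of (card A)" "\<forall>k\<in>{1..n}. ga k = int (part nu k)"
      "\<forall>k>n. part nu k = 0"
      using lattice_kostka_partition[OF A] lattice_kostka_partition[OF B] card by metis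
    then show ?thesis
      using lr lattice_kostka_lr[OF A, of n ga nu] lattice_kostka_lr[OF B, of n ga nu] by simp
  qed simp
  show "kostka n A al = kostka n B al"
    by (rule kostka_determined[OF A B card]) (simp only: alternant_kostka[OF A] alternant_kostka[OF B] lat)
next
  fix nu
  assume K: "\<forall>n al. kostka n A al = kostka n B al" and "nu \<in> partitions_of (card A)"
  then have nu: "is_partition nu" by (simp add: partitions_of_def)
  let ?n = "length nu"
  have alt: "(\<Sum>w | w permutes {1..?n}. sign w * int (kostka ?n C
      (\<lambda>k. (\<lambda>k. int (part nu k) + (int ?n - int k)) (w k) - (int ?n - int k)))) =
    int (card (lr_tableaux C nu))" if "skew_diagram C" for C
    by (rule trans[OF alternant_kostka[OF that] alternant_lattice_kostka[OF that nu refl]])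
  have "int (card (lr_tableaux A nu)) = int (card (lr_tableaux B nu))"
    unfolding alt[OF A, symmetric] alt[OF B, symmetric] by (simp only: K)
  then show "card (lr_tableaux A nu) = card (lr_tableaux B nu)" by simp
qed

section \<open>Fillings by strips\<close>

definition nw_ideal :: "box set \<Rightarrow> box set \<Rightarrow> bool" where
  "nw_ideal A I \<longleftrightarrow> I \<subseteq> A \<and> (\<forall>b\<in>I. \<forall>c\<in>A. fst c \<le> fst b \<longrightarrow> snd c \<le> snd b \<longrightarrow> c \<in> I)"

definition strip :: "bool \<Rightarrow> box set \<Rightarrow> bool" where
  "strip h I \<longleftrightarrow> (if h then inj_on snd I else inj_on fst I)"

text \<open>Counts the fillings of \<open>A\<close> in which the letters fill, one after the other, horizontal
  (\<open>True\<close>) or vertical (\<open>False\<close>) strips of the prescribed sizes, i.e. a coefficient of a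
  supersymmetric skew Schur function.\<close>

fun strip_fillings :: "(bool \<times> nat) list \<Rightarrow> box set \<Rightarrow> int" where
  "strip_fillings [] A = (if A = {} then 1 else 0)"
| "strip_fillings ((h, p) # W) A = (\<Sum>I | nw_ideal A I \<and> strip h I \<and> card I = p. strip_fillings W (A - I))"

abbreviation hword :: "nat list \<Rightarrow> (bool \<times> nat) list" where
  "hword ps \<equiv> map (Pair True) ps"

lemma nw_idealD: "nw_ideal A I \<Longrightarrow> (i, j) \<in> I \<Longrightarrow> (a, b) \<in> A \<Longrightarrow> a \<le> i \<Longrightarrow> b \<le> j \<Longrightarrow> (a, b) \<in> I"
  unfolding nw_ideal_def by fastforce

lemma nw_ideal_subset: "nw_ideal A I \<Longrightarrow> I \<subseteq> A" by (simp add: nw_ideal_def)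

lemma finite_nw_ideals: "finite A \<Longrightarrow> finite {I. nw_ideal A I \<and> P I}"
  by (rule finite_subset[of _ "Pow A"]) (auto simp: nw_ideal_def)

text \<open>Ensures that the recursion of \<open>strip_fillings\<close> never leaves the skew
  diagrams.\<close>

lemma skew_diagram_diff:
  assumes A: "skew_diagram A" and I: "nw_ideal A I"
  shows "skew_diagram (A - I)"
  unfolding skew_diagram_iff
proof (intro conjI)
  show "box_convex (A - I)"
    unfolding box_convex_def
  proof (intro allI impI)
    fix i j i' j' a b
    assume *: "(i, j) \<in> A - I" "(i', j') \<in> A - I" "i \<le> a" "a \<le> i'" "j \<le> b" "b \<le> j'"
    then have "(a, b) \<in> A" using skew_diagramD(4)[OF A, of i j i' j'] by blast
    moreover have "(a, b) \<notin> I" using nw_idealD[OF I, of a b i j] * by blast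
    ultimately show "(a, b) \<in> A - I" by blast
  qed
qed (use A in \<open>auto simp: skew_diagram_iff\<close>)

lemma strip_fillings_nonneg: "0 \<le> strip_fillings W A"
  by (induction W A rule: strip_fillings.induct) (auto intro: sum_nonneg)

lemma strip_fillings_card: "finite A \<Longrightarrow> strip_fillings W A \<noteq> 0 \<Longrightarrow> sum_list (map snd W) = card A"
proof (induction W A rule: strip_fillings.induct)
  case (1 A)
  then show ?case by (simp split: if_splits)
next
  case (2 h p W A)
  from 2(3) obtain I where I: "nw_ideal A I" "strip h I" "card I = p" "strip_fillings W (A - I) \<noteq> 0"
    using sum.not_neutral_contains_not_neutral by force
  then have "sum_list (map snd W) = card (A - I)" using 2(1)[of I] 2(2) by simp
  moreover have "card (A - I) + card I = card A"
    using 2(2) nw_ideal_subset[OF I(1)] by (metis card_Diff_subset card_mono finite_subset le_add_diff_inverse2)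
  ultimately show ?case using I(3) by simp
qed

lemma minimal_box:
  assumes "finite A" "A \<noteq> {}"
  shows "\<exists>b\<in>A. nw_ideal A {b}"
proof -
  define i where "i = Min (fst ` A)"
  have "i \<in> fst ` A" unfolding i_def using assms by (intro Min_in) auto
  then obtain j' where j': "(i, j') \<in> A" by auto
  define j where "j = (LEAST j. (i, j) \<in> A)"
  have j: "(i, j) \<in> A" unfolding j_def by (rule LeastI[of _ j']) (rule j')
  have "nw_ideal A {(i, j)}"
    unfolding nw_ideal_def
  proof (intro conjI ballI impI)
    fix b c assume *: "b \<in> {(i, j)}" "c \<in> A" "fst c \<le> fst b" "snd c \<le> snd b"
    have "i \<le> fst c" unfolding i_def using assms * by (intro Min_le) auto
    then have c: "c = (i, snd c)" using * by (cases c) auto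
    then have "j \<le> snd c" unfolding j_def using * by (intro Least_le) metis
    then show "c \<in> {(i, j)}" using * c by (cases c) auto
  qed (use j in auto)
  then show ?thesis using j by blast
qed

text \<open>Peeling off one minimal box after the other gives a standard filling. This provides a
  nonzero count for every diagram, from which its size can be recognised.\<close>

lemma strip_fillings_standard:
  assumes "finite A"
  shows "strip_fillings (hword (replicate (card A) 1)) A \<noteq> 0"
  using assms
proof (induction "card A" arbitrary: A)
  case 0
  then show ?case by simp
next
  case (Suc m)
  then have "A \<noteq> {}" by auto
  then obtain b where b: "b \<in> A" "nw_ideal A {b}" using minimal_box Suc.prems by blast
  have m: "card (A - {b}) = m" using Suc b by simp
  then have pos: "0 < strip_fillings (hword (replicate m 1)) (A - {b})"
    using Suc.hyps(1)[of "A - {b}"] Suc.prems strip_fillings_nonneg[of "hword (replicate m 1)" "A - {b}"] by simp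
  have "0 < (\<Sum>I | nw_ideal A I \<and> strip True I \<and> card I = 1. strip_fillings (hword (replicate m 1)) (A - I))"
    by (rule sum_pos2[of _ "{b}"])
      (use finite_nw_ideals[OF Suc.prems] b pos strip_fillings_nonneg in \<open>auto simp: strip_def\<close>)
  then show ?case unfolding Suc.hyps(2)[symmetric] by simp
qed

section \<open>Horizontal strips and semistandard tableaux\<close>

lemma ssyt_empty: "ssyt n {} = {\<lambda>_. 0}"
  by (auto simp: ssyt_def semistandard_def)

lemma ssyt_0: "A \<noteq> {} \<Longrightarrow> ssyt 0 A = {}"
  by (force simp: ssyt_def semistandard_def)

lemma first_letter_strip:
  assumes A: "skew_diagram A" and T: "T \<in> ssyt (Suc m) A"
  shows "nw_ideal A {b \<in> A. T b = 1}" "strip True {b \<in> A. T b = 1}"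
    "(\<lambda>b. T b - 1) \<in> ssyt m (A - {b \<in> A. T b = 1})"
    "1 \<le> k \<Longrightarrow> entries (A - {b \<in> A. T b = 1}) (\<lambda>b. T b - 1) k = entries A T (Suc k)"
proof -
  let ?I = "{b \<in> A. T b = 1}"
  have ss: "semistandard A T" and out: "\<And>b. b \<notin> A \<Longrightarrow> T b = 0" and le: "\<And>b. b \<in> A \<Longrightarrow> T b \<le> Suc m"
    using T unfolding ssyt_def by blast+
  have ge: "1 \<le> T b" if "b \<in> A" for b using ss that by (simp add: semistandard_def)
  show "nw_ideal A ?I"
    unfolding nw_ideal_def
  proof (intro conjI ballI impI)
    fix b c assume *: "b \<in> ?I" "c \<in> A" "fst c \<le> fst b" "snd c \<le> snd b"
    obtain i j a d where bc: "b = (i, j)" "c = (a, d)" by fastforce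
    have "T c \<le> T b"
      using semistandard_se[OF A ss, of a d i j] semistandard_row[OF ss, of i d j] * bc
      by (cases "a = i") auto
    then show "c \<in> ?I" using * ge[of c] by auto
  qed auto
  show "strip True ?I"
    unfolding strip_def if_True
  proof (rule inj_onI)
    fix b c assume *: "b \<in> ?I" "c \<in> ?I" "snd b = snd c"
    obtain i j a where bc: "b = (i, j)" "c = (a, j)" using * by (cases b; cases c) auto
    show "b = c"
      using semistandard_column[OF ss, of i j a] semistandard_column[OF ss, of a j i] * bc
      by (cases i a rule: linorder_cases) auto
  qed
  have "semistandard (A - ?I) (\<lambda>b. T b - 1)"
    unfolding semistandard_def
  proof (intro conjI ballI allI impI)
    fix b assume "b \<in> A - ?I"
    then show "1 \<le> T b - 1" using ge[of b] by (cases "T b") auto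
  next
    fix i j j' assume *: "(i, j) \<in> A - ?I" "(i, j') \<in> A - ?I" "j < j'"
    then show "T (i, j) - 1 \<le> T (i, j') - 1" using semistandard_row[OF ss, of i j j'] by auto
  next
    fix i i' j assume *: "(i, j) \<in> A - ?I" "(i', j) \<in> A - ?I" "i < i'"
    then show "T (i, j) - 1 < T (i', j) - 1"
      using semistandard_column[OF ss, of i j i'] ge[of "(i, j)"] by auto
  qed
  moreover have "T b - 1 = 0" if "b \<notin> A - ?I" for b using out[of b] that by (cases "b \<in> A") auto
  moreover have "T b - 1 \<le> m" if "b \<in> A - ?I" for b using le[of b] that by auto
  ultimately show "(\<lambda>b. T b - 1) \<in> ssyt m (A - ?I)" by (simp add: ssyt_def)
  show "entries (A - ?I) (\<lambda>b. T b - 1) k = entries A T (Suc k)" if "1 \<le> k"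
  proof -
    have "T b - 1 = k \<longleftrightarrow> T b = Suc k" for b using that by auto
    then have "{b \<in> A - ?I. T b - 1 = k} = {b \<in> A. T b = Suc k}" using that by auto
    then show ?thesis by (simp add: entries_def)
  qed
qed

lemma ssyt_prepend:
  assumes A: "skew_diagram A" and I: "nw_ideal A I" "strip True I" and S: "S \<in> ssyt m (A - I)"
  defines "T \<equiv> \<lambda>b. if b \<in> A then Suc (S b) else 0"
  shows "T \<in> ssyt (Suc m) A" "{b \<in> A. T b = 1} = I"
proof -
  have ss: "semistandard (A - I) S" and out: "\<And>b. b \<notin> A - I \<Longrightarrow> S b = 0" and le: "\<And>b. b \<in> A - I \<Longrightarrow> S b \<le> m"
    using S unfolding ssyt_def by blast+
  have ge: "1 \<le> S b" if "b \<in> A - I" for b using ss that unfolding semistandard_def by blast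
  have zero: "S b = 0 \<longleftrightarrow> b \<in> I" if "b \<in> A" for b using ge[of b] out[of b] that by (cases "b \<in> I") auto
  have "semistandard A T"
    unfolding semistandard_def
  proof (intro conjI ballI allI impI)
    fix i j j' assume *: "(i, j) \<in> A" "(i, j') \<in> A" "j < j'"
    have "S (i, j) \<le> S (i, j')"
    proof (cases "(i, j) \<in> I")
      case False
      then have "(i, j') \<notin> I" using nw_idealD[OF I(1), of i j' i j] * by auto
      then show ?thesis using semistandard_row[OF ss, of i j j'] * False by auto
    qed (use zero[of "(i, j)"] * in auto)
    then show "T (i, j) \<le> T (i, j')" using * by (simp add: T_def)
  next
    fix i i' j assume *: "(i, j) \<in> A" "(i', j) \<in> A" "i < i'"
    have i': "(i', j) \<notin> I"
    proof
      assume i': "(i', j) \<in> I"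
      then have "(i, j) \<in> I" using nw_idealD[OF I(1), of i' j i j] * by auto
      then show False using I(2) i' * inj_onD[of snd I "(i, j)" "(i', j)"] by (simp add: strip_def)
    qed
    have "S (i, j) < S (i', j)"
    proof (cases "(i, j) \<in> I")
      case True
      then show ?thesis using zero[of "(i, j)"] ge[of "(i', j)"] i' * by auto
    next
      case False
      then show ?thesis using semistandard_column[OF ss, of i j i'] i' * by auto
    qed
    then show "T (i, j) < T (i', j)" using * by (simp add: T_def)
  qed (simp add: T_def)
  moreover have "T b \<le> Suc m" if "b \<in> A" for b using le[of b] out[of b] that by (cases "b \<in> I") (auto simp: T_def)
  ultimately show "T \<in> ssyt (Suc m) A" by (simp add: ssyt_def T_def)
  show "{b \<in> A. T b = 1} = I" using zero nw_ideal_subset[OF I(1)] by (auto simp: T_def)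
qed

text \<open>The ones of a tableau form a horizontal strip that is an order ideal; removing them and
  lowering the other entries by 1 is a bijection onto pairs of such a strip and a tableau of the
  rest.\<close>

lemma strip_fillings_kostka:
  assumes "skew_diagram A"
  shows "strip_fillings (hword ps) A = int (kostka (length ps) A (\<lambda>k. int (ps ! (k - 1))))"
  using assms
proof (induction ps arbitrary: A)
  case Nil
  show ?case
  proof (cases "A = {}")
    case True
    have "{T. T = (\<lambda>_. 0) \<and> content_is 0 {} T (\<lambda>k. int ([] ! (k - 1)))} = {\<lambda>_ :: box. 0 :: nat}"
      by (auto simp: content_is_def)
    then show ?thesis using True by (simp add: kostka_def ssyt_empty)
  qed (simp add: kostka_def ssyt_0)
next
  case (Cons p ps)
  note A = Cons.prems
  note fin = skew_diagramD(1)[OF A]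
  let ?m = "length ps"
  let ?X = "{T \<in> ssyt (Suc ?m) A. content_is (Suc ?m) A T (\<lambda>k. int ((p # ps) ! (k - 1)))}"
  let ?Is = "{I. nw_ideal A I \<and> strip True I \<and> card I = p}"
  let ?Y = "\<lambda>I. {S \<in> ssyt ?m (A - I). content_is ?m (A - I) S (\<lambda>k. int (ps ! (k - 1)))}"
  have "card ?X = card (SIGMA I:?Is. ?Y I)"
  proof (rule bij_betw_same_card, rule bij_betwI)
    let ?f = "\<lambda>T. ({b \<in> A. T b = 1}, \<lambda>b. T b - 1)"
    \<comment> \<open>The filling \<open>S\<close> is 0 on \<open>I\<close>, so the successor puts
      the entry 1 exactly there.\<close>
    let ?g = "\<lambda>(I :: box set, S). \<lambda>b. if b \<in> A then Suc (S b) else 0"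
    show "?f \<in> ?X \<rightarrow> (SIGMA I:?Is. ?Y I)"
    proof
      fix T assume "T \<in> ?X"
      then have T: "T \<in> ssyt (Suc ?m) A"
        and c: "\<And>k. k \<in> {1..Suc ?m} \<Longrightarrow> entries A T k = (p # ps) ! (k - 1)"
        by (auto simp: content_is_def)
      note f = first_letter_strip[OF A T]
      have "card {b \<in> A. T b = 1} = p" using c[of 1] by (simp add: entries_def)
      moreover have "content_is ?m (A - {b \<in> A. T b = 1}) (\<lambda>b. T b - 1) (\<lambda>k. int (ps ! (k - 1)))"
        unfolding content_is_def
      proof
        fix k assume k: "k \<in> {1..?m}"
        then show "int (entries (A - {b \<in> A. T b = 1}) (\<lambda>b. T b - 1) k) = int (ps ! (k - 1))"
          using f(4)[of k] c[of "Suc k"] by (simp add: nth_Cons')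
      qed
      ultimately show "?f T \<in> (SIGMA I:?Is. ?Y I)" using f(1-3) by blast
    qed
    have inv: "?f (?g x) = x" if "x \<in> (SIGMA I:?Is. ?Y I)" for x
    proof -
      obtain I S where x: "x = (I, S)" "nw_ideal A I" "strip True I" "S \<in> ssyt ?m (A - I)" using \<open>x \<in> _\<close> by auto
      have "S b = 0" if "b \<notin> A" for b using x(4) that unfolding ssyt_def by blast
      then have "(\<lambda>b. (if b \<in> A then Suc (S b) else 0) - 1) = S" by auto
      then show ?thesis using ssyt_prepend(2)[OF A x(2-4)] by (simp add: x(1))
    qed
    show "?g \<in> (SIGMA I:?Is. ?Y I) \<rightarrow> ?X"
    proof
      fix x assume xx: "x \<in> (SIGMA I:?Is. ?Y I)"
      then obtain I S where x: "x = (I, S)" "nw_ideal A I" "strip True I" "S \<in> ssyt ?m (A - I)"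
        and p: "card I = p" and c: "content_is ?m (A - I) S (\<lambda>k. int (ps ! (k - 1)))" by auto
      define T where "T = ?g x"
      have T: "T \<in> ssyt (Suc ?m) A" "{b \<in> A. T b = 1} = I"
        using ssyt_prepend[OF A x(2-4)] by (simp_all add: T_def x(1))
      have S: "(\<lambda>b. T b - 1) = S" using inv[OF xx] by (simp add: T_def x(1))
      have "content_is (Suc ?m) A T (\<lambda>k. int ((p # ps) ! (k - 1)))"
        unfolding content_is_def
      proof
        fix k assume k: "k \<in> {1..Suc ?m}"
        show "int (entries A T k) = int ((p # ps) ! (k - 1))"
        proof (cases "k = 1")
          case True
          then show ?thesis using T(2) p by (simp add: entries_def)
        next
          case False
          then obtain l where l: "k = Suc l" "l \<in> {1..?m}" using k by (cases k) auto
          have "int (entries (A - I) S l) = int (ps ! (l - 1))" using c l by (simp add: content_is_def)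
          then show ?thesis using first_letter_strip(4)[OF A T(1), of l] l unfolding T(2) S
            by (simp add: nth_Cons')
        qed
      qed
      then show "?g x \<in> ?X" using T(1) by (simp add: T_def)
    qed
    show "?f (?g x) = x" if "x \<in> (SIGMA I:?Is. ?Y I)" for x by (rule inv[OF that])
    show "?g (?f T) = T" if "T \<in> ?X" for T
    proof -
      have T: "T \<in> ssyt (Suc ?m) A" using that by simp
      have out: "T b = 0" if "b \<notin> A" for b using T that unfolding ssyt_def by blast
      have ge: "1 \<le> T b" if "b \<in> A" for b using T that unfolding ssyt_def semistandard_def by blast
      have "(if b \<in> A then Suc (T b - 1) else 0) = T b" for b using out[of b] ge[of b] by auto
      then show ?thesis by (simp only: prod.case fun_eq_iff) simp
    qed
  qed
  also have "\<dots> = (\<Sum>I\<in>?Is. card (?Y I))"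
    using finite_nw_ideals[OF fin] finite_ssyt[of "A - _"] fin by (intro card_SigmaI) auto
  finally have "int (kostka (Suc ?m) A (\<lambda>k. int ((p # ps) ! (k - 1)))) =
    (\<Sum>I\<in>?Is. int (kostka ?m (A - I) (\<lambda>k. int (ps ! (k - 1)))))"
    by (simp add: kostka_def)
  also have "\<dots> = (\<Sum>I\<in>?Is. strip_fillings (hword ps) (A - I))"
    using Cons.IH[OF skew_diagram_diff[OF A]] by (intro sum.cong) auto
  finally show ?case by simp
qed

section \<open>One horizontal strip followed by one vertical strip\<close>

definition right_linked :: "box set \<Rightarrow> box set" where
  "right_linked I = {(i, j) \<in> I. (i, Suc j) \<in> I}"

text \<open>A box with an upper neighbour in the ideal cannot lie in the horizontal strip, which
  would then contain the neighbour too; a right-linked box cannot lie in the vertical strip for the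
  dual reason. All other boxes may go either way.\<close>

definition up_linked :: "box set \<Rightarrow> box set" where
  "up_linked I = {(i, j) \<in> I. (i - 1, j) \<in> I}"

text \<open>A filling of an order ideal \<open>I\<close> by a horizontal strip \<open>J\<close> followed by a vertical strip is
  free exactly at the northeastern ends of the components of \<open>I\<close>.\<close>

lemma strip_pair_iff:
  assumes A: "skew_diagram A"
  shows "nw_ideal A J \<and> strip True J \<and> nw_ideal (A - J) K \<and> strip False K \<longleftrightarrow>
    nw_ideal A (J \<union> K) \<and> J \<inter> K = {} \<and> right_linked (J \<union> K) \<subseteq> J \<and> up_linked (J \<union> K) \<inter> J = {}"
    (is "?L \<longleftrightarrow> ?R")
proof
  assume ?L
  then have J: "nw_ideal A J" "inj_on snd J" and K: "nw_ideal (A - J) K" "inj_on fst K"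
    by (auto simp: strip_def)
  have sub: "J \<subseteq> A" "K \<subseteq> A - J" using nw_ideal_subset J K by auto
  have "c \<in> J \<union> K" if "b \<in> J \<union> K" "c \<in> A" "fst c \<le> fst b" "snd c \<le> snd b" for b c
    using that J(1) K(1) unfolding nw_ideal_def by blast
  then have I: "nw_ideal A (J \<union> K)" using sub unfolding nw_ideal_def by blast
  moreover have "J \<inter> K = {}" using sub by auto
  moreover have "right_linked (J \<union> K) \<subseteq> J"
  proof
    fix b assume "b \<in> right_linked (J \<union> K)"
    then obtain i j where b: "b = (i, j)" "(i, j) \<in> J \<union> K" "(i, Suc j) \<in> J \<union> K"
      by (auto simp: right_linked_def)
    show "b \<in> J"
    proof (rule ccontr)
      assume "b \<notin> J"
      then have m: "(i, j) \<in> K" "(i, j) \<in> A" using b sub by auto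
      have "(i, Suc j) \<notin> J" using nw_idealD[OF J(1), of i "Suc j" i j] m \<open>b \<notin> J\<close> b by auto
      then have "(i, Suc j) \<in> K" using b by auto
      then show False using inj_onD[OF K(2), of "(i, j)" "(i, Suc j)"] m by simp
    qed
  qed
  moreover have "up_linked (J \<union> K) \<inter> J = {}"
  proof (rule ccontr)
    assume "up_linked (J \<union> K) \<inter> J \<noteq> {}"
    then obtain i j where b: "(i, j) \<in> J" "(i - 1, j) \<in> J \<union> K" by (auto simp: up_linked_def)
    then have "(i - 1, j) \<in> J" using nw_idealD[OF J(1) b(1), of "i - 1" j] sub by auto
    moreover have "1 \<le> i" using skew_diagramD(2)[OF A, of i j] b sub by auto
    ultimately show False using inj_onD[OF J(2), of "(i, j)" "(i - 1, j)"] b by simp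
  qed
  ultimately show ?R by blast
next
  assume ?R
  then have I: "nw_ideal A (J \<union> K)" and dis: "J \<inter> K = {}" and R: "right_linked (J \<union> K) \<subseteq> J"
    and U: "up_linked (J \<union> K) \<inter> J = {}" by auto
  have sub: "J \<union> K \<subseteq> A" using nw_ideal_subset[OF I] .
  \<comment> \<open>A box of the diagram weakly northwest of \<open>(i, j)\<close> in a higher row
    would, by convexity, put the upper neighbour of \<open>(i, j)\<close> into the ideal.\<close>
  have up: "a = i" if "(a, d) \<in> A" "(i, j) \<in> J" "a \<le> i" "d \<le> j" for a d i j
  proof (rule ccontr)
    assume "a \<noteq> i"
    have "(i - 1, j) \<in> A"
      using skew_diagramD(4)[OF A that(1), of i j "i - 1" j] that sub \<open>a \<noteq> i\<close> by auto
    then have "(i - 1, j) \<in> J \<union> K" using nw_idealD[OF I, of i j "i - 1" j] that by auto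
    then have "(i, j) \<in> up_linked (J \<union> K)" using that by (auto simp: up_linked_def)
    then show False using U that by blast
  qed
  have right: "(i, d) \<in> right_linked (J \<union> K)" if "(i, d) \<in> A" "(i, j) \<in> J \<union> K" "d < j" for i d j
  proof -
    have "(i, Suc d) \<in> A"
      using skew_diagramD(4)[OF A that(1), of i j i "Suc d"] that sub by auto
    then show ?thesis
      using nw_idealD[OF I that(2), of i d] nw_idealD[OF I that(2), of i "Suc d"] that
      by (auto simp: right_linked_def)
  qed
  have J: "nw_ideal A J"
    unfolding nw_ideal_def
  proof (intro conjI ballI impI)
    fix b c assume *: "b \<in> J" "c \<in> A" "fst c \<le> fst b" "snd c \<le> snd b"
    obtain i j a d where bc: "b = (i, j)" "c = (a, d)" by fastforce
    have "a = i" using up[of a d i j] * bc by simp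
    then show "c \<in> J" using right[of i d j] * bc R by (cases "d = j") auto
  qed (use sub in auto)
  moreover have "inj_on snd J"
  proof (rule inj_onI)
    fix b c assume *: "b \<in> J" "c \<in> J" "snd b = snd c"
    obtain i j a where bc: "b = (i, j)" "c = (a, j)" using * by (cases b; cases c) auto
    have "(i, j) \<in> A" "(a, j) \<in> A" "(i, j) \<in> J" "(a, j) \<in> J" using * sub bc by auto
    then have "a = i" using up[of a j i j] up[of i j a j] by (metis nle_le order_refl)
    then show "b = c" using bc by simp
  qed
  moreover have "nw_ideal (A - J) K"
    using I sub dis unfolding nw_ideal_def by blast
  moreover have "inj_on fst K"
  proof (rule inj_onI)
    fix b c assume *: "b \<in> K" "c \<in> K" "fst b = fst c"
    obtain i j d where bc: "b = (i, j)" "c = (i, d)" using * by (cases b; cases c) auto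
    have m: "b \<in> A" "c \<in> A" "b \<notin> J" "c \<notin> J" using * sub dis by auto
    have "\<not> j < d" using right[of i j d] R m bc * by blast
    moreover have "\<not> d < j" using right[of i d j] R m bc * by blast
    ultimately show "b = c" using bc by simp
  qed
  ultimately show ?L by (simp add: strip_def)
qed

definition ribbon_pairs :: "box set \<Rightarrow> nat \<Rightarrow> (box set \<times> box set) set" where
  "ribbon_pairs A m = {(I, J). nw_ideal A I \<and> right_linked I \<subseteq> J \<and> J \<subseteq> I - up_linked I \<and> card I = m}"

lemma finite_ribbon_pairs: "finite A \<Longrightarrow> finite (ribbon_pairs A m)"
  by (rule finite_subset[of _ "Pow A \<times> Pow A"]) (auto simp: ribbon_pairs_def nw_ideal_def)

text \<open>Regrouping by the union \<open>I\<close> of the two strips separates the region removed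
  from the way in which it is split.\<close>

lemma strip_fillings_hv:
  assumes A: "skew_diagram A"
  shows "strip_fillings ((True, p) # (False, q) # W) A =
    (\<Sum>(I, J)\<in>{x \<in> ribbon_pairs A (p + q). card (snd x) = p}. strip_fillings W (A - I))"
proof -
  note fin = skew_diagramD(1)[OF A]
  let ?Js = "{J. nw_ideal A J \<and> strip True J \<and> card J = p}"
  let ?Ks = "\<lambda>J. {K. nw_ideal (A - J) K \<and> strip False K \<and> card K = q}"
  have "strip_fillings ((True, p) # (False, q) # W) A =
    (\<Sum>J\<in>?Js. \<Sum>K\<in>?Ks J. strip_fillings W (A - J - K))" by simp
  also have "\<dots> = (\<Sum>(J, K)\<in>(SIGMA J:?Js. ?Ks J). strip_fillings W (A - J - K))"
    using finite_nw_ideals[OF fin] finite_nw_ideals[OF finite_Diff[OF fin]] by (intro sum.Sigma) auto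
  also have "\<dots> = (\<Sum>(I, J)\<in>{x \<in> ribbon_pairs A (p + q). card (snd x) = p}. strip_fillings W (A - I))"
  proof (rule sum.reindex_bij_witness[of _ "\<lambda>(I, J). (J, I - J)" "\<lambda>(J, K). (J \<union> K, J)"])
    fix x assume "x \<in> (SIGMA J:?Js. ?Ks J)"
    then obtain J K where x: "x = (J, K)" and JK: "nw_ideal A J \<and> strip True J \<and> nw_ideal (A - J) K \<and> strip False K"
      and card: "card J = p" "card K = q" by auto
    note R = JK[unfolded strip_pair_iff[OF A]]
    have "J \<union> K \<subseteq> A" using R nw_ideal_subset by blast
    then have f: "finite J" "finite K" using fin finite_subset by auto
    show "(\<lambda>(I, J). (J, I - J)) ((\<lambda>(J, K). (J \<union> K, J)) x) = x" using R by (auto simp: x)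
    have "card (J \<union> K) = p + q" using card_Un_disjoint[OF f] R card by simp
    then have "(J \<union> K, J) \<in> ribbon_pairs A (p + q)" using R unfolding ribbon_pairs_def by blast
    then show "(\<lambda>(J, K). (J \<union> K, J)) x \<in> {x \<in> ribbon_pairs A (p + q). card (snd x) = p}"
      using card by (simp add: x)
    have "A - (J \<union> K) = A - J - K" by auto
    then show "(case (\<lambda>(J, K). (J \<union> K, J)) x of (I, J) \<Rightarrow> strip_fillings W (A - I)) =
      (case x of (J, K) \<Rightarrow> strip_fillings W (A - J - K))" by (simp add: x)
  next
    fix y assume y_in: "y \<in> {x \<in> ribbon_pairs A (p + q). card (snd x) = p}"
    obtain I J where y: "y = (I, J)" by fastforce
    have I: "nw_ideal A I" "right_linked I \<subseteq> J" "J \<subseteq> I - up_linked I"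
      and card: "card I = p + q" "card J = p" using y_in unfolding y ribbon_pairs_def by simp_all
    have IJ: "J \<union> (I - J) = I" using I by auto
    have "finite J" using I nw_ideal_subset[OF I(1)] fin by (meson Diff_subset finite_subset subset_trans)
    then have cK: "card (I - J) = q" using card I by (subst card_Diff_subset) auto
    have "nw_ideal A J \<and> strip True J \<and> nw_ideal (A - J) (I - J) \<and> strip False (I - J)"
      unfolding strip_pair_iff[OF A] IJ using I by auto
    then show "(\<lambda>(I, J). (J, I - J)) y \<in> (SIGMA J:?Js. ?Ks J)" using card cK by (simp add: y)
    show "(\<lambda>(J, K). (J \<union> K, J)) ((\<lambda>(I, J). (J, I - J)) y) = y" using IJ by (simp add: y)
  qed
  finally show ?thesis .
qed

text \<open>The last box of the top row. Rows start at 1 because for row 0 the truncated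
  \<open>i - 1\<close> would make a box its own upper neighbour.\<close>

lemma free_box_exists:
  assumes "finite I" "I \<noteq> {}" "\<And>i j. (i, j) \<in> I \<Longrightarrow> 1 \<le> i"
  shows "\<exists>b\<in>I. b \<notin> right_linked I \<and> b \<notin> up_linked I"
proof -
  define i where "i = Min (fst ` I)"
  have "i \<in> fst ` I" unfolding i_def using assms by (intro Min_in) auto
  then have ne: "{j. (i, j) \<in> I} \<noteq> {}" by auto
  have fin: "finite {j. (i, j) \<in> I}"
    by (rule finite_subset[OF _ finite_imageI[OF assms(1), of snd]]) force
  define j where "j = Max {j. (i, j) \<in> I}"
  have ij: "(i, j) \<in> I" using Max_in[OF fin ne] by (simp add: j_def)
  have "(i, Suc j) \<notin> I" using Max_ge[OF fin, of "Suc j"] by (auto simp: j_def)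
  moreover have "(i - 1, j) \<notin> I"
  proof
    assume "(i - 1, j) \<in> I"
    then have "i \<le> i - 1" unfolding i_def using assms(1) by (metis Min_le finite_imageI fst_conv imageI)
    then show False using assms(3)[OF ij] by simp
  qed
  ultimately show ?thesis using ij by (auto simp: right_linked_def up_linked_def)
qed

text \<open>Moving one free box of \<open>I\<close> between the two strips changes the parity of the
  horizontal one and leaves \<open>I\<close>, hence the remaining diagram, unchanged.\<close>

lemma alternating_hv:
  assumes A: "skew_diagram A" and m: "0 < m"
  shows "(\<Sum>p\<le>m. (-1) ^ p * strip_fillings ((True, p) # (False, m - p) # W) A) = 0"
proof -
  note fin = skew_diagramD(1)[OF A]
  let ?Y = "ribbon_pairs A m"
  let ?h = "\<lambda>x. (-1) ^ card (snd x) * strip_fillings W (A - fst x)"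
  have fY: "finite ?Y" by (rule finite_ribbon_pairs[OF fin])
  have finI: "finite I" "finite J" if "(I, J) \<in> ?Y" for I J
    using that fin unfolding ribbon_pairs_def
    by (auto dest!: nw_ideal_subset intro: finite_subset)
  have "(\<Sum>p\<le>m. (-1) ^ p * strip_fillings ((True, p) # (False, m - p) # W) A) =
    (\<Sum>p\<le>m. \<Sum>x\<in>{x \<in> ?Y. card (snd x) = p}. ?h x)"
  proof (rule sum.cong[OF refl])
    fix p assume "p \<in> {..m}"
    then show "(-1) ^ p * strip_fillings ((True, p) # (False, m - p) # W) A =
      (\<Sum>x\<in>{x \<in> ?Y. card (snd x) = p}. ?h x)"
      unfolding strip_fillings_hv[OF A] sum_distrib_left by (intro sum.cong) (auto simp: case_prod_unfold)
  qed
  also have "\<dots> = (\<Sum>x\<in>?Y. ?h x)"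
  proof (rule sum.group[OF fY])
    show "(\<lambda>x. card (snd x)) ` ?Y \<subseteq> {..m}"
    proof
      fix n assume "n \<in> (\<lambda>x. card (snd x)) ` ?Y"
      then obtain x where x: "x \<in> ?Y" "n = card (snd x)" by blast
      obtain I J where IJ: "x = (I, J)" by fastforce
      have "J \<subseteq> I" "card I = m" using x(1) unfolding IJ ribbon_pairs_def by auto
      then show "n \<in> {..m}" using card_mono[of I J] finI[of I J] x IJ by simp
    qed
  qed simp
  also have "\<dots> = 0"
  proof -
    \<comment> \<open>The chosen box depends on \<open>I\<close> alone, so moving it twice restores
      the pair.\<close>
    define f where "f = (\<lambda>I. SOME b. b \<in> I \<and> b \<notin> right_linked I \<and> b \<notin> up_linked I)"
    have f: "f I \<in> I" "f I \<notin> right_linked I" "f I \<notin> up_linked I" if "(I, J) \<in> ?Y" for I J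
    proof -
      have "I \<subseteq> A" "I \<noteq> {}" using that m nw_ideal_subset by (auto simp: ribbon_pairs_def)
      then have "\<exists>b. b \<in> I \<and> b \<notin> right_linked I \<and> b \<notin> up_linked I"
        using free_box_exists[of I] finI[OF that] skew_diagramD(2)[OF A] by blast
      from someI_ex[OF this] show "f I \<in> I" "f I \<notin> right_linked I" "f I \<notin> up_linked I"
        by (auto simp: f_def)
    qed
    define tog where "tog = (\<lambda>(I, J). (I, if f I \<in> J then J - {f I} else insert (f I) J))"
    have tog: "tog x \<in> ?Y \<and> tog (tog x) = x \<and> ?h (tog x) = - ?h x" if "x \<in> ?Y" for x
    proof -
      obtain I J where x: "x = (I, J)" by fastforce
      then have IJ: "(I, J) \<in> ?Y" using that by simp
      note fI = f[OF IJ]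
      have "tog x \<in> ?Y" using IJ fI by (auto simp: x tog_def ribbon_pairs_def)
      moreover have "tog (tog x) = x" by (auto simp: x tog_def)
      moreover have "?h (tog x) = - ?h x"
      proof (cases "f I \<in> J")
        case True
        then have "card J = Suc (card (J - {f I}))" using finI(2)[OF IJ] by (metis card.remove)
        then have "(-1 :: int) ^ card J = - ((-1) ^ card (J - {f I}))" by (simp only: power_Suc mult_minus1)
        then show ?thesis using True by (simp del: card_Diff_singleton add: x tog_def)
      next
        case False
        then show ?thesis using finI(2)[OF IJ] by (simp add: x tog_def)
      qed
      ultimately show ?thesis by blast
    qed
    have "(\<Sum>x\<in>?Y. ?h x) = (\<Sum>x\<in>?Y. - ?h x)"
      by (rule sum.reindex_bij_witness[of _ tog tog]) (use tog in auto)
    then show ?thesis by (simp add: sum_negf)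
  qed
  finally show ?thesis .
qed

text \<open>A linear relation valid for all skew diagrams survives any preceding letters, because
  these merely replace the diagram by smaller skew diagrams.\<close>

lemma strip_fillings_prefix_linear:
  assumes "finite S" and zero: "\<And>A. skew_diagram A \<Longrightarrow> (\<Sum>i\<in>S. c i * strip_fillings (X i) A) = 0"
    and "skew_diagram A"
  shows "(\<Sum>i\<in>S. c i * strip_fillings (pre @ X i) A) = 0"
  using assms(3)
proof (induction pre arbitrary: A)
  case Nil
  then show ?case using zero by simp
next
  case (Cons x pre)
  obtain h p where x: "x = (h, p)" by fastforce
  let ?Is = "{I. nw_ideal A I \<and> strip h I \<and> card I = p}"
  have "(\<Sum>i\<in>S. c i * strip_fillings ((x # pre) @ X i) A) =
    (\<Sum>i\<in>S. \<Sum>I\<in>?Is. c i * strip_fillings (pre @ X i) (A - I))"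
    by (simp add: x sum_distrib_left)
  also have "\<dots> = (\<Sum>I\<in>?Is. \<Sum>i\<in>S. c i * strip_fillings (pre @ X i) (A - I))" by (rule sum.swap)
  also have "\<dots> = 0" using Cons.IH[OF skew_diagram_diff[OF Cons.prems]] by (intro sum.neutral) auto
  finally show ?case .
qed

lemma nw_ideal_card_0: "finite A \<Longrightarrow> {I. nw_ideal A I \<and> strip h I \<and> card I = 0} = {{}}"
  by (auto simp: nw_ideal_def strip_def dest: finite_subset)

lemma strip_fillings_drop_0:
  assumes "skew_diagram A"
  shows "strip_fillings (pre @ (h, 0) # W) A = strip_fillings (pre @ W) A"
  using assms
proof (induction pre arbitrary: A)
  case Nil
  then show ?case using nw_ideal_card_0[OF skew_diagramD(1)] by simp
next
  case (Cons x pre)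
  obtain h p where x: "x = (h, p)" by fastforce
  show ?case
    using Cons.IH[OF skew_diagram_diff[OF Cons.prems]] by (auto simp: x intro!: sum.cong)
qed

text \<open>The alternating relation expresses the vertical letter of size \<open>m\<close> through
  words with an additional horizontal letter and a smaller vertical one, as the elementary symmetric
  functions are expressed through the complete ones. The prefix is arbitrary because it absorbs the
  new letter.\<close>

lemma strip_fillings_v_eq:
  assumes A: "skew_diagram A" and B: "skew_diagram B"
    and eq: "\<And>ps. strip_fillings (hword ps) A = strip_fillings (hword ps) B"
  shows "strip_fillings (hword ps @ (False, m) # hword qs) A = strip_fillings (hword ps @ (False, m) # hword qs) B"
proof (induction m arbitrary: ps rule: less_induct)
  case (less m)
  show ?case
  proof (cases "m = 0")
    case True
    then show ?thesis
      using eq[of "ps @ qs"] strip_fillings_drop_0[OF A] strip_fillings_drop_0[OF B] by simp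
  next
    case False
    let ?X = "\<lambda>p. hword ps @ (True, p) # (False, m - p) # hword qs"
    have rec: "strip_fillings (hword ps @ (False, m) # hword qs) C =
      - (\<Sum>p\<in>{..m} - {0}. (-1) ^ p * strip_fillings (?X p) C)" if C: "skew_diagram C" for C
    proof -
      have "(\<Sum>p\<in>{..m}. (-1) ^ p * strip_fillings (?X p) C) = 0"
        by (rule strip_fillings_prefix_linear[OF _ _ C]) (use alternating_hv False in auto)
      then have "strip_fillings (?X 0) C + (\<Sum>p\<in>{..m} - {0}. (-1) ^ p * strip_fillings (?X p) C) = 0"
        by (subst (asm) sum.remove[of _ 0]) auto
      moreover have "strip_fillings (?X 0) C = strip_fillings (hword ps @ (False, m) # hword qs) C"
        using strip_fillings_drop_0[OF C] by simp
      ultimately show ?thesis by linarith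
    qed
    have "strip_fillings (?X p) A = strip_fillings (?X p) B" if "p \<in> {..m} - {0}" for p
      using less[of "m - p" "ps @ [p]"] that False by simp
    then show ?thesis unfolding rec[OF A] rec[OF B] by (intro arg_cong[of _ _ uminus] sum.cong) auto
  qed
qed

section \<open>Northwest ribbons\<close>

lemma nw1_iff: "(i, j) \<in> nw1 A \<longleftrightarrow> (i, j) \<in> A \<and> (i - 1, j - 1) \<notin> A"
  by (simp add: nw1_def)

lemma nw_ideal_nw1:
  assumes A: "skew_diagram A"
  shows "nw_ideal A (nw1 A)"
  unfolding nw_ideal_def
proof (intro conjI ballI impI)
  fix b c assume *: "b \<in> nw1 A" "c \<in> A" "fst c \<le> fst b" "snd c \<le> snd b"
  obtain i j a d where bc: "b = (i, j)" "c = (a, d)" by fastforce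
  have b: "(i, j) \<in> A" "(i - 1, j - 1) \<notin> A" using * bc by (auto simp: nw1_iff)
  have "(a - 1, d - 1) \<notin> A"
  proof
    assume "(a - 1, d - 1) \<in> A"
    then have "(i - 1, j - 1) \<in> A" using skew_diagramD(4)[OF A _ b(1), of "a - 1" "d - 1" "i - 1" "j - 1"] * bc by auto
    then show False using b by simp
  qed
  then show "c \<in> nw1 A" using * bc by (simp add: nw1_iff)
qed (auto simp: nw1_def)

text \<open>If the diagonal predecessor of a box \<open>(i, j)\<close> of \<open>I\<close> were in
  \<open>A\<close>, then \<open>(i, j - 1)\<close> would be in \<open>I\<close> and linked both to
  the right and upwards.\<close>

lemma ribbon_pair_subset_nw1:
  assumes A: "skew_diagram A" and I: "nw_ideal A I" and dis: "right_linked I \<inter> up_linked I = {}"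
  shows "I \<subseteq> nw1 A"
proof
  fix b assume b: "b \<in> I"
  obtain i j where ij: "b = (i, j)" by fastforce
  have m: "(i, j) \<in> I" "(i, j) \<in> A" using b ij nw_ideal_subset[OF I] by auto
  have "(i - 1, j - 1) \<notin> A"
  proof
    assume d: "(i - 1, j - 1) \<in> A"
    have "1 \<le> j" using skew_diagramD(3)[OF A m(2)] .
    have "(i, j - 1) \<in> A" using skew_diagramD(4)[OF A d m(2), of i "j - 1"] by simp
    then have "(i, j - 1) \<in> I" "(i - 1, j - 1) \<in> I" using d nw_idealD[OF I m(1)] by auto
    then have "(i, j - 1) \<in> right_linked I" "(i, j - 1) \<in> up_linked I"
      using m \<open>1 \<le> j\<close> by (auto simp: right_linked_def up_linked_def)
    then show False using dis by blast
  qed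
  then show "b \<in> nw1 A" using m ij by (simp add: nw1_iff)
qed

lemma nw1_linked_disjoint: "right_linked (nw1 A) \<inter> up_linked (nw1 A) = {}"
  by (auto simp: right_linked_def up_linked_def nw1_def)

text \<open>The ways of splitting the whole ribbon. Their number is the coefficient of x^p in x^a (1
  + x)^r, with \<open>a\<close> right-linked boxes and \<open>r\<close> free ends.\<close>

definition nw_splits :: "box set \<Rightarrow> nat \<Rightarrow> box set set" where
  "nw_splits A p = {J. right_linked (nw1 A) \<subseteq> J \<and> J \<subseteq> nw1 A - up_linked (nw1 A) \<and> card J = p}"

lemma strip_fillings_above_nw1:
  assumes A: "skew_diagram A" and pq: "card (nw1 A) < p + q"
  shows "strip_fillings ((True, p) # (False, q) # W) A = 0"
proof -
  have "ribbon_pairs A (p + q) = {}"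
  proof (rule ccontr)
    assume "ribbon_pairs A (p + q) \<noteq> {}"
    then obtain I J where I: "nw_ideal A I" "right_linked I \<subseteq> J" "J \<subseteq> I - up_linked I" "card I = p + q"
      unfolding ribbon_pairs_def by blast
    have "finite (nw1 A)" using skew_diagramD(1)[OF A] by (auto simp: nw1_def intro: finite_subset)
    moreover have "I \<subseteq> nw1 A" using I by (intro ribbon_pair_subset_nw1[OF A I(1)]) blast
    ultimately show False using card_mono[of "nw1 A" I] I(4) pq by simp
  qed
  then show ?thesis unfolding strip_fillings_hv[OF A] by simp
qed

text \<open>In the largest possible degree the region \<open>I\<close> must be the whole ribbon, so
  the count factors.\<close>

lemma strip_fillings_nw1:
  assumes A: "skew_diagram A" and pq: "p + q = card (nw1 A)"
  shows "strip_fillings ((True, p) # (False, q) # W) A =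
    int (card (nw_splits A p)) * strip_fillings W (A - nw1 A)"
proof -
  let ?N = "nw1 A"
  have fN: "finite ?N" using skew_diagramD(1)[OF A] by (auto simp: nw1_def intro: finite_subset)
  have top: "I = ?N" if "nw_ideal A I" "right_linked I \<subseteq> J" "J \<subseteq> I - up_linked I" "card I = p + q" for I J
  proof (rule card_subset_eq[OF fN])
    show "I \<subseteq> ?N" using that by (intro ribbon_pair_subset_nw1[OF A that(1)]) blast
    show "card I = card ?N" using that pq by simp
  qed
  have "{x \<in> ribbon_pairs A (p + q). card (snd x) = p} = Pair ?N ` nw_splits A p"
  proof
    show "{x \<in> ribbon_pairs A (p + q). card (snd x) = p} \<subseteq> Pair ?N ` nw_splits A p"
    proof
      fix x assume x: "x \<in> {x \<in> ribbon_pairs A (p + q). card (snd x) = p}"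
      obtain I J where IJ: "x = (I, J)" by fastforce
      have I: "nw_ideal A I" "right_linked I \<subseteq> J" "J \<subseteq> I - up_linked I" "card I = p + q" "card J = p"
        using x unfolding IJ ribbon_pairs_def by simp_all
      then have "J \<in> nw_splits A p" unfolding nw_splits_def top[OF I(1-4), symmetric] by blast
      then show "x \<in> Pair ?N ` nw_splits A p" using IJ top[OF I(1-4)] by blast
    qed
    show "Pair ?N ` nw_splits A p \<subseteq> {x \<in> ribbon_pairs A (p + q). card (snd x) = p}"
      using nw_ideal_nw1[OF A] pq by (auto simp: ribbon_pairs_def nw_splits_def)
  qed
  then have "strip_fillings ((True, p) # (False, q) # W) A =
    (\<Sum>(I, J)\<in>Pair ?N ` nw_splits A p. strip_fillings W (A - I))"
    unfolding strip_fillings_hv[OF A] by simp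
  also have "\<dots> = (\<Sum>J\<in>nw_splits A p. strip_fillings W (A - ?N))"
    by (subst sum.reindex) (auto simp: inj_on_def)
  finally show ?thesis by simp
qed

text \<open>A splitting consists of the right-linked boxes and an arbitrary set of free ends; taking
  none or all of them leaves no choice.\<close>

lemma card_nw_splits:
  assumes A: "skew_diagram A"
  shows "card (nw_splits A (card (right_linked (nw1 A)))) = 1"
    and "card (nw_splits A (card (nw1 A - up_linked (nw1 A)))) = 1"
    and "card (nw_splits A p) \<noteq> 0 \<Longrightarrow> card (right_linked (nw1 A)) \<le> p \<and> p \<le> card (nw1 A - up_linked (nw1 A))"
proof -
  let ?R = "right_linked (nw1 A)" and ?V = "nw1 A - up_linked (nw1 A)"
  have fV: "finite ?V" using skew_diagramD(1)[OF A] by (auto simp: nw1_def intro: finite_subset)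
  have RV: "?R \<subseteq> ?V" using nw1_linked_disjoint by (auto simp: right_linked_def)
  have "J = ?R" if "J \<in> nw_splits A (card ?R)" for J
  proof -
    have "?R \<subseteq> J" "finite J" "card J = card ?R" using that fV finite_subset by (auto simp: nw_splits_def)
    then show ?thesis using card_subset_eq[of J ?R] by auto
  qed
  moreover have "?R \<in> nw_splits A (card ?R)" using RV by (simp add: nw_splits_def)
  ultimately have "nw_splits A (card ?R) = {?R}" by blast
  then show "card (nw_splits A (card ?R)) = 1" by simp
  have "J = ?V" if "J \<in> nw_splits A (card ?V)" for J
    using that card_subset_eq[OF fV, of J] by (simp add: nw_splits_def)
  moreover have "?V \<in> nw_splits A (card ?V)" using RV by (simp add: nw_splits_def)
  ultimately have "nw_splits A (card ?V) = {?V}" by blast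
  then show "card (nw_splits A (card ?V)) = 1" by simp
  assume "card (nw_splits A p) \<noteq> 0"
  then obtain J where J: "?R \<subseteq> J" "J \<subseteq> ?V" "card J = p"
    unfolding nw_splits_def by (metis (mono_tags, lifting) card.empty empty_Collect_eq)
  then show "card ?R \<le> p \<and> p \<le> card ?V"
    using card_mono[OF fV J(2)] card_mono[OF finite_subset[OF J(2) fV] J(1)] by simp
qed

text \<open>Each row has exactly one box that is not right-linked, its last, and each column exactly
  one that is not up-linked, its top.\<close>

lemma card_linked:
  assumes N: "skew_diagram N"
  shows "card N = card (right_linked N) + card (fst ` N)"
    and "card (N - up_linked N) = card (snd ` N)"
proof -
  note fin = skew_diagramD(1)[OF N]
  have "bij_betw fst (N - right_linked N) (fst ` N)"
    unfolding bij_betw_def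
  proof
    show "inj_on fst (N - right_linked N)"
    proof (rule inj_onI)
      fix b c assume *: "b \<in> N - right_linked N" "c \<in> N - right_linked N" "fst b = fst c"
      obtain i j d where bc: "b = (i, j)" "c = (i, d)" using * by (cases b; cases c) auto
      have "(i, Suc j) \<in> N" if "j < d"
        using skew_diagramD(4)[OF N, of i j i d i "Suc j"] that * bc by simp
      moreover have "(i, Suc d) \<in> N" if "d < j"
        using skew_diagramD(4)[OF N, of i d i j i "Suc d"] that * bc by simp
      ultimately show "b = c" using * bc by (cases j d rule: linorder_cases) (auto simp: right_linked_def)
    qed
    show "fst ` (N - right_linked N) = fst ` N"
    proof
      show "fst ` N \<subseteq> fst ` (N - right_linked N)"
      proof
        fix i assume "i \<in> fst ` N"
        then have ne: "{j. (i, j) \<in> N} \<noteq> {}" by auto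
        have f: "finite {j. (i, j) \<in> N}"
          by (rule finite_subset[OF _ finite_imageI[OF fin, of snd]]) force
        define j where "j = Max {j. (i, j) \<in> N}"
        have "(i, j) \<in> N" using Max_in[OF f ne] by (simp add: j_def)
        moreover have "(i, Suc j) \<notin> N" using Max_ge[OF f, of "Suc j"] by (auto simp: j_def)
        ultimately have "(i, j) \<in> N - right_linked N" by (simp add: right_linked_def)
        then show "i \<in> fst ` (N - right_linked N)" by force
      qed
    qed auto
  qed
  then have "card (N - right_linked N) = card (fst ` N)" by (rule bij_betw_same_card)
  moreover have sub: "right_linked N \<subseteq> N" by (auto simp: right_linked_def)
  ultimately show "card N = card (right_linked N) + card (fst ` N)"
    using card_Diff_subset[OF finite_subset[OF sub fin] sub] card_mono[OF fin sub] by simp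
  have "bij_betw snd (N - up_linked N) (snd ` N)"
    unfolding bij_betw_def
  proof
    show "inj_on snd (N - up_linked N)"
    proof (rule inj_onI)
      fix b c assume *: "b \<in> N - up_linked N" "c \<in> N - up_linked N" "snd b = snd c"
      obtain i j a where bc: "b = (i, j)" "c = (a, j)" using * by (cases b; cases c) auto
      have "(a - 1, j) \<in> N" if "i < a"
        using skew_diagramD(4)[OF N, of i j a j "a - 1" j] that * bc by simp
      moreover have "(i - 1, j) \<in> N" if "a < i"
        using skew_diagramD(4)[OF N, of a j i j "i - 1" j] that * bc by simp
      ultimately show "b = c" using * bc by (cases i a rule: linorder_cases) (auto simp: up_linked_def)
    qed
    show "snd ` (N - up_linked N) = snd ` N"
    proof
      show "snd ` N \<subseteq> snd ` (N - up_linked N)"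
      proof
        fix j assume "j \<in> snd ` N"
        then obtain i' where i': "(i', j) \<in> N" by auto
        define i where "i = (LEAST i. (i, j) \<in> N)"
        have i: "(i, j) \<in> N" unfolding i_def by (rule LeastI[of _ i']) (rule i')
        have "1 \<le> i" using skew_diagramD(2)[OF N i] .
        then have "(i - 1, j) \<notin> N" using not_less_Least[of "i - 1" "\<lambda>i. (i, j) \<in> N"] by (simp add: i_def)
        with i have "(i, j) \<in> N - up_linked N" by (simp add: up_linked_def)
        then show "j \<in> snd ` (N - up_linked N)" by force
      qed
    qed auto
  qed
  then show "card (N - up_linked N) = card (snd ` N)" by (rule bij_betw_same_card)
qed

section \<open>Counting the component ribbons by their northeastern ends\<close>

definition ribbon_next :: "box set \<Rightarrow> (box \<times> box) set" where
  "ribbon_next N = {((i, j), c). (i, j) \<in> N \<and> c \<in> N \<and>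
     c = (if (i, Suc j) \<in> N then (i, Suc j) else (i - 1, j))}"

lemma ribbon_next_row:
  assumes N: "skew_diagram N" and m: "(i, j) \<in> N" "(i, j') \<in> N" "j \<le> j'"
  shows "((i, j), (i, j')) \<in> (ribbon_next N)\<^sup>*"
  using m(3)
proof (induction j' rule: dec_induct)
  case base
  then show ?case by simp
next
  case (step d)
  have "(i, d) \<in> N" "(i, Suc d) \<in> N"
    using skew_diagramD(4)[OF N m(1,2), of i d] skew_diagramD(4)[OF N m(1,2), of i "Suc d"] step by auto
  then have "((i, d), (i, Suc d)) \<in> ribbon_next N" by (simp add: ribbon_next_def)
  with step.IH show ?case by (rule rtrancl_into_rtrancl)
qed

text \<open>A box with an upper neighbour has no right neighbour by \<open>dis\<close>, so the walk,
  which prefers to go right, is forced upwards.\<close>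

lemma ribbon_next_column:
  assumes N: "skew_diagram N" and dis: "right_linked N \<inter> up_linked N = {}"
    and m: "(i, j) \<in> N" "(i', j) \<in> N" "i' \<le> i"
  shows "((i, j), (i', j)) \<in> (ribbon_next N)\<^sup>*"
  using m(3)
proof (induction i' rule: inc_induct)
  case base
  then show ?case by simp
next
  case (step a)
  have "(a, j) \<in> N" "(Suc a, j) \<in> N"
    using skew_diagramD(4)[OF N m(2,1), of a j] skew_diagramD(4)[OF N m(2,1), of "Suc a" j] step by auto
  moreover from this have "(Suc a, Suc j) \<notin> N"
    using dis by (auto simp: right_linked_def up_linked_def)
  ultimately have "((Suc a, j), (a, j)) \<in> ribbon_next N" by (simp add: ribbon_next_def)
  with step.IH show ?case by (rule rtrancl_into_rtrancl)
qed

lemma ribbon_next_linked: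
  assumes N: "skew_diagram N" and dis: "right_linked N \<inter> up_linked N = {}" and bc: "(b, c) \<in> box_linked N"
  shows "(b, c) \<in> (ribbon_next N)\<^sup>* \<or> (c, b) \<in> (ribbon_next N)\<^sup>*"
proof -
  obtain i j a d where e: "b = (i, j)" "c = (a, d)" by fastforce
  have m: "(i, j) \<in> N" "(a, d) \<in> N" "i = a \<or> j = d" using bc e by (auto simp: box_linked_def)
  then show ?thesis
    using ribbon_next_row[OF N, of i j d] ribbon_next_row[OF N, of i d j]
      ribbon_next_column[OF N dis, of i j a] ribbon_next_column[OF N dis, of a j i] e
    by (metis nle_le)
qed

text \<open>Walking right if possible and up otherwise leads every box of a component to the
  northeastern end of that component.\<close>

lemma num_ribbons_eq:
  assumes N: "skew_diagram N" and dis: "right_linked N \<inter> up_linked N = {}"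
  shows "num_ribbons N = card (N - right_linked N - up_linked N)"
proof -
  note fin = skew_diagramD(1)[OF N]
  let ?L = "(box_linked N)\<^sup>+" and ?F = "N - right_linked N - up_linked N"
  note eqv = equiv_box_linked[of N]
  have sv: "single_valued (ribbon_next N)" by (auto simp: single_valued_def ribbon_next_def)
  have terminal: "c = f" if f: "f \<in> ?F" and "(f, c) \<in> (ribbon_next N)\<^sup>*" for f c
    using that(2)
  proof (cases rule: converse_rtranclE)
    case (step y)
    then show ?thesis
      using f by (auto simp: ribbon_next_def right_linked_def up_linked_def split: if_splits)
  qed simp
  \<comment> \<open>Follows a chain of links out of \<open>f\<close>. Since the walk is
    deterministic and stops at \<open>f\<close>, a box met on a walk towards \<open>f\<close> again
    leads to \<open>f\<close>.\<close>
  have reach: "(c, f) \<in> (ribbon_next N)\<^sup>*" if f: "f \<in> ?F" and "(f, c) \<in> ?L" for f c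
    using that(2)
  proof (induction rule: trancl_induct)
    case (base c)
    then show ?case using ribbon_next_linked[OF N dis base] terminal[OF f] by blast
  next
    case (step b c)
    from ribbon_next_linked[OF N dis step.hyps(2)] show ?case
    proof
      assume "(b, c) \<in> (ribbon_next N)\<^sup>*"
      then show ?thesis using single_valued_confluent[OF sv step.IH] terminal[OF f] by blast
    next
      assume "(c, b) \<in> (ribbon_next N)\<^sup>*"
      then show ?thesis using step.IH by (rule rtrancl_trans)
    qed
  qed
  have "bij_betw (\<lambda>f. ?L `` {f}) ?F (components N)"
    unfolding bij_betw_def
  proof
    show "inj_on (\<lambda>f. ?L `` {f}) ?F"
    proof (rule inj_onI)
      fix f g assume *: "f \<in> ?F" "g \<in> ?F" "?L `` {f} = ?L `` {g}"
      then have "(f, g) \<in> ?L" using eq_equiv_class[OF _ eqv] by blast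
      then have "(g, f) \<in> (ribbon_next N)\<^sup>*" by (rule reach[OF *(1)])
      then show "f = g" by (rule terminal[OF *(2)])
    qed
    show "(\<lambda>f. ?L `` {f}) ` ?F = components N"
    proof
      show "(\<lambda>f. ?L `` {f}) ` ?F \<subseteq> components N" unfolding components_def by (auto intro: quotientI)
      show "components N \<subseteq> (\<lambda>f. ?L `` {f}) ` ?F"
      proof
        fix C assume C: "C \<in> components N"
        note c = skew_diagram_component[OF N C]
        have "C \<noteq> {}" using c(2) by (simp add: connected_boxes_def)
        then obtain f where f: "f \<in> C" "f \<notin> right_linked C" "f \<notin> up_linked C"
          using free_box_exists[of C] skew_diagramD(1,2)[OF c(1)] by blast
        have CL: "C = ?L `` {f}" using C f(1) eqv unfolding components_def by (metis Image_singleton_iff equiv_class_eq quotientE)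
        have closed: "d \<in> C" if "d \<in> N" "fst d = fst f \<or> snd d = snd f" for d
          unfolding CL using that f(1) c(3) by (auto simp: box_linked_def)
        have "f \<in> ?F"
          using f c(3) closed by (cases f) (auto simp: right_linked_def up_linked_def)
        then show "C \<in> (\<lambda>f. ?L `` {f}) ` ?F" using CL by blast
      qed
    qed
  qed
  then show ?thesis unfolding num_ribbons_def by (metis bij_betw_same_card)
qed

text \<open>Free ends are the top boxes of columns minus the right-linked boxes, and the latter
  number the size minus the rows. This reduces the number of components to the three cardinalities
  that the fillings determine.\<close>

lemma num_ribbons_nw1:
  assumes "skew_diagram A"
  shows "num_ribbons (nw1 A) + card (nw1 A) = card (fst ` nw1 A) + card (snd ` nw1 A)"
proof -
  let ?N = "nw1 A"
  note N = skew_diagram_nw1(1)[OF assms]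
  note fin = skew_diagramD(1)[OF N]
  have sub: "right_linked ?N \<subseteq> ?N - up_linked ?N"
    using nw1_linked_disjoint by (auto simp: right_linked_def)
  have "?N - right_linked ?N - up_linked ?N = (?N - up_linked ?N) - right_linked ?N" by blast
  then have "num_ribbons ?N = card (?N - up_linked ?N) - card (right_linked ?N)"
    using num_ribbons_eq[OF N nw1_linked_disjoint] card_Diff_subset[OF _ sub] finite_subset[OF sub] fin by simp
  moreover have "card (right_linked ?N) \<le> card (?N - up_linked ?N)" using sub fin by (intro card_mono) auto
  ultimately show ?thesis using card_linked[OF N] by simp
qed

text \<open>The support of the pairs \<open>(p, q)\<close> is common to both diagrams. Its largest
  total is the size of the ribbon; among the pairs with this total the smallest \<open>p\<close> is
  the number of right-linked boxes, which gives the rows, and the largest \<open>p\<close> is the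
  number of columns. At the smallest \<open>p\<close> the leading factor is 1, so the counts of the
  remaining diagrams agree.\<close>

lemma strip_fillings_remove_nw1:
  assumes A: "skew_diagram A" and B: "skew_diagram B"
    and eq: "\<And>ps. strip_fillings (hword ps) A = strip_fillings (hword ps) B"
  shows "card (nw1 A) = card (nw1 B)" "card (fst ` nw1 A) = card (fst ` nw1 B)"
    "card (snd ` nw1 A) = card (snd ` nw1 B)"
    "strip_fillings (hword ps) (A - nw1 A) = strip_fillings (hword ps) (B - nw1 B)"
proof -
  define Q where "Q = (\<lambda>A p q. \<exists>ps. strip_fillings ((True, p) # (False, q) # hword ps) A \<noteq> 0)"
  have hv: "strip_fillings ((True, p) # (False, q) # hword ps) A = strip_fillings ((True, p) # (False, q) # hword ps) B"
    for p q ps using strip_fillings_v_eq[OF A B eq, of "[p]" q ps] by simp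
  have QQ: "Q A = Q B" by (simp add: Q_def fun_eq_iff hv del: strip_fillings.simps)
  have le: "p + q \<le> card (nw1 C)" if "skew_diagram C" "Q C p q" for C p q
    using strip_fillings_above_nw1[OF that(1), of p q] that(2) unfolding Q_def by (metis not_le)
  have mid: "card (right_linked (nw1 C)) \<le> p \<and> p \<le> card (snd ` nw1 C)"
    if C: "skew_diagram C" and "Q C p q" and pq: "p + q = card (nw1 C)" for C p q
  proof -
    have "card (nw_splits C p) \<noteq> 0"
      using that(2) strip_fillings_nw1[OF C pq] unfolding Q_def by auto
    then show ?thesis
      using card_nw_splits(3)[OF C] card_linked(2)[OF skew_diagram_nw1(1)[OF C]] by simp
  qed
  have split: "card (right_linked (nw1 C)) + card (fst ` nw1 C) = card (nw1 C)"
    "card (snd ` nw1 C) + (card (nw1 C) - card (snd ` nw1 C)) = card (nw1 C)" if C: "skew_diagram C" for C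
    using card_linked[OF skew_diagram_nw1(1)[OF C]] card_image_le[OF skew_diagramD(1)[OF skew_diagram_nw1(1)[OF C]], of snd]
    by auto
  have low: "strip_fillings ((True, card (right_linked (nw1 C))) # (False, card (fst ` nw1 C)) # W) C =
    strip_fillings W (C - nw1 C)" if C: "skew_diagram C" for C W
    using strip_fillings_nw1[OF C split(1)[OF C]] card_nw_splits(1)[OF C] by (simp del: strip_fillings.simps)
  have high: "strip_fillings ((True, card (snd ` nw1 C)) # (False, card (nw1 C) - card (snd ` nw1 C)) # W) C =
    strip_fillings W (C - nw1 C)" if C: "skew_diagram C" for C W
    using strip_fillings_nw1[OF C split(2)[OF C]] card_nw_splits(2)[OF C] card_linked(2)[OF skew_diagram_nw1(1)[OF C]]
    by (simp del: strip_fillings.simps)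
  \<comment> \<open>A standard filling of the remaining diagram keeps the extreme coefficients from
    vanishing, so the bounds on the support are attained.\<close>
  have std: "\<exists>ps. strip_fillings (hword ps) (C - nw1 C) \<noteq> 0" if C: "skew_diagram C" for C
    using strip_fillings_standard[of "C - nw1 C"] skew_diagramD(1)[OF C] by blast
  have Qlow: "Q C (card (right_linked (nw1 C))) (card (fst ` nw1 C))" if C: "skew_diagram C" for C
    unfolding Q_def low[OF C] by (rule std[OF C])
  have Qhigh: "Q C (card (snd ` nw1 C)) (card (nw1 C) - card (snd ` nw1 C))" if C: "skew_diagram C" for C
    unfolding Q_def high[OF C] by (rule std[OF C])
  show card: "card (nw1 A) = card (nw1 B)"
    using le[OF A, of "card (right_linked (nw1 B))" "card (fst ` nw1 B)"] Qlow[OF B]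
      le[OF B, of "card (right_linked (nw1 A))" "card (fst ` nw1 A)"] Qlow[OF A] split(1)[OF A] split(1)[OF B]
    unfolding QQ by simp
  have R: "card (right_linked (nw1 A)) = card (right_linked (nw1 B))"
    using mid[OF A, of "card (right_linked (nw1 B))" "card (fst ` nw1 B)"] Qlow[OF B]
      mid[OF B, of "card (right_linked (nw1 A))" "card (fst ` nw1 A)"] Qlow[OF A] split(1)[OF A] split(1)[OF B] card
    unfolding QQ by simp
  then show rows: "card (fst ` nw1 A) = card (fst ` nw1 B)" using split(1)[OF A] split(1)[OF B] card by simp
  show "card (snd ` nw1 A) = card (snd ` nw1 B)"
    using mid[OF A, of "card (snd ` nw1 B)" "card (nw1 B) - card (snd ` nw1 B)"] Qhigh[OF B]
      mid[OF B, of "card (snd ` nw1 A)" "card (nw1 A) - card (snd ` nw1 A)"] Qhigh[OF A] split(2)[OF A] split(2)[OF B] card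
    unfolding QQ by simp
  show "strip_fillings (hword ps) (A - nw1 A) = strip_fillings (hword ps) (B - nw1 B)"
    unfolding low[OF A, symmetric] low[OF B, symmetric] R rows by (rule hv)
qed

text \<open>Needed in both directions: to start the induction from the given characters and to
  return from the counts to the characters of the remaining diagrams.\<close>

lemma skew_character_iff_strip_fillings:
  assumes A: "skew_diagram A" and B: "skew_diagram B"
  shows "skew_character A = skew_character B \<longleftrightarrow>
    (\<forall>ps. strip_fillings (hword ps) A = strip_fillings (hword ps) B)"
proof -
  have card: "card A = card B" if eq: "\<forall>ps. strip_fillings (hword ps) A = strip_fillings (hword ps) B"
  proof -
    \<comment> \<open>Only words whose letters add up to the size have fillings, so a standard word
      of \<open>A\<close> with fillings of \<open>B\<close> forces equal sizes.\<close>
    have "strip_fillings (hword (replicate (card A) 1)) B \<noteq> 0"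
      using strip_fillings_standard[OF skew_diagramD(1)[OF A]] eq by metis
    from strip_fillings_card[OF skew_diagramD(1)[OF B] this] show ?thesis
      by (simp add: o_def sum_list_replicate)
  qed
  have "(\<forall>n al. kostka n A al = kostka n B al) \<longleftrightarrow>
    (\<forall>ps. strip_fillings (hword ps) A = strip_fillings (hword ps) B)"
  proof
    assume eq: "\<forall>ps. strip_fillings (hword ps) A = strip_fillings (hword ps) B"
    show "\<forall>n al. kostka n A al = kostka n B al"
    proof (intro allI)
      fix n and al :: "nat \<Rightarrow> int"
      show "kostka n A al = kostka n B al"
      proof (cases "\<forall>k\<in>{1..n}. 0 \<le> al k")
        case True
        \<comment> \<open>The successor compensates for list positions starting at 0, whereas
          contents start at 1.\<close>
        let ?ps = "map (\<lambda>k. nat (al (Suc k))) [0..<n]"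
        have "kostka n C al = kostka (length ?ps) C (\<lambda>k. int (?ps ! (k - 1)))" for C
          unfolding length_map length_upt diff_zero using True by (intro kostka_cong) auto
        then show ?thesis
          using eq[rule_format, of ?ps] unfolding strip_fillings_kostka[OF A] strip_fillings_kostka[OF B] by simp
      next
        case False
        \<comment> \<open>A negative prescribed number of entries admits no tableau.\<close>
        then have "{T \<in> ssyt n C. content_is n C T al} = {}" for C
          unfolding content_is_def by (metis (mono_tags, lifting) empty_Collect_eq of_nat_0_le_iff)
        then show ?thesis by (simp only: kostka_def)
      qed
    qed
  qed (simp add: strip_fillings_kostka[OF A] strip_fillings_kostka[OF B])
  then show ?thesis
    using lr_tableaux_iff_kostka[OF A B] card unfolding skew_character_eq_iff by blast
qed

theorem theorem6p1:
  fixes A B :: "box set"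
  assumes "skew_diagram A" and "skew_diagram B"
    and "skew_character A = skew_character B"
  shows "pi_nw A = pi_nw B \<and>
    (\<forall>i\<ge>1. num_ribbons (nw i A) = num_ribbons (nw i B)) \<and>
    (\<forall>i\<ge>1. arm_length (nw i A) = arm_length (nw i B) \<and>
            leg_length (nw i A) = leg_length (nw i B)) \<and>
    (\<forall>i. skew_character (remove_nw i A) = skew_character (remove_nw i B))"
proof -
  note A = skew_diagram_remove_nw[OF assms(1)] and B = skew_diagram_remove_nw[OF assms(2)]
  \<comment> \<open>The counts for all \<open>ps\<close> are the invariant: removing a ribbon needs
    all of them as input and returns all of them.\<close>
  have eq: "strip_fillings (hword ps) (remove_nw i A) = strip_fillings (hword ps) (remove_nw i B)" for i ps
  proof (induction i arbitrary: ps)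
    case 0
    then show ?case
      using assms skew_character_iff_strip_fillings[OF assms(1,2)] by (simp add: remove_nw_def)
  next
    case (Suc i)
    show ?case unfolding remove_nw_Suc by (rule strip_fillings_remove_nw1(4)[OF A B Suc.IH])
  qed
  have nw: "nw (Suc i) C = nw1 (remove_nw i C)" for i C by (simp add: remove_nw_def)
  note nw1_eq = strip_fillings_remove_nw1(1-3)[OF A B eq]
  have ribbons: "num_ribbons (nw (Suc i) A) = num_ribbons (nw (Suc i) B)" for i
    using num_ribbons_nw1[OF A, of i] num_ribbons_nw1[OF B, of i] nw1_eq[of i] unfolding nw by linarith
  have "pi_nw A = pi_nw B" using nw1_eq(1) by (simp add: pi_nw_def fun_eq_iff nw del: nw.simps)
  moreover have "num_ribbons (nw i A) = num_ribbons (nw i B) \<and> arm_length (nw i A) = arm_length (nw i B) \<and>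
    leg_length (nw i A) = leg_length (nw i B)" if "1 \<le> i" for i
    using ribbons[of "i - 1"] nw1_eq[of "i - 1"] nw[of "i - 1"] that
    by (simp add: arm_length_def leg_length_def)
  moreover have "skew_character (remove_nw i A) = skew_character (remove_nw i B)" for i
    using skew_character_iff_strip_fillings[OF A B] eq by blast
  ultimately show ?thesis by blast
qed

end
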